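(* Consider the attitude and gyroscope-bias estimation problem and the Riccati observer described in the context. Suppose that the angular velocity $\Omega(t)$ is continuous and bounded, that the measurement directions $a_j^{(i)}(t)$, $b_i(t)$ ($i=1,\dots,p$, $j=1,\dots,n_i$) are uniformly continuous and bounded on $[0,\infty)$, and that there exist constants $\delta,\mu>0$ such that for all $t\ge0$ both $$W^{A_\lambda^\star,C_\lambda^\star}(t,t+\delta):=\frac1\delta\int_t^{t+\delta}\sum_{i=1}^pC_i^{\star\top}(s)C_i^\star(s)\,ds\ \succeq\ \mu I_3$$ and $$W^{\bar C^\star}(t,t+\delta):=\frac1\delta\int_t^{t+\delta}\sum_{i=1}^p\bar C_i^{\star\top}(s,t,\delta)\,\bar C_i^\star(s,t,\delta)\,ds\ \succeq\ \mu I_3,$$ where $$C_i^\star(s):=\Lambda_i^\top(s)R^\top(s)\,b_i(s)^\times,\qquad \bar C_i^\star(s,t,\delta):=C_i^\star(s)\Big(\int_t^sR(\tau)\,d\tau-\rho(t,\delta)\Big),$$ $$\rho(t,\delta):=\frac1\delta\Big(W^{A_\lambda^\star,C_\lambda^\star}(t,t+\delta)\Big)^{-1}\int_t^{t+\delta}\sum_{i=1}^pC_i^{\star\top}(s)C_i^\star(s)\int_t^sR(\tau)\,d\tau\,ds .$$ Then the pair $(A^\star(t),C^\star(t))$ is uniformly observable, and the equilibrium $(\tilde R,\tilde d)=(I_3,0)$ of the estimation error is locally exponentially stable.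
   Context: For $\omega\in\mathbb{R}^3$, $\omega^\times$ is the skew-symmetric matrix with $\omega^\times y=\omega\times y$ for all $y\in\mathbb{R}^3$. $\mathbf{SO}(3)$ is the group of $3\times3$ rotation matrices. For symmetric matrices, $X\succeq Y$ means $X-Y$ is positive semidefinite. System: $R(t)\in\mathbf{SO}(3)$ and an unknown constant bias $d\in\mathbb{R}^3$ satisfy $\dot R=R\,\Omega^\times=R(\Omega_y-d)^\times$, $\dot d=0$, where $\Omega_y=\Omega+d$ is the measured angular velocity. Outputs: for $i=1,\dots,p$, $y_i:=\Lambda_i^\top R^\top b_i\in\mathbb{R}^{n_i}$ with $n_i\ge 1$ and $\Lambda_i:=[a_1^{(i)}\ \cdots\ a_{n_i}^{(i)}]\in\mathbb{R}^{3\times n_i}$, where $a_j^{(i)}(t),b_i(t)\in\mathbb{R}^3$ are known; $m=\sum_{i=1}^pn_i$. Observer: $\dot{\hat R}=\hat R(\Omega_y-\hat d)^\times+\Delta_R^\times\hat R$, $\dot{\hat d}=-\Delta_d$, with $\hat R(0)\in\mathbf{SO}(3)$, $\hat d(0)\in\mathbb{R}^3$. Output errors are $\tilde y_i:=\Lambda_i^\top\hat R^\top b_i-y_i$, stacked as $\bm y=(\tilde y_1,\dots,\tilde y_p)\in\mathbb{R}^m$. Let $$A:=\begin{bmatrix}0_{3\times3}&\hat R\\0_{3\times3}&0_{3\times3}\end{bmatrix},\qquad C:=\begin{bmatrix}C_1&0_{n_1\times3}\\\vdots&\vdots\\C_p&0_{n_p\times3}\end{bmatrix},\qquad C_i:=\Lambda_i^\top\hat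 R^\top b_i^\times .$$ The innovation is $\Delta=(\Delta_R,\Delta_d)=-P\,C^\top Q\,\bm y\in\mathbb{R}^6$, where $P(t)\in\mathbb{R}^{6\times6}$ solves the continuous Riccati equation $\dot P=AP+PA^\top-PC^\top QCP+V$ with $P(0)$ symmetric positive definite. Here $Q(t)\in\mathbb{R}^{m\times m}$ and $V(t)\in\mathbb{R}^{6\times6}$ are bounded continuous symmetric positive definite matrix-valued functions. Errors: $\tilde R:=\hat RR^\top$, $\tilde d:=d-\hat d$, so that $\dot{\tilde R}=(\hat R\tilde d+\Delta_R)^\times\tilde R$, $\dot{\tilde d}=\Delta_d$. Local exponential stability of $(I_3,0)$ means: there exist $r,c,\kappa>0$ such that $\|\tilde R(0)-I_3\|+|\tilde d(0)|\le r$ implies $\|\tilde R(t)-I_3\|+|\tilde d(t)|\le c\,e^{-\kappa t}(\|\tilde R(0)-I_3\|+|\tilde d(0)|)$ for all $t\ge0$. The pair $(A^\star(t),C^\star(t))$ is obtained by replacing $\hat R$ by $R$ in $(A,C)$: $$A^\star(t):=\begin{bmatrix}0_{3\times3}&R(t)\\0_{3\times3}&0_{3\times3}\end{bmatrix},\qquad C^\star(t):=\begin{bmatrix}C_1^\star(t)&0_{n_1\times3}\\\vdots&\vdots\\C_p^\star(t)&0_{n_p\times3}\end{bmatrix}.$$ It is uniformly observable if there exist $\delta',\mu'>0$ such that for all $t\ge0$, $\frac1{\delta'}\int_t^{t+\delta'}\Phi^\top(s,t)C^{\star\top}(s)C^\star(s)\Phi(s,t)\,ds\succeq\mu' I_6$,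 where $\Phi(s,t)$ is the state transition matrix of $A^\star$: $\frac{\partial}{\partial s}\Phi(s,t)=A^\star(s)\Phi(s,t)$, $\Phi(t,t)=I_6$.
   Formalization: Q(t) and V(t) are assumed uniformly positive definite (bounded below by a fixed positive multiple of the identity for all t≥0); with merely pointwise positive definite weights, e.g. Q(t)=q e^{-5t}I with small q, exponential stability fails. *)

theory Defs
  imports "HOL-Analysis.Analysis"
begin

unbundle cross3_syntax

section \<open>Matrices\<close>

definition skew :: "real^3 \<Rightarrow> real^3^3" where
  "skew w = matrix (\<lambda>y. w \<times> y)"

lemma skew_mult_vec: "skew w *v y = w \<times> y"
proof -
  have "linear (\<lambda>y. w \<times> y)"
    by (rule linearI) (simp_all add: cross_add_right cross_mult_right)
  then show ?thesis
    unfolding skew_def by simp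
qed

definition SO3 :: "(real^3^3) set" where
  "SO3 = {R. rotation_matrix R}"

definition sym_mat :: "real^'n^'n \<Rightarrow> bool" where
  "sym_mat M \<longleftrightarrow> transpose M = M"

definition pos_semidef :: "real^'n^'n \<Rightarrow> bool" where
  "pos_semidef M \<longleftrightarrow> sym_mat M \<and> (\<forall>x. 0 \<le> x \<bullet> (M *v x))"

definition pos_def :: "real^'n^'n \<Rightarrow> bool" where
  "pos_def M \<longleftrightarrow> sym_mat M \<and> (\<forall>x. x \<noteq> 0 \<longrightarrow> 0 < x \<bullet> (M *v x))"

definition loewner_ge :: "real^'n^'n \<Rightarrow> real^'n^'n \<Rightarrow> bool"  (infix "\<succeq>" 50) where
  "X \<succeq> Y \<longleftrightarrow> pos_semidef (X - Y)"

(* Positive definiteness of a time-varying matrix is meant in the sense used for time-varying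
   quadratic forms: bounded below by a fixed positive multiple of the identity. Pointwise
   positive definiteness alone would allow Q or V to decay to 0, and the Riccati gain with it;
   the estimation error then need not converge exponentially. *)
definition admissible_weight :: "(real \<Rightarrow> real^'n^'n) \<Rightarrow> bool" where
  "admissible_weight M \<longleftrightarrow>
     continuous_on {0..} M \<and> bounded (M ` {0..}) \<and> (\<forall>t\<ge>0. pos_def (M t)) \<and>
     (\<exists>\<epsilon>>0. \<forall>t\<ge>0. M t \<succeq> \<epsilon> *\<^sub>R mat 1)"

text \<open>The type \<open>3 + 3\<close> is the disjoint sum of two three-element index types, so
  \<open>real^(3+3)\<close> is six-dimensional: \<open>Inl\<close> indexes the attitude block and \<open>Inr\<close> the bias block.\<close>

definition upper_part :: "real^(3+3) \<Rightarrow> real^3" where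
  "upper_part v = (\<chi> k. v $ Inl k)"

definition lower_part :: "real^(3+3) \<Rightarrow> real^3" where
  "lower_part v = (\<chi> k. v $ Inr k)"

definition A_mat :: "real^3^3 \<Rightarrow> real^(3+3)^(3+3)" where
  "A_mat S = (\<chi> i j. case (i, j) of (Inl k, Inr l) \<Rightarrow> S $ k $ l | _ \<Rightarrow> 0)"

section \<open>Uniform observability\<close>

definition transition_matrix ::
  "(real \<Rightarrow> real^'n^'n) \<Rightarrow> (real \<Rightarrow> real \<Rightarrow> real^'n^'n) \<Rightarrow> bool" where
  "transition_matrix A \<Phi> \<longleftrightarrow>
     (\<forall>t\<ge>0. \<Phi> t t = mat 1 \<and>
       (\<forall>s\<ge>0. ((\<lambda>s. \<Phi> s t) has_vector_derivative (A s ** \<Phi> s t)) (at s within {0..})))"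

definition uniformly_observable ::
  "(real \<Rightarrow> real^'n^'n) \<Rightarrow> (real \<Rightarrow> real^'n^'m) \<Rightarrow> bool" where
  "uniformly_observable A C \<longleftrightarrow>
     (\<exists>\<Phi>. transition_matrix A \<Phi> \<and>
       (\<exists>\<delta>>0. \<exists>\<mu>>0. \<forall>t\<ge>0.
          (1 / \<delta>) *\<^sub>R integral {t..t+\<delta>}
             (\<lambda>s. transpose (\<Phi> s t) ** transpose (C s) ** C s ** \<Phi> s t)
          \<succeq> \<mu> *\<^sub>R mat 1))"

section \<open>Outputs\<close>

text \<open>An \<open>n \<times> 3\<close> matrix whose number of rows \<open>n\<close> is a term is given by its rows
  \<open>M 1, \<dots>, M n\<close>. For such a matrix, \<open>gram n M\<close> is the product of its transpose with itself.\<close>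

definition gram :: "nat \<Rightarrow> (nat \<Rightarrow> real^3) \<Rightarrow> real^3^3" where
  "gram n M = (\<chi> k l. \<Sum>j=1..n. M j $ k * M j $ l)"

text \<open>The output matrix of channel \<open>i\<close> has columns \<open>a i 1 t, \<dots>, a i (n i) t\<close>, so the \<open>j\<close>-th row
  of its transpose is \<open>a i j t\<close>. In the following, \<open>S\<close> stands for an attitude (true or estimated).\<close>

definition y_out :: "(nat \<Rightarrow> nat \<Rightarrow> real \<Rightarrow> real^3) \<Rightarrow> (nat \<Rightarrow> real \<Rightarrow> real^3) \<Rightarrow>
    real^3^3 \<Rightarrow> real \<Rightarrow> nat \<Rightarrow> nat \<Rightarrow> real" where
  "y_out a b S t i j = a i j t \<bullet> (transpose S *v b i t)"

definition C_row :: "(nat \<Rightarrow> nat \<Rightarrow> real \<Rightarrow> real^3) \<Rightarrow> (nat \<Rightarrow> real \<Rightarrow> real^3) \<Rightarrow>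
    real^3^3 \<Rightarrow> real \<Rightarrow> nat \<Rightarrow> nat \<Rightarrow> real^3" where
  "C_row a b S t i j = a i j t v* (transpose S ** skew (b i t))"

text \<open>The scalar outputs are stacked along an enumeration \<open>idx\<close> of the pairs \<open>(i, j)\<close> with
  \<open>1 \<le> i \<le> p\<close> and \<open>1 \<le> j \<le> n i\<close>; its index type has \<open>m = n 1 + \<dots> + n p\<close> elements.\<close>

definition stacking :: "nat \<Rightarrow> (nat \<Rightarrow> nat) \<Rightarrow> ('m::finite \<Rightarrow> nat \<times> nat) \<Rightarrow> bool" where
  "stacking p n idx \<longleftrightarrow> bij_betw idx UNIV (SIGMA i:{1..p}. {1..n i})"

definition C_mat :: "('m::finite \<Rightarrow> nat \<times> nat) \<Rightarrow> (nat \<Rightarrow> nat \<Rightarrow> real \<Rightarrow> real^3) \<Rightarrow>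
    (nat \<Rightarrow> real \<Rightarrow> real^3) \<Rightarrow> real^3^3 \<Rightarrow> real \<Rightarrow> real^(3+3)^'m" where
  "C_mat idx a b S t =
     (\<chi> k c. case c of Inl l \<Rightarrow> C_row a b S t (fst (idx k)) (snd (idx k)) $ l | Inr l \<Rightarrow> 0)"

definition y_err :: "('m::finite \<Rightarrow> nat \<times> nat) \<Rightarrow> (nat \<Rightarrow> nat \<Rightarrow> real \<Rightarrow> real^3) \<Rightarrow>
    (nat \<Rightarrow> real \<Rightarrow> real^3) \<Rightarrow> real^3^3 \<Rightarrow> real^3^3 \<Rightarrow> real \<Rightarrow> real^'m" where
  "y_err idx a b Rh R t =
     (\<chi> k. y_out a b Rh t (fst (idx k)) (snd (idx k)) - y_out a b R t (fst (idx k)) (snd (idx k)))"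

section \<open>The averaged excitation matrices\<close>

definition W_lam :: "nat \<Rightarrow> (nat \<Rightarrow> nat) \<Rightarrow> (nat \<Rightarrow> nat \<Rightarrow> real \<Rightarrow> real^3) \<Rightarrow>
    (nat \<Rightarrow> real \<Rightarrow> real^3) \<Rightarrow> (real \<Rightarrow> real^3^3) \<Rightarrow> real \<Rightarrow> real \<Rightarrow> real^3^3" where
  "W_lam p n a b R t \<delta> =
     (1 / \<delta>) *\<^sub>R integral {t..t+\<delta>} (\<lambda>s. \<Sum>i=1..p. gram (n i) (C_row a b (R s) s i))"

definition rho :: "nat \<Rightarrow> (nat \<Rightarrow> nat) \<Rightarrow> (nat \<Rightarrow> nat \<Rightarrow> real \<Rightarrow> real^3) \<Rightarrow>
    (nat \<Rightarrow> real \<Rightarrow> real^3) \<Rightarrow> (real \<Rightarrow> real^3^3) \<Rightarrow> real \<Rightarrow> real \<Rightarrow> real^3^3" where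
  "rho p n a b R t \<delta> =
     (1 / \<delta>) *\<^sub>R (matrix_inv (W_lam p n a b R t \<delta>) **
       integral {t..t+\<delta>}
         (\<lambda>s. (\<Sum>i=1..p. gram (n i) (C_row a b (R s) s i)) ** integral {t..s} R))"

definition Cbar_row :: "nat \<Rightarrow> (nat \<Rightarrow> nat) \<Rightarrow> (nat \<Rightarrow> nat \<Rightarrow> real \<Rightarrow> real^3) \<Rightarrow>
    (nat \<Rightarrow> real \<Rightarrow> real^3) \<Rightarrow> (real \<Rightarrow> real^3^3) \<Rightarrow> real \<Rightarrow> real \<Rightarrow> real \<Rightarrow>
    nat \<Rightarrow> nat \<Rightarrow> real^3" where
  "Cbar_row p n a b R s t \<delta> i j =
     C_row a b (R s) s i j v* (integral {t..s} R - rho p n a b R t \<delta>)"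

definition W_bar :: "nat \<Rightarrow> (nat \<Rightarrow> nat) \<Rightarrow> (nat \<Rightarrow> nat \<Rightarrow> real \<Rightarrow> real^3) \<Rightarrow>
    (nat \<Rightarrow> real \<Rightarrow> real^3) \<Rightarrow> (real \<Rightarrow> real^3^3) \<Rightarrow> real \<Rightarrow> real \<Rightarrow> real^3^3" where
  "W_bar p n a b R t \<delta> =
     (1 / \<delta>) *\<^sub>R integral {t..t+\<delta>} (\<lambda>s. \<Sum>i=1..p. gram (n i) (Cbar_row p n a b R s t \<delta> i))"

section \<open>The observer and its estimation error\<close>

definition innovation :: "('m::finite \<Rightarrow> nat \<times> nat) \<Rightarrow> (nat \<Rightarrow> nat \<Rightarrow> real \<Rightarrow> real^3) \<Rightarrow>
    (nat \<Rightarrow> real \<Rightarrow> real^3) \<Rightarrow> (real \<Rightarrow> real^'m^'m) \<Rightarrow>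
    real^3^3 \<Rightarrow> real^3^3 \<Rightarrow> real^(3+3)^(3+3) \<Rightarrow> real \<Rightarrow> real^(3+3)" where
  "innovation idx a b Q R Rh P t =
     - ((P ** transpose (C_mat idx a b Rh t) ** Q t) *v y_err idx a b Rh R t)"

definition riccati_rhs :: "real^'n^'n \<Rightarrow> real^'n^'m \<Rightarrow> real^'m^'m \<Rightarrow> real^'n^'n \<Rightarrow>
    real^'n^'n \<Rightarrow> real^'n^'n" where
  "riccati_rhs A C Q V P =
     A ** P + P ** transpose A - P ** transpose C ** Q ** C ** P + V"

definition observer_solution :: "('m::finite \<Rightarrow> nat \<times> nat) \<Rightarrow>
    (nat \<Rightarrow> nat \<Rightarrow> real \<Rightarrow> real^3) \<Rightarrow> (nat \<Rightarrow> real \<Rightarrow> real^3) \<Rightarrow>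
    (real \<Rightarrow> real^'m^'m) \<Rightarrow> (real \<Rightarrow> real^(3+3)^(3+3)) \<Rightarrow>
    (real \<Rightarrow> real^3^3) \<Rightarrow> (real \<Rightarrow> real^3) \<Rightarrow> real^3 \<Rightarrow>
    (real \<Rightarrow> real^3^3) \<Rightarrow> (real \<Rightarrow> real^3) \<Rightarrow> (real \<Rightarrow> real^(3+3)^(3+3)) \<Rightarrow> bool" where
  "observer_solution idx a b Q V R \<Omega> d Rh dh P \<longleftrightarrow>
     (\<forall>t\<ge>0.
        (Rh has_vector_derivative
           (Rh t ** skew ((\<Omega> t + d) - dh t) +
            skew (upper_part (innovation idx a b Q (R t) (Rh t) (P t) t)) ** Rh t))
          (at t within {0..}) \<and>
        (dh has_vector_derivative
           - lower_part (innovation idx a b Q (R t) (Rh t) (P t) t))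
          (at t within {0..}) \<and>
        (P has_vector_derivative
           riccati_rhs (A_mat (Rh t)) (C_mat idx a b (Rh t) t) (Q t) (V t) (P t))
          (at t within {0..}))"

definition est_error :: "real^3^3 \<Rightarrow> real^3 \<Rightarrow> real^3^3 \<Rightarrow> real^3 \<Rightarrow> real" where
  "est_error R d Rh dh = norm (Rh ** transpose R - mat 1) + norm (d - dh)"

text \<open>The Riccati state starts at the fixed matrix \<open>P0\<close>, on which the constants may depend; they
  are uniform in the initial attitude and bias estimates. Besides the exponential bound along
  every trajectory, the definition requires that a trajectory on \<open>[0, \<infinity>)\<close> does start from each
  of these initial estimates, so that the bound is never vacuous.\<close>

definition locally_exp_stable :: "('m::finite \<Rightarrow> nat \<times> nat) \<Rightarrow>
    (nat \<Rightarrow> nat \<Rightarrow> real \<Rightarrow> real^3) \<Rightarrow> (nat \<Rightarrow> real \<Rightarrow> real^3) \<Rightarrow>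
    (real \<Rightarrow> real^'m^'m) \<Rightarrow> (real \<Rightarrow> real^(3+3)^(3+3)) \<Rightarrow> real^(3+3)^(3+3) \<Rightarrow>
    (real \<Rightarrow> real^3^3) \<Rightarrow> (real \<Rightarrow> real^3) \<Rightarrow> real^3 \<Rightarrow> bool" where
  "locally_exp_stable idx a b Q V P0 R \<Omega> d \<longleftrightarrow>
     (\<exists>r>0. \<exists>c>0. \<exists>\<kappa>>0. \<forall>Rh0\<in>SO3. \<forall>dh0. est_error (R 0) d Rh0 dh0 \<le> r \<longrightarrow>
        (\<exists>Rh dh P. observer_solution idx a b Q V R \<Omega> d Rh dh P \<and>
           Rh 0 = Rh0 \<and> dh 0 = dh0 \<and> P 0 = P0) \<and>
        (\<forall>Rh dh P. observer_solution idx a b Q V R \<Omega> d Rh dh P \<and>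
           Rh 0 = Rh0 \<and> dh 0 = dh0 \<and> P 0 = P0 \<longrightarrow>
           (\<forall>t\<ge>0. est_error (R t) d (Rh t) (dh t)
                    \<le> c * exp (- \<kappa> * t) * est_error (R 0) d Rh0 dh0)))"

end

theory Submission
  imports Defs
begin

text \<open>Uniform observability: the transition matrix of \<open>A\<^sup>\<star>\<close> is unipotent with off-diagonal block
  \<open>N(s) = \<integral>\<^sub>t\<^sup>s R\<close>, so the Gramian at \<open>(u, w)\<close> integrates \<open>|C (u + N w)|\<^sup>2\<close>. Writing
  \<open>u + N w = (u + \<rho> w) + (N - \<rho>) w\<close>, the choice of \<open>\<rho>\<close> kills the cross term, and the two squares are
  bounded from below by the two hypotheses.

  Stability: write \<open>R\<^sub>h R\<^sup>T = I + E\<close>. Orthogonality makes the symmetric part of \<open>E\<close> quadratic in \<open>E\<close>, so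
  the vector \<open>x\<close> formed by the skew part of \<open>E\<close> and the bias error measures the estimation error and
  satisfies \<open>x' = (A - P C\<^sup>T Q C) x + O(|x|\<^sup>2)\<close>. Then \<open>x \<bullet> P\<^sup>-\<^sup>1 x\<close> decays exponentially as long as the
  error is small and \<open>P\<close> is bounded from above and below. The lower bound on \<open>P\<close> holds because \<open>V\<close>
  dominates the Riccati equation for small \<open>P\<close>. For the upper bound, \<open>\<zeta> \<bullet> P \<zeta>\<close> is at most the cost of
  steering the adjoint system from \<open>0\<close> to \<open>\<zeta>\<close> over a window of length \<open>\<delta>\<close>, which the Gramian along
  \<open>R\<^sub>h\<close>, a small perturbation of the one along \<open>R\<close>, controls. A bootstrap argument in \<open>t\<close> closes the
  estimate, and the resulting a priori bounds turn the global solution of a truncated, globally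
  Lipschitz system into a solution of the observer equations.\<close>

section \<open>Matrix norms and derivatives\<close>

text \<open>The obstacle is a circular dependence. The coefficients of the Riccati equation contain
  the estimate, so \<open>P\<close> is bounded above only while \<open>Rh\<close> stays near
  \<open>R\<close>; \<open>Rh\<close> stays near \<open>R\<close> only while the Lyapunov function
  decays; and the decay rate comes from the bounds on \<open>P\<close>. The circle is broken by
  fixing every constant from the data alone, in \<open>observer_consts\<close>, before a trajectory
  or a horizon \<open>T\<close> is chosen. Estimates along a trajectory hold on
  \<open>[0, T]\<close> for every \<open>T\<close>, under a smallness hypothesis that their
  conclusion strictly improves. The linearisation is taken along \<open>Rh\<close>, not along
  \<open>R\<close>: the linear part of the error equation then has exactly the coefficients of the
  Riccati equation, and all terms with \<open>A\<close> cancel in the Lyapunov derivative. The true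
  attitude is left in the remainder and in the Gramian only. The uniform lower bound on
  \<open>V\<close> supplies both the lower bound on \<open>P\<close> and the decay; the one on
  \<open>Q\<close> limits the cost of the steering control.\<close>

declare transpose_matrix_vector [simp del]

lemma norm_vec_sq: "norm (x::('a::real_inner)^'n)^2 = (\<Sum>i\<in>UNIV. norm (x$i)^2)"
  by (simp add: power2_norm_eq_inner inner_vec_def)

text \<open>The norm of \<open>real^'n^'m\<close> is the Frobenius norm, so Cauchy-Schwarz in each
  row suffices. All estimates use this norm in place of an operator norm, at the price of dimension
  factors.\<close>

lemma norm_mult_vec_le: "norm ((A::real^'n^'m) *v x) \<le> norm A * norm x"
proof -
  have "norm (A *v x)^2 = (\<Sum>i\<in>UNIV. (A$i \<bullet> x)^2)"
    by (simp add: norm_vec_sq matrix_vector_mult_def inner_vec_def)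
  also have "\<dots> \<le> (\<Sum>i\<in>UNIV. norm (A$i)^2 * norm x^2)"
    by (intro sum_mono) (metis Cauchy_Schwarz_ineq power2_norm_eq_inner)
  also have "\<dots> = (norm A * norm x)^2"
    by (simp add: norm_vec_sq[of A] power_mult_distrib sum_distrib_right)
  finally show ?thesis
    by (rule power2_le_imp_le) simp
qed

lemma norm_transpose [simp]: "norm (transpose (A::real^'n^'m)) = norm A"
proof -
  have "norm (transpose A)^2 = norm A^2"
    unfolding norm_vec_sq by (simp add: transpose_def sum.swap[of _ "UNIV::'n set"])
  then show ?thesis
    by (metis norm_ge_zero power2_eq_imp_eq)
qed

lemma norm_matrix_mult_le: "norm ((A::real^'n^'m) ** (B::real^'k^'n)) \<le> norm A * norm B"
proof -
  have row: "(A ** B)$i = transpose B *v (A$i)" for i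
    by (simp add: vec_eq_iff matrix_matrix_mult_def matrix_vector_mult_def transpose_def mult.commute)
  have "norm (A ** B)^2 = (\<Sum>i\<in>UNIV. norm (transpose B *v (A$i))^2)"
    by (simp add: norm_vec_sq row)
  also have "\<dots> \<le> (\<Sum>i\<in>UNIV. (norm B * norm (A$i))^2)"
    by (intro sum_mono power_mono order_trans[OF norm_mult_vec_le]) auto
  also have "\<dots> = (norm A * norm B)^2"
    by (simp add: norm_vec_sq[of A] power_mult_distrib sum_distrib_left mult.commute)
  finally show ?thesis
    by (rule power2_le_imp_le) simp
qed

lemma matrix_mult_add_left: "(A + B) ** C = A ** C + B ** (C::real^'k^'n)"
  by (vector matrix_matrix_mult_def sum.distrib distrib_right)

lemma bounded_bilinear_matrix_mult: "bounded_bilinear ((**) :: real^'n^'m \<Rightarrow> real^'k^'n \<Rightarrow> _)"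
proof
  show "\<exists>K. \<forall>(a::real^'n^'m) (b::real^'k^'n). norm (a ** b) \<le> norm a * norm b * K"
    by (intro exI[of _ 1]) (simp add: norm_matrix_mult_le)
qed (simp_all add: matrix_add_ldistrib matrix_mult_add_left scalar_matrix_assoc
       matrix_scalar_ac scaleR_matrix_vector_assoc)

lemma bounded_bilinear_mult_vec: "bounded_bilinear ((*v) :: real^'n^'m \<Rightarrow> real^'n \<Rightarrow> _)"
proof
  show "\<exists>K. \<forall>(a::real^'n^'m) (b::real^'n). norm (a *v b) \<le> norm a * norm b * K"
    by (intro exI[of _ 1]) (simp add: norm_mult_vec_le)
qed (simp_all add: algebra_simps matrix_vector_mult_scaleR scaleR_matrix_vector_assoc)

lemma bounded_linear_transpose: "bounded_linear (transpose :: real^'n^'m \<Rightarrow> _)"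
  unfolding linear_conv_bounded_linear[symmetric]
  by (rule linearI) (simp_all add: transpose_def vec_eq_iff)

lemma transpose_add: "transpose (A + B) = transpose A + transpose (B::real^'n^'m)"
  and transpose_diff: "transpose (A - B) = transpose A - transpose (B::real^'n^'m)"
  and transpose_minus: "transpose (- A) = - transpose (A::real^'n^'m)"
  by (simp_all add: transpose_def vec_eq_iff)

lemma inner_mult_vec: "x \<bullet> ((A::real^'n^'m) *v y) = (transpose A *v x) \<bullet> y"
  by (simp add: transpose_matrix_vector dot_lmul_matrix)

lemma inner_matrix_mult_left: "((A::real^'n^'m) ** B) \<bullet> C = (B::real^'k^'n) \<bullet> (transpose A ** C)"
proof -
  have "(A ** B) \<bullet> C = (\<Sum>i\<in>UNIV. \<Sum>j\<in>UNIV. \<Sum>k\<in>UNIV. A$i$k * B$k$j * C$i$j)"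
    by (simp add: inner_vec_def matrix_matrix_mult_def sum_distrib_right)
  also have "\<dots> = (\<Sum>k\<in>UNIV. \<Sum>j\<in>UNIV. \<Sum>i\<in>UNIV. A$i$k * B$k$j * C$i$j)"
    by (subst (2) sum.swap, subst sum.swap, subst (2) sum.swap) simp
  also have "\<dots> = B \<bullet> (transpose A ** C)"
    by (simp add: inner_vec_def matrix_matrix_mult_def transpose_def sum_distrib_left mult_ac)
  finally show ?thesis .
qed

lemma inner_transpose: "transpose (A::real^'n^'m) \<bullet> transpose B = A \<bullet> B"
  by (simp add: inner_vec_def transpose_def sum.swap[of _ "UNIV::'n set"])

lemma inner_matrix_mult_right: "((A::real^'n^'m) ** (B::real^'k^'n)) \<bullet> C = A \<bullet> (C ** transpose B)"
proof -
  have "(A ** B) \<bullet> C = (transpose B ** transpose A) \<bullet> transpose C"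
    by (simp add: inner_transpose flip: matrix_transpose_mul)
  also have "\<dots> = transpose A \<bullet> transpose (C ** transpose B)"
    by (simp add: inner_matrix_mult_left matrix_transpose_mul)
  finally show ?thesis
    by (simp add: inner_transpose)
qed

lemma has_vector_derivative_inner:
  assumes "(f has_vector_derivative f') (at t within S)" "(g has_vector_derivative g') (at t within S)"
  shows "((\<lambda>s. f s \<bullet> (g s :: 'a::real_inner)) has_real_derivative f t \<bullet> g' + f' \<bullet> g t) (at t within S)"
  using bounded_bilinear.has_vector_derivative[OF bounded_bilinear_inner assms]
  by (simp add: has_real_derivative_iff_has_vector_derivative)

lemmas has_vector_derivative_matrix_mult =
  bounded_bilinear.has_vector_derivative[OF bounded_bilinear_matrix_mult]
lemmas has_vector_derivative_mult_vec =
  bounded_bilinear.has_vector_derivative[OF bounded_bilinear_mult_vec]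
lemmas has_vector_derivative_transpose =
  bounded_linear.has_vector_derivative[OF bounded_linear_transpose]
lemmas continuous_on_matrix_mult = bounded_bilinear.continuous_on[OF bounded_bilinear_matrix_mult]
lemmas continuous_on_mult_vec = bounded_bilinear.continuous_on[OF bounded_bilinear_mult_vec]
lemmas continuous_on_transpose = bounded_linear.continuous_on[OF bounded_linear_transpose]

lemma has_vector_derivative_continuous_on:
  assumes "\<And>t. t \<in> S \<Longrightarrow> (f has_vector_derivative f' t) (at t within S)"
  shows "continuous_on S f"
  using assms by (meson continuous_on_eq_continuous_within has_vector_derivative_continuous)

section \<open>Comparison and continuation arguments on an interval\<close>

lemma nonincreasing_within:
  fixes f :: "real \<Rightarrow> real"
  assumes "a \<le> b"
    and d: "\<And>t. t \<in> {a..b} \<Longrightarrow> (f has_real_derivative f' t) (at t within {a..b})"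
    and "\<And>t. t \<in> {a..b} \<Longrightarrow> f' t \<le> 0"
  shows "f b \<le> f a"
proof -
  have "\<exists>x\<in>{a..b}. f b - f a = (b - a) * f' x"
    using mvt_very_simple[of a b f "\<lambda>t h. h * f' t"] assms(1) d
    by (auto simp: has_field_derivative_def mult.commute[of _ "f' _"] )
  then show ?thesis
    using assms by (smt (verit) mult_nonneg_nonpos)
qed

text \<open>The weight \<open>exp (- 2 * K * s)\<close> makes the squared norm of \<open>D\<close>
  nonincreasing. This serves to propagate algebraic identities along a flow: symmetry of
  \<open>P\<close> and orthogonality of the estimate.\<close>

lemma gronwall_zero:
  fixes D :: "real \<Rightarrow> 'a::real_inner"
  assumes T: "0 \<le> t" "t \<le> T"
    and d: "\<And>t. t \<in> {0..T} \<Longrightarrow> (D has_vector_derivative D' t) (at t within {0..T})"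
    and b: "\<And>t. t \<in> {0..T} \<Longrightarrow> D t \<bullet> D' t \<le> K * norm (D t)^2"
    and "D 0 = 0"
  shows "D t = 0"
proof -
  define f where "f = (\<lambda>s. (D s \<bullet> D s) * exp (- 2 * K * s))"
  define f' where "f' = (\<lambda>s. 2 * (D s \<bullet> D' s - K * (D s \<bullet> D s)) * exp (- 2 * K * s))"
  have sub: "{0..t} \<subseteq> {0..T}" using T by auto
  have "f t \<le> f 0"
  proof (rule nonincreasing_within[where f = f and f' = f'])
    fix s assume s: "s \<in> {0..t}"
    then have A: "((\<lambda>s. D s \<bullet> D s) has_real_derivative D s \<bullet> D' s + D' s \<bullet> D s) (at s within {0..t})"
      using d T sub by (intro has_vector_derivative_inner)
        (auto intro: has_vector_derivative_within_subset[OF _ sub])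
    have B: "((\<lambda>s. exp (- 2 * K * s)) has_real_derivative - 2 * K * exp (- 2 * K * s))
        (at s within {0..t})"
      by (auto intro!: derivative_eq_intros)
    have "2 * (p - K * q) * e = (p + p) * e + - 2 * K * e * q" for p q e :: real
      by (simp add: algebra_simps)
    then have "f' s = (D s \<bullet> D' s + D' s \<bullet> D s) * exp (- 2 * K * s)
        + - 2 * K * exp (- 2 * K * s) * (D s \<bullet> D s)"
      unfolding f'_def inner_commute[of "D' s" "D s"] by blast
    with DERIV_mult[OF A B] show "(f has_real_derivative f' s) (at s within {0..t})"
      by (simp only: f_def)
    show "f' s \<le> 0"
      using b[of s] s sub by (auto simp: f'_def power2_norm_eq_inner mult_nonpos_nonneg)
  qed (use T in auto)
  also have "f 0 = 0" using assms by (simp add: f_def)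
  finally have "D t \<bullet> D t \<le> 0"
    by (simp add: f_def mult_le_0_iff) 
  then show ?thesis
    by (metis inner_gt_zero_iff not_less)
qed

text \<open>At a first time where \<open>g\<close> reaches \<open>M\<close>, the hypothesis of
  \<open>step\<close> holds up to and including that time, and its strict conclusion is a
  contradiction.\<close>

lemma bootstrap:
  fixes g :: "real \<Rightarrow> real"
  assumes c: "continuous_on {0..T} g" and "g 0 < M"
    and step: "\<And>\<tau>. \<tau> \<in> {0..T} \<Longrightarrow> (\<And>t. t \<in> {0..\<tau>} \<Longrightarrow> g t \<le> M) \<Longrightarrow> g \<tau> < M"
    and t: "t \<in> {0..T}"
  shows "g t < M"
proof (rule ccontr)
  assume "\<not> g t < M"
  define S where "S = {s\<in>{0..T}. M \<le> g s}"
  have S: "S = {0..T} \<inter> g -` {M..}" by (auto simp: S_def)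
  have "closed S" unfolding S by (intro continuous_closed_preimage c) auto
  then have cS: "compact S" "S \<noteq> {}"
    using \<open>\<not> g t < M\<close> t by (auto simp: S_def compact_eq_bounded_closed intro: bounded_subset[of "{0..T}"])
  obtain u where u: "u \<in> S" "\<And>s. s \<in> S \<Longrightarrow> u \<le> s"
    using compact_attains_inf[OF cS] by blast
  \<comment> \<open>Before \<open>u\<close> this is minimality. At \<open>u\<close>, a value above
    \<open>M\<close> would be preceded by a crossing of the level \<open>M\<close>, which minimality
    moves to \<open>u\<close> itself.\<close>
  have "g s \<le> M" if "s \<in> {0..u}" for s
  proof (cases "s = u")
    case False
    then show ?thesis using that u by (force simp: S_def)
  next
    case True
    show ?thesis
    proof (rule ccontr)
      assume "\<not> g s \<le> M"
      moreover have "continuous_on {0..u} g"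
        using u by (auto simp: S_def intro: continuous_on_subset[OF c])
      ultimately have "\<exists>v\<ge>0. v \<le> u \<and> g v = M"
        using \<open>g 0 < M\<close> True that by (intro IVT') auto
      then obtain v where "0 \<le> v" "v \<le> u" "g v = M" by blast
      then have "v \<in> S" "g v = M"
        using u by (auto simp: S_def)
      then have "v = u" using u \<open>v \<le> u\<close> by force
      then show False using \<open>g v = M\<close> True \<open>\<not> g s \<le> M\<close> by simp
    qed
  qed
  with step[of u] u show False by (auto simp: S_def)
qed

section \<open>Coercive and positive semidefinite matrices\<close>

lemma abs_inner_mult_vec_le: "\<bar>x \<bullet> ((A::real^'n^'m) *v y)\<bar> \<le> norm x * norm A * norm y"
proof -
  have "\<bar>x \<bullet> (A *v y)\<bar> \<le> norm x * norm (A *v y)" by (rule Cauchy_Schwarz_ineq2)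
  also have "\<dots> \<le> norm x * (norm A * norm y)" by (intro mult_left_mono norm_mult_vec_le) auto
  finally show ?thesis by (simp add: mult.assoc)
qed

lemma inner_mult_vec_le: "x \<bullet> ((A::real^'n^'m) *v y) \<le> norm x * norm A * norm y"
  using abs_inner_mult_vec_le[of x A y] by linarith

lemma sym_mat_inner: "sym_mat M \<Longrightarrow> x \<bullet> (M *v y) = (M *v x) \<bullet> y"
  by (simp add: inner_mult_vec sym_mat_def)

text \<open>Coercivity makes the kernel trivial, and pairing \<open>G *v x = y\<close> with
  \<open>x\<close> bounds the solution. The Gramian equation for the steering control is solved this
  way.\<close>

lemma coercive_solve:
  fixes G :: "real^'n^'n"
  assumes "0 < \<gamma>" and G: "\<And>x. \<gamma> * norm x^2 \<le> x \<bullet> (G *v x)"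
  obtains x where "G *v x = y" "\<gamma> * norm x \<le> norm y"
proof -
  have "x = 0" if "G *v x = 0" for x
    using G[of x] that \<open>0 < \<gamma>\<close> by (simp add: mult_le_0_iff)
  then obtain B where "B ** G = mat 1"
    using matrix_left_invertible_ker[of G] by auto
  then have "G ** B = mat 1"
    by (simp add: matrix_left_right_inverse)
  then have sol: "G *v (B *v y) = y"
    by (simp add: matrix_vector_mul_assoc)
  have "\<gamma> * norm (B *v y) * norm (B *v y) \<le> norm y * norm (B *v y)"
    using G[of "B *v y"] norm_cauchy_schwarz[of "B *v y" y]
    by (simp add: sol power2_eq_square mult.commute mult.left_commute)
  then have "\<gamma> * norm (B *v y) \<le> norm y"
    by (cases "B *v y = 0") (auto simp: mult_le_cancel_right)
  with sol show thesis by (rule that)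
qed

lemma coercive_inv:
  fixes G :: "real^'n^'n"
  assumes "0 < \<gamma>" and G: "\<And>x. \<gamma> * norm x^2 \<le> x \<bullet> (G *v x)"
  shows "G ** matrix_inv G = mat 1" "matrix_inv G ** G = mat 1"
    "\<gamma> * norm (matrix_inv G *v y) \<le> norm y"
proof -
  have "x = 0" if "G *v x = 0" for x
    using G[of x] that \<open>0 < \<gamma>\<close> by (simp add: mult_le_0_iff)
  then have inv: "invertible G"
    using matrix_left_invertible_ker[of G] invertible_left_inverse by blast
  then show 1: "G ** matrix_inv G = mat 1" and 2: "matrix_inv G ** G = mat 1"
    unfolding invertible_def matrix_inv_def by (metis (mono_tags, lifting) someI_ex)+
  obtain x where x: "G *v x = y" "\<gamma> * norm x \<le> norm y"
    using coercive_solve[OF assms] .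
  then have "matrix_inv G *v y = x"
    using 2 by (metis matrix_vector_mul_assoc matrix_vector_mul_lid)
  with x show "\<gamma> * norm (matrix_inv G *v y) \<le> norm y" by simp
qed

text \<open>Converts an operator bound into a Frobenius bound by summing the norms of the columns.
  The factors 3 and 6 in later constants come from here.\<close>

lemma norm_le_of_columns:
  fixes M :: "real^'n^'m"
  assumes "\<And>x. norm (M *v x) \<le> k * norm x"
  shows "norm M \<le> real CARD('n) * k"
proof -
  have "norm M = norm (transpose M)" by simp
  also have "\<dots> \<le> (\<Sum>j\<in>UNIV. norm (transpose M $ j))"
    by (simp add: norm_vec_def L2_set_le_sum)
  also have "\<dots> \<le> (\<Sum>j\<in>(UNIV::'n set). k)"
  proof (rule sum_mono)
    fix j :: 'n
    have "transpose M $ j = M *v axis j 1"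
      by (simp add: matrix_vector_mult_basis column_def transpose_def)
    then show "norm (transpose M $ j) \<le> k"
      using assms[of "axis j 1"] by simp
  qed
  finally show ?thesis by simp
qed

lemma coercive_inv_norm:
  fixes G :: "real^'n^'n"
  assumes "0 < \<gamma>" and G: "\<And>x. \<gamma> * norm x^2 \<le> x \<bullet> (G *v x)"
  shows "norm (matrix_inv G) \<le> real CARD('n) * (1 / \<gamma>)"
  using coercive_inv(3)[OF assms] \<open>0 < \<gamma>\<close>
  by (intro norm_le_of_columns) (simp add: field_simps)

text \<open>The quadratic polynomial \<open>r\<close> \<mapsto> form at
  \<open>x + r *\<^sub>R y\<close> is nonnegative, so its discriminant is not positive; a vanishing
  leading coefficient is treated apart.\<close>

lemma psd_cauchy_schwarz:
  fixes M :: "real^'n^'n"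
  assumes s: "sym_mat M" and psd: "\<And>x. 0 \<le> x \<bullet> (M *v x)"
  shows "(x \<bullet> (M *v y))^2 \<le> (x \<bullet> (M *v x)) * (y \<bullet> (M *v y))"
proof -
  let ?a = "x \<bullet> (M *v x)" and ?b = "x \<bullet> (M *v y)" and ?c = "y \<bullet> (M *v y)"
  have sym: "y \<bullet> (M *v x) = ?b"
    using sym_mat_inner[OF s, of y x] by (simp add: inner_commute)
  have q: "0 \<le> ?a + 2 * r * ?b + r^2 * ?c" for r
    using psd[of "x + r *\<^sub>R y"]
    by (simp add: matrix_vector_right_distrib matrix_vector_mult_scaleR inner_add_left
        inner_add_right sym power2_eq_square algebra_simps)
  have c0: "0 \<le> ?c" by (rule psd)
  show ?thesis
  proof (cases "?c = 0")
    case True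
    have "?b = 0"
    proof (rule ccontr)
      assume "?b \<noteq> 0"
      \<comment> \<open>At this \<open>r\<close> the polynomial, now affine, would take the value
        -1.\<close>
      with q[of "- (?a + 1) / (2 * ?b)"] True show False
        by (simp add: field_simps)
    qed
    with True show ?thesis by simp
  next
    case False
    with c0 have "0 < ?c" by simp
    with q[of "- ?b / ?c"] show ?thesis
      by (simp add: field_simps power2_eq_square)
  qed
qed

text \<open>Cauchy-Schwarz for the form, applied to \<open>M *v x\<close> and \<open>x\<close>,
  gives |Mx|^4 \<le> k^2 |Mx|^2 |x|^2. This replaces an appeal to the spectral theorem.\<close>

lemma psd_norm_le:
  fixes M :: "real^'n^'n"
  assumes s: "sym_mat M" and psd: "\<And>x. 0 \<le> x \<bullet> (M *v x)"
    and le: "\<And>x. x \<bullet> (M *v x) \<le> k * norm x^2" and "0 \<le> k"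
  shows "norm M \<le> real CARD('n) * k"
proof (rule norm_le_of_columns)
  fix x :: "real^'n"
  let ?y = "M *v x"
  have "(?y \<bullet> ?y)^2 \<le> (?y \<bullet> (M *v ?y)) * (x \<bullet> ?y)"
    using psd_cauchy_schwarz[OF s psd] by blast
  also have "\<dots> \<le> (k * norm ?y^2) * (k * norm x^2)"
    by (intro mult_mono le psd) (use \<open>0 \<le> k\<close> in auto)
  finally have "norm ?y^2 * norm ?y^2 \<le> (k * norm x)^2 * norm ?y^2"
    by (simp add: dot_square_norm power2_eq_square mult_ac)
  then have "norm ?y^2 \<le> (k * norm x)^2 \<or> ?y = 0"
    by (simp only: mult_le_cancel_right) (auto simp: not_le)
  then show "norm ?y \<le> k * norm x"
    using \<open>0 \<le> k\<close> by (auto intro: power2_le_imp_le)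
qed

text \<open>The constant is the minimum of the form on the compact unit sphere; homogeneity does the
  rest.\<close>

lemma pos_def_coercive:
  fixes M :: "real^'n^'n"
  assumes "pos_def M"
  obtains \<gamma> where "0 < \<gamma>" "\<And>x. \<gamma> * norm x^2 \<le> x \<bullet> (M *v x)"
proof -
  let ?f = "\<lambda>x. x \<bullet> (M *v x)"
  have c: "continuous_on (sphere 0 1) ?f"
    by (intro continuous_intros continuous_on_mult_vec)
  have "sphere (0::real^'n) 1 \<noteq> {}" by simp
  then obtain u where u: "u \<in> sphere 0 1" "\<And>x. x \<in> sphere 0 1 \<Longrightarrow> ?f u \<le> ?f x"
    using continuous_attains_inf[OF compact_sphere _ c] by blast
  show thesis
  proof
    have "u \<noteq> 0" using u(1) by auto
    then show "0 < ?f u" using assms by (auto simp: pos_def_def)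
    fix x :: "real^'n"
    show "?f u * norm x^2 \<le> ?f x"
    proof (cases "x = 0")
      case False
      have "?f u \<le> ?f (x /\<^sub>R norm x)"
        using False by (intro u(2)) simp
      also have "\<dots> = ?f x / norm x^2"
        by (simp add: matrix_vector_mult_scaleR power2_eq_square divide_inverse mult_ac)
      finally show ?thesis using False by (simp add: field_simps)
    qed simp
  qed
qed

lemma loewner_ge_scaled_mat:
  assumes "M \<succeq> e *\<^sub>R mat 1"
  shows "sym_mat M" "e * norm x^2 \<le> x \<bullet> (M *v x)"
proof -
  have "sym_mat (M - e *\<^sub>R mat 1)" and ps: "0 \<le> x \<bullet> ((M - e *\<^sub>R mat 1) *v x)"
    using assms by (auto simp: loewner_ge_def pos_semidef_def)
  then show "sym_mat M"
    by (simp add: sym_mat_def transpose_diff transpose_scalar)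
  show "e * norm x^2 \<le> x \<bullet> (M *v x)"
    using ps by (simp add: matrix_vector_mult_diff_rdistrib inner_diff_right
        power2_norm_eq_inner flip: scaleR_matrix_vector_assoc)
qed

lemma loewner_geI:
  assumes "sym_mat M" "\<And>x. e * norm x^2 \<le> x \<bullet> (M *v x)"
  shows "M \<succeq> e *\<^sub>R mat 1"
  using assms
  by (simp add: loewner_ge_def pos_semidef_def sym_mat_def transpose_diff transpose_scalar
      matrix_vector_mult_diff_rdistrib inner_diff_right power2_norm_eq_inner
      flip: scaleR_matrix_vector_assoc)

lemma sym_mat_congruence: "sym_mat Q \<Longrightarrow> sym_mat (transpose C ** Q ** (C::real^'n^'m))"
  by (simp add: sym_mat_def matrix_transpose_mul matrix_mul_assoc)

lemma matrix_mult_diff_right: "A ** (B - C) = A ** B - A ** (C::real^'k^'n)"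
  and matrix_mult_diff_left: "(X - Y) ** Z = X ** Z - Y ** (Z::real^'k^'n)"
  by (vector matrix_matrix_mult_def sum_subtractf algebra_simps)+

lemma has_vector_derivative_iff_quotient:
  "(f has_vector_derivative D) (at t within S) \<longleftrightarrow>
    ((\<lambda>s. (1 / (s - t)) *\<^sub>R (f s - f t)) \<longlongrightarrow> D) (at t within S)"
proof -
  have "\<forall>\<^sub>F s in at t within S. norm (f s - f t - (s - t) *\<^sub>R D) / norm (s - t) =
      norm ((1 / (s - t)) *\<^sub>R (f s - f t) - D)"
    unfolding eventually_at_filter
  proof (intro always_eventually allI impI)
    fix s assume "s \<noteq> t"
    then have "(1 / (s - t)) *\<^sub>R (f s - f t) - D = (1 / (s - t)) *\<^sub>R (f s - f t - (s - t) *\<^sub>R D)"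
      by (simp add: scaleR_diff_right)
    then show "norm (f s - f t - (s - t) *\<^sub>R D) / norm (s - t) =
      norm ((1 / (s - t)) *\<^sub>R (f s - f t) - D)"
      by simp
  qed
  then have "((\<lambda>s. norm (f s - f t - (s - t) *\<^sub>R D) / norm (s - t)) \<longlongrightarrow> 0) (at t within S) \<longleftrightarrow>
      ((\<lambda>s. norm ((1 / (s - t)) *\<^sub>R (f s - f t) - D)) \<longlongrightarrow> 0) (at t within S)"
    by (rule tendsto_cong)
  then show ?thesis
    unfolding has_vector_derivative_def has_derivative_iff_norm
    by (simp add: bounded_linear_scaleR_left tendsto_norm_zero_iff Lim_null[of _ D])
qed

text \<open>Rests on the resolvent identity \<open>J s - J t = - J s (P s - P t) J t\<close> for the
  inverses \<open>J\<close>. Uniform coercivity bounds them, so the identity first gives continuity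
  of \<open>J\<close> and then, divided by \<open>s - t\<close>, its derivative.\<close>

lemma has_vector_derivative_matrix_inv:
  fixes P :: "real \<Rightarrow> real^'n^'n"
  assumes P': "(P has_vector_derivative P') (at t within S)" and "t \<in> S" and "0 < \<gamma>"
    and G: "\<And>s x. s \<in> S \<Longrightarrow> \<gamma> * norm x^2 \<le> x \<bullet> (P s *v x)"
  shows "((\<lambda>s. matrix_inv (P s)) has_vector_derivative
           - (matrix_inv (P t) ** P' ** matrix_inv (P t))) (at t within S)"
proof -
  let ?J = "\<lambda>s. matrix_inv (P s)"
  note inv = coercive_inv[OF \<open>0 < \<gamma>\<close> G]
  have diff: "?J s - ?J t = - (?J s ** (P s - P t) ** ?J t)" if "s \<in> S" for s
  proof -
    have "?J s ** (P s - P t) ** ?J t = (?J s ** P s) ** ?J t - ?J s ** (P t ** ?J t)"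
      by (simp add: matrix_mult_diff_right matrix_mult_diff_left matrix_mul_assoc)
    also have "\<dots> = ?J t - ?J s"
      using inv(1)[OF \<open>t \<in> S\<close>] inv(2)[OF that] by simp
    finally show ?thesis by simp
  qed
  have cP: "(P \<longlongrightarrow> P t) (at t within S)"
    using has_vector_derivative_continuous[OF P'] by (simp add: continuous_within)
  let ?B = "real CARD('n) * (1 / \<gamma>)"
  have "((\<lambda>s. ?J s - ?J t) \<longlongrightarrow> 0) (at t within S)"
  proof (rule Lim_null_comparison)
    show "\<forall>\<^sub>F s in at t within S. norm (?J s - ?J t) \<le> ?B * norm (P s - P t) * ?B"
      unfolding eventually_at_topological
    proof (intro exI[of _ UNIV] conjI ballI impI)
      fix s assume "s \<in> S"
      have "norm (?J s ** (P s - P t) ** ?J t) \<le> norm (?J s) * norm (P s - P t) * norm (?J t)"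
        by (intro order_trans[OF norm_matrix_mult_le] mult_right_mono norm_matrix_mult_le) auto
      also have "\<dots> \<le> ?B * norm (P s - P t) * ?B"
        using coercive_inv_norm[OF \<open>0 < \<gamma>\<close> G] \<open>s \<in> S\<close> \<open>t \<in> S\<close> \<open>0 < \<gamma>\<close>
        by (intro mult_mono) auto
      finally show "norm (?J s - ?J t) \<le> ?B * norm (P s - P t) * ?B"
        by (simp add: diff[OF \<open>s \<in> S\<close>])
    qed auto
    have "((\<lambda>s. ?B * norm (P s - P t) * ?B) \<longlongrightarrow> ?B * norm (P t - P t) * ?B) (at t within S)"
      by (intro tendsto_intros cP)
    then show "((\<lambda>s. ?B * norm (P s - P t) * ?B) \<longlongrightarrow> 0) (at t within S)" by simp
  qed
  then have cJ: "(?J \<longlongrightarrow> ?J t) (at t within S)" by (rule LIM_zero_cancel)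
  have q: "((\<lambda>s. (1 / (s - t)) *\<^sub>R (P s - P t)) \<longlongrightarrow> P') (at t within S)"
    using P' by (simp only: has_vector_derivative_iff_quotient)
  have "((\<lambda>s. - (?J s ** ((1 / (s - t)) *\<^sub>R (P s - P t)) ** ?J t))
      \<longlongrightarrow> - (?J t ** P' ** ?J t)) (at t within S)"
    by (intro tendsto_intros bounded_bilinear.tendsto[OF bounded_bilinear_matrix_mult] cJ q)
  then have "((\<lambda>s. (1 / (s - t)) *\<^sub>R (?J s - ?J t)) \<longlongrightarrow> - (?J t ** P' ** ?J t)) (at t within S)"
    by (rule Lim_transform_eventually)
       (simp add: eventually_at_filter diff matrix_scalar_ac scalar_matrix_assoc)
  then show ?thesis
    by (simp only: has_vector_derivative_iff_quotient)
qed

section \<open>The Riccati equation\<close>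

lemma mult_vec_minus_left: "(- A) *v x = - ((A::real^'n^'m) *v x)"
  by (simp add: matrix_vector_mult_def vec_eq_iff sum_negf)

lemma riccati_rhs_quadratic:
  fixes A V P :: "real^'n^'n" and C :: "real^'n^'m"
  assumes "sym_mat P"
  shows "x \<bullet> (riccati_rhs A C Q V P *v x) =
    2 * (x \<bullet> (A *v (P *v x))) - (C *v (P *v x)) \<bullet> (Q *v (C *v (P *v x))) + x \<bullet> (V *v x)"
proof -
  have "x \<bullet> (P *v (transpose A *v x)) = x \<bullet> (A *v (P *v x))"
    using assms by (simp add: sym_mat_inner inner_mult_vec[of x A] inner_commute)
  moreover have "x \<bullet> (P *v (transpose C *v y)) = (C *v (P *v x)) \<bullet> y" for y
    using assms by (simp add: sym_mat_inner inner_mult_vec[of _ "transpose C"])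
  ultimately show ?thesis
    by (simp add: riccati_rhs_def matrix_vector_mult_add_rdistrib matrix_vector_mult_diff_rdistrib
        inner_add_right inner_diff_right flip: matrix_vector_mul_assoc)
qed

lemma weighted_cross_term_le:
  fixes Q :: "real^'m^'m"
  assumes "0 < q" "\<And>y. q * norm y^2 \<le> y \<bullet> (Q *v y)"
  shows "2 * (w \<bullet> y) - y \<bullet> (Q *v y) \<le> norm w^2 / q"
proof -
  have "0 \<le> norm (w - q *\<^sub>R y)^2" by simp
  also have "\<dots> = norm w^2 - 2 * q * (w \<bullet> y) + q^2 * norm y^2"
    unfolding power2_norm_eq_inner
    by (simp add: inner_diff_left inner_diff_right inner_commute[of y w] power2_eq_square[of q]
        algebra_simps)
  finally have "q * (2 * (w \<bullet> y) - q * norm y^2) \<le> norm w^2"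
    by (simp add: power2_eq_square algebra_simps)
  then have "2 * (w \<bullet> y) - q * norm y^2 \<le> norm w^2 / q"
    using \<open>0 < q\<close> by (simp add: field_simps)
  with assms(2)[of y] show ?thesis by linarith
qed

text \<open>\<open>A\<close> and \<open>C\<close> are arbitrary functions of time here, although in
  the application they contain the estimate. The bounds are parameters separate from
  \<open>T\<close>, so estimates expressed through them are uniform in the horizon.\<close>

locale riccati_flow =
  fixes A :: "real \<Rightarrow> real^'n^'n" and C :: "real \<Rightarrow> real^'n^'m"
    and Q :: "real \<Rightarrow> real^'m^'m" and V :: "real \<Rightarrow> real^'n^'n"
    and P :: "real \<Rightarrow> real^'n^'n" and T ka kc kq kv q v :: real
  assumes P_deriv: "\<And>t. t \<in> {0..T} \<Longrightarrow>
      (P has_vector_derivative riccati_rhs (A t) (C t) (Q t) (V t) (P t)) (at t within {0..T})"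
    and P0_sym: "sym_mat (P 0)"
    and sym: "\<And>t. t \<in> {0..T} \<Longrightarrow> sym_mat (Q t)" "\<And>t. t \<in> {0..T} \<Longrightarrow> sym_mat (V t)"
    and bounds: "\<And>t. t \<in> {0..T} \<Longrightarrow> norm (A t) \<le> ka" "\<And>t. t \<in> {0..T} \<Longrightarrow> norm (C t) \<le> kc"
      "\<And>t. t \<in> {0..T} \<Longrightarrow> norm (Q t) \<le> kq" "\<And>t. t \<in> {0..T} \<Longrightarrow> norm (V t) \<le> kv"
    and coercive: "0 < q" "\<And>t y. t \<in> {0..T} \<Longrightarrow> q * norm y^2 \<le> y \<bullet> (Q t *v y)"
      "0 < v" "\<And>t x. t \<in> {0..T} \<Longrightarrow> v * norm x^2 \<le> x \<bullet> (V t *v x)"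
begin

lemma P_continuous: "continuous_on {0..T} P"
  by (rule has_vector_derivative_continuous_on) (rule P_deriv)

text \<open>The antisymmetric difference \<open>D\<close> solves a linear homogeneous equation,
  because \<open>P M P\<close> minus its transpose is \<open>D M P\<close> plus
  \<open>transpose P M D\<close>. The bound \<open>kp\<close> may depend on \<open>T\<close>, since
  only the vanishing of \<open>D\<close> is concluded.\<close>

lemma P_symmetric:
  assumes t: "t \<in> {0..T}"
  shows "sym_mat (P t)"
proof -
  let ?M = "\<lambda>s. transpose (C s) ** Q s ** C s"
  define D where "D = (\<lambda>s. P s - transpose (P s))"
  define D' where "D' = (\<lambda>s. A s ** D s + D s ** transpose (A s) -
    (D s ** ?M s ** P s + transpose (P s) ** ?M s ** D s))"
  have "compact (P ` {0..T})"
    by (rule compact_continuous_image[OF P_continuous]) simp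
  then obtain kp where kp: "\<And>s. s \<in> {0..T} \<Longrightarrow> norm (P s) \<le> kp"
    using compact_imp_bounded bounded_iff by (metis imageI)
  define K where "K = ka + ka + (kc * kq * kc * kp + kp * (kc * kq * kc))"
  have "D t = 0"
  proof (rule gronwall_zero)
    fix s assume s: "s \<in> {0..T}"
    let ?r = "riccati_rhs (A s) (C s) (Q s) (V s) (P s)"
    have M: "transpose (?M s) = ?M s"
      using sym_mat_congruence[OF sym(1)[OF s]] by (simp add: sym_mat_def)
    have "transpose ?r = transpose (P s) ** transpose (A s) + A s ** transpose (P s)
        - transpose (P s) ** ?M s ** transpose (P s) + V s"
      using sym[OF s]
      by (simp add: riccati_rhs_def transpose_add transpose_diff matrix_transpose_mul
          matrix_mul_assoc sym_mat_def)
    then have "?r - transpose ?r = D' s"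
      unfolding riccati_rhs_def D'_def D_def
      by (simp add: matrix_mult_diff_right matrix_mult_diff_left matrix_mul_assoc algebra_simps)
    then show "(D has_vector_derivative D' s) (at s within {0..T})"
      unfolding D_def
      using has_vector_derivative_diff[OF P_deriv[OF s] has_vector_derivative_transpose[OF P_deriv[OF s]]]
      by simp
    have nn: "0 \<le> ka" "0 \<le> kc" "0 \<le> kq" "0 \<le> kp"
      using bounds[OF s] kp[OF s] norm_ge_zero order_trans by blast+
    have nM: "norm (?M s) \<le> kc * kq * kc"
      using bounds[OF s] nn
      by (intro order_trans[OF norm_matrix_mult_le] mult_mono) auto
    have "norm (D' s) \<le> norm (A s ** D s) + norm (D s ** transpose (A s)) +
        (norm (D s ** ?M s ** P s) + norm (transpose (P s) ** ?M s ** D s))"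
      unfolding D'_def
      by (intro order_trans[OF norm_triangle_ineq4] add_mono norm_triangle_ineq)
    also have "\<dots> \<le> ka * norm (D s) + norm (D s) * ka +
        (norm (D s) * (kc * kq * kc) * kp + kp * (kc * kq * kc) * norm (D s))"
      using bounds[OF s] nn kp[OF s] nM
      by (intro add_mono order_trans[OF norm_matrix_mult_le] mult_mono mult_nonneg_nonneg) auto
    also have "\<dots> = K * norm (D s)"
      by (simp add: K_def algebra_simps)
    finally have "norm (D' s) \<le> K * norm (D s)" .
    then have "norm (D s) * norm (D' s) \<le> norm (D s) * (K * norm (D s))"
      by (rule mult_left_mono) simp
    then show "D s \<bullet> D' s \<le> K * norm (D s)^2"
      using norm_cauchy_schwarz[of "D s" "D' s"] by (simp add: power2_eq_square mult_ac)
  next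
    show "D 0 = 0" using P0_sym by (simp add: D_def sym_mat_def)
  qed (use t in auto)
  then show ?thesis by (simp add: D_def sym_mat_def)
qed

lemma quadratic_deriv:
  assumes t: "t \<in> {0..T}"
  shows "((\<lambda>s. x \<bullet> (P s *v x)) has_real_derivative
    x \<bullet> (riccati_rhs (A t) (C t) (Q t) (V t) (P t) *v x)) (at t within {0..T})"
  using has_vector_derivative_inner[OF has_vector_derivative_const[of x]
      has_vector_derivative_mult_vec[OF P_deriv[OF t] has_vector_derivative_const[of x]]]
  by simp

text \<open>At the first time at which \<open>x \<bullet> P x \<le> p\<close> for some unit vector \<open>x\<close>, this \<open>x\<close> is an
  eigenvector of \<open>P\<close> for the eigenvalue \<open>p\<close>, and the Riccati equation forces \<open>x \<bullet> P x\<close> to grow.\<close>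

lemma P_lower:
  assumes "0 < p" and small: "2 * p * ka + p^2 * (kc * kq * kc) < v"
    and init: "\<And>x. x \<noteq> 0 \<Longrightarrow> p * norm x^2 < x \<bullet> (P 0 *v x)"
    and t: "t \<in> {0..T}"
  shows "p * norm x^2 \<le> x \<bullet> (P t *v x)"
proof -
  define g where "g = (\<lambda>z :: real \<times> (real^'n). snd z \<bullet> (P (fst z) *v snd z))"
  define S where "S = {z \<in> Sigma {0..T} (\<lambda>_. sphere 0 1). g z \<le> p}"
  have cg: "continuous_on (Sigma {0..T} (\<lambda>_. sphere 0 1)) g"
    unfolding g_def
    by (intro continuous_intros continuous_on_mult_vec continuous_on_compose2[OF P_continuous]) auto
  have cS: "compact S"
  proof -
    have "S = Sigma {0..T} (\<lambda>_. sphere 0 1) \<inter> g -` {..p}"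
      by (auto simp: S_def)
    then have "closed S"
      by (simp only:) (intro continuous_closed_preimage cg closed_Times; simp)
    moreover have "bounded (Sigma {0..T} (\<lambda>_. sphere (0::real^'n) 1))"
      by (intro bounded_Times) auto
    then have "bounded S" by (rule bounded_subset) (auto simp: S_def)
    ultimately show ?thesis by (simp add: compact_eq_bounded_closed)
  qed
  have "S = {}"
  proof (rule ccontr)
    assume "S \<noteq> {}"
    then obtain z where z: "z \<in> S" "\<And>y. y \<in> S \<Longrightarrow> fst z \<le> fst y"
      using continuous_attains_inf[OF cS _ continuous_on_fst[OF continuous_on_id]] by auto
    obtain t0 x where zx: "z = (t0, x)" by (cases z)
    have t0: "t0 \<in> {0..T}" and nx: "norm x = 1" and le: "x \<bullet> (P t0 *v x) \<le> p"
      using z(1) by (auto simp: S_def zx g_def)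
    have "x \<noteq> 0" using nx by auto
    have early: "p < y \<bullet> (P s *v y)" if "norm y = 1" "0 \<le> s" "s < t0" for y s
      using z(2)[of "(s, y)"] that t0 by (force simp: S_def zx g_def)
    have "0 < t0"
      using init[OF \<open>x \<noteq> 0\<close>] le t0 nx by (cases "t0 = 0") auto
    have ge: "p \<le> y \<bullet> (P t0 *v y)" if y: "norm y = 1" for y
    proof (rule ccontr)
      assume n: "\<not> ?thesis"
      have c: "continuous_on {0..t0} (\<lambda>s. y \<bullet> (P s *v y))"
        using t0 by (intro continuous_intros continuous_on_mult_vec
            continuous_on_subset[OF P_continuous]) auto
      have "p \<le> y \<bullet> (P s *v y)" if "s \<in> {0..<t0}" for s
        using early[OF y, of s] that by simp
      then have "p \<le> y \<bullet> (P t0 *v y)"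
        using continuous_ge_on_closure[of "{0..<t0}" "\<lambda>s. y \<bullet> (P s *v y)" t0 p] c \<open>0 < t0\<close>
        by (simp add: closure_atLeastLessThan)
      with n show False by simp
    qed
    have psd: "0 \<le> y \<bullet> ((P t0 - p *\<^sub>R mat 1) *v y)" for y
    proof (cases "y = 0")
      case False
      have "p \<le> (y /\<^sub>R norm y) \<bullet> (P t0 *v (y /\<^sub>R norm y))"
        using False by (intro ge) simp
      also have "\<dots> = (y \<bullet> (P t0 *v y)) / (norm y)^2"
        by (simp add: matrix_vector_mult_scaleR power2_eq_square divide_inverse mult_ac)
      finally have "p * norm y^2 \<le> y \<bullet> (P t0 *v y)"
        using False by (simp add: field_simps)
      then show ?thesis
        by (simp add: matrix_vector_mult_diff_rdistrib inner_diff_right power2_norm_eq_inner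
            flip: scaleR_matrix_vector_assoc)
    qed simp
    have symp: "sym_mat (P t0 - p *\<^sub>R mat 1)"
      using P_symmetric[OF t0] by (simp add: sym_mat_def transpose_diff transpose_scalar)
    have "x \<bullet> ((P t0 - p *\<^sub>R mat 1) *v x) = 0"
      using psd[of x] le nx
      by (simp add: matrix_vector_mult_diff_rdistrib inner_diff_right dot_square_norm
            flip: scaleR_matrix_vector_assoc)
    \<comment> \<open>A semidefinite form that vanishes at \<open>x\<close> has \<open>x\<close> in
      its kernel, by Cauchy-Schwarz; this is the eigenvector equation.\<close>
    then have "(y \<bullet> ((P t0 - p *\<^sub>R mat 1) *v x))^2 \<le> 0" for y
      using psd_cauchy_schwarz[OF symp psd, of y x] by simp
    then have "(P t0 - p *\<^sub>R mat 1) *v x = 0"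
      by (metis inner_eq_zero_iff power2_less_eq_zero_iff)
    then have eig: "P t0 *v x = p *\<^sub>R x"
      by (simp add: matrix_vector_mult_diff_rdistrib flip: scaleR_matrix_vector_assoc)
    \<comment> \<open>With \<open>P t0 *v x = p *\<^sub>R x\<close> and |x| = 1, the form of the
      right-hand side at \<open>x\<close> is at least
      \<open>v - 2 * p * ka - p^2 * (kc * kq * kc)\<close>, which is positive by
      \<open>small\<close>.\<close>
    let ?r = "riccati_rhs (A t0) (C t0) (Q t0) (V t0) (P t0)"
    have k0: "0 \<le> kc" "0 \<le> kq" using bounds(2,3)[OF t0] norm_ge_zero order_trans by blast+
    have "- (x \<bullet> (A t0 *v x)) \<le> ka"
      using abs_inner_mult_vec_le[of x "A t0" x] bounds(1)[OF t0] nx by simp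
    then have "p * - (x \<bullet> (A t0 *v x)) \<le> p * ka"
      using \<open>0 < p\<close> by (intro mult_left_mono) auto
    then have 1: "- (2 * (x \<bullet> (A t0 *v (P t0 *v x)))) \<le> 2 * p * ka"
      by (simp only: eig matrix_vector_mult_scaleR inner_scaleR_right)
    have nC: "norm (C t0 *v x) \<le> kc"
      using norm_mult_vec_le[of "C t0" x] bounds(2)[OF t0] nx by simp
    have "(C t0 *v x) \<bullet> (Q t0 *v (C t0 *v x)) \<le> kc * kq * kc"
      using bounds(3)[OF t0] nC k0
      by (intro order_trans[OF inner_mult_vec_le] mult_mono) auto
    then have 2: "(C t0 *v (P t0 *v x)) \<bullet> (Q t0 *v (C t0 *v (P t0 *v x))) \<le> p^2 * (kc * kq * kc)"
      by (simp add: eig matrix_vector_mult_scaleR power2_eq_square mult.assoc mult_left_mono \<open>0 < p\<close> less_imp_le)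
    have 3: "v \<le> x \<bullet> (V t0 *v x)"
      using coercive(4)[OF t0, of x] nx by simp
    have pos: "0 < x \<bullet> (?r *v x)"
      using 1 2 3 small riccati_rhs_quadratic[OF P_symmetric[OF t0], of x "A t0" "C t0" "Q t0" "V t0"]
      by linarith
    \<comment> \<open>A positive derivative at \<open>t0\<close> makes the form smaller than
      \<open>p\<close> just before \<open>t0\<close>, where \<open>early\<close> says that it
      exceeds \<open>p\<close>.\<close>
    obtain e where e: "0 < e" "\<And>h. 0 < h \<Longrightarrow> t0 - h \<in> {0..T} \<Longrightarrow> h < e \<Longrightarrow>
        x \<bullet> (P (t0 - h) *v x) < x \<bullet> (P t0 *v x)"
      using has_real_derivative_pos_inc_left[OF quadratic_deriv[OF t0] pos] by blast
    define h where "h = min (t0 / 2) (e / 2)"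
    have "0 < h" "h < e" "h < t0" using e(1) \<open>0 < t0\<close> by (auto simp: h_def)
    then have "x \<bullet> (P (t0 - h) *v x) < p"
      using e(2)[of h] t0 le by force
    then show False
      using early[OF nx, of "t0 - h"] \<open>0 < h\<close> \<open>h < t0\<close> by simp
  qed
  then have unit: "p < y \<bullet> (P t *v y)" if "norm y = 1" for y
    using t that by (force simp: S_def g_def)
  show ?thesis
  proof (cases "x = 0")
    case False
    have "p < (x /\<^sub>R norm x) \<bullet> (P t *v (x /\<^sub>R norm x))"
      using False by (intro unit) simp
    also have "\<dots> = (x \<bullet> (P t *v x)) / (norm x)^2"
      by (simp add: matrix_vector_mult_scaleR power2_eq_square divide_inverse mult_ac)
    finally show ?thesis
      using False by (simp add: field_simps)
  qed simp
qed

text \<open>The Riccati equation gives \<open>(z \<bullet> P z)' = z \<bullet> V z + 2 w \<bullet> y - y \<bullet> Q y\<close> with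
  \<open>y = C P z\<close>, and completing the square bounds the last two terms by \<open>|w|\<^sup>2 / q\<close>.\<close>

lemma dual_cost:
  assumes t01: "0 \<le> t0" "t0 \<le> t1" "t1 \<le> T"
    and z: "\<And>s. s \<in> {t0..t1} \<Longrightarrow>
      (z has_vector_derivative transpose (C s) *v w s - transpose (A s) *v z s) (at s within {t0..t1})"
    and bz: "\<And>s. s \<in> {t0..t1} \<Longrightarrow> norm (z s) \<le> kz" and bw: "\<And>s. s \<in> {t0..t1} \<Longrightarrow> norm (w s) \<le> kw"
  shows "z t1 \<bullet> (P t1 *v z t1) \<le> z t0 \<bullet> (P t0 *v z t0) + (kv * kz^2 + kw^2 / q) * (t1 - t0)"
proof -
  let ?r = "\<lambda>s. riccati_rhs (A s) (C s) (Q s) (V s) (P s)"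
  define z' where "z' = (\<lambda>s. transpose (C s) *v w s - transpose (A s) *v z s)"
  define k where "k = kv * kz^2 + kw^2 / q"
  define f where "f = (\<lambda>s. z s \<bullet> (P s *v z s) - k * s)"
  define f' where "f' = (\<lambda>s. z s \<bullet> (P s *v z' s + ?r s *v z s) + z' s \<bullet> (P s *v z s) - k)"
  have "f t1 \<le> f t0"
  proof (rule nonincreasing_within[where f = f and f' = f'])
    fix s assume s: "s \<in> {t0..t1}"
    then have sT: "s \<in> {0..T}" using t01 by auto
    have "(P has_vector_derivative ?r s) (at s within {t0..t1})"
      using t01 by (intro has_vector_derivative_within_subset[OF P_deriv[OF sT]]) auto
    from has_vector_derivative_inner[OF z[OF s] has_vector_derivative_mult_vec[OF this z[OF s]]]
    show "(f has_real_derivative f' s) (at s within {t0..t1})"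
      unfolding f_def f'_def z'_def
      by (rule DERIV_cong[OF DERIV_diff]) (auto intro!: derivative_eq_intros)
    note sy = P_symmetric[OF sT]
    let ?y = "C s *v (P s *v z s)"
    \<comment> \<open>By symmetry \<open>z'\<close> contributes twice, with -2 times the term
      containing \<open>A\<close>; the Riccati right-hand side contributes the same term with +2, so
      \<open>A\<close> drops out.\<close>
    have "z s \<bullet> (P s *v z' s) = z' s \<bullet> (P s *v z s)"
      using sym_mat_inner[OF sy] by (metis inner_commute)
    moreover have "z' s \<bullet> (P s *v z s) = w s \<bullet> ?y - z s \<bullet> (A s *v (P s *v z s))"
      by (simp add: z'_def inner_diff_left inner_mult_vec[of "w s"] inner_mult_vec[of "z s" "A s"])
    moreover have "z s \<bullet> (?r s *v z s) = 2 * (z s \<bullet> (A s *v (P s *v z s)))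
        - ?y \<bullet> (Q s *v ?y) + z s \<bullet> (V s *v z s)"
      by (rule riccati_rhs_quadratic[OF sy])
    moreover have "2 * (w s \<bullet> ?y) - ?y \<bullet> (Q s *v ?y) \<le> norm (w s)^2 / q"
      by (rule weighted_cross_term_le) (use coercive sT in auto)
    moreover have "norm (w s)^2 / q \<le> kw^2 / q"
      using bw[OF s] coercive(1) by (intro divide_right_mono power_mono) auto
    moreover have "z s \<bullet> (V s *v z s) \<le> kv * kz^2"
    proof -
      have "0 \<le> kz" "0 \<le> kv" using bz[OF s] bounds(4)[OF sT] norm_ge_zero order_trans by blast+
      then have "z s \<bullet> (V s *v z s) \<le> kz * kv * kz"
        using bz[OF s] bounds(4)[OF sT]
        by (intro order_trans[OF inner_mult_vec_le] mult_mono) auto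
      then show ?thesis by (simp add: power2_eq_square mult_ac)
    qed
    ultimately show "f' s \<le> 0"
      by (simp add: f'_def k_def inner_add_right)
  qed (use t01 in auto)
  then show ?thesis
    unfolding k_def[symmetric] by (simp add: f_def algebra_simps)
qed

text \<open>The matrices \<open>\<Phi> s\<close> and \<open>\<Psi> s\<close> play the role of the transition matrices of \<open>A\<close> from and
  to the initial time \<open>t0\<close> of a window. The control \<open>w = C \<Phi> \<eta>\<close> steers \<open>z\<close> from \<open>0\<close> to \<open>\<zeta>\<close>
  when \<open>\<eta>\<close> solves a linear equation with the Gramian as its matrix.\<close>

lemma P_upper_initial:
  fixes \<Phi> \<Psi> :: "real \<Rightarrow> real^'n^'n"
  assumes t: "t \<in> {0..T}"
    and \<Psi>: "\<And>s. s \<in> {0..t} \<Longrightarrow> (\<Psi> has_vector_derivative - (\<Psi> s ** A s)) (at s within {0..t})"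
    and inv: "\<Phi> t ** \<Psi> t = mat 1"
    and b: "\<And>s. s \<in> {0..t} \<Longrightarrow> norm (\<Psi> s) \<le> kf" "norm (\<Phi> t) \<le> kf"
    and h: "t \<le> h" and kv: "0 \<le> kv"
  shows "\<zeta> \<bullet> (P t *v \<zeta>) \<le> (kf^4 * norm (P 0) + kv * kf^4 * h) * norm \<zeta>^2"
proof -
  \<comment> \<open>Before a full window has elapsed no control is used: \<open>z\<close> is the
    free adjoint solution that ends at \<open>\<zeta>\<close>, and the price is the initial form of
    \<open>P 0\<close>.\<close>
  define g where "g = transpose (\<Phi> t) *v \<zeta>"
  define z where "z = (\<lambda>s. transpose (\<Psi> s) *v g)"
  have kf: "0 \<le> kf" using b(2) norm_ge_zero order_trans by blast
  have g: "norm g \<le> kf * norm \<zeta>"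
    unfolding g_def using b(2) by (intro order_trans[OF norm_mult_vec_le] mult_right_mono) auto
  have zb: "norm (z s) \<le> kf^2 * norm \<zeta>" if "s \<in> {0..t}" for s
  proof -
    have "norm (z s) \<le> kf * (kf * norm \<zeta>)"
      unfolding z_def using b(1)[OF that] g kf
      by (intro order_trans[OF norm_mult_vec_le] mult_mono) auto
    then show ?thesis by (simp add: power2_eq_square)
  qed
  have zt: "z t = \<zeta>"
    by (simp add: z_def g_def matrix_vector_mul_assoc inv flip: matrix_transpose_mul)
  have "z t \<bullet> (P t *v z t) \<le> z 0 \<bullet> (P 0 *v z 0) + (kv * (kf^2 * norm \<zeta>)^2 + 0^2 / q) * (t - 0)"
  proof (rule dual_cost[where w = "\<lambda>s. 0"])
    fix s assume s: "s \<in> {0..t}"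
    have "((\<lambda>s. transpose (\<Psi> s) *v g) has_vector_derivative transpose (- (\<Psi> s ** A s)) *v g)
       (at s within {0..t})"
      using has_vector_derivative_mult_vec[OF has_vector_derivative_transpose[OF \<Psi>[OF s]]
          has_vector_derivative_const[of g]] by simp
    then show "(z has_vector_derivative transpose (C s) *v 0 - transpose (A s) *v z s) (at s within {0..t})"
      by (simp add: z_def transpose_minus matrix_transpose_mul matrix_vector_mul_assoc mult_vec_minus_left)
  qed (use t zb in auto)
  also have "z 0 \<bullet> (P 0 *v z 0) \<le> (kf^2 * norm \<zeta>) * norm (P 0) * (kf^2 * norm \<zeta>)"
    using zb[of 0] t kf by (intro order_trans[OF inner_mult_vec_le] mult_mono) auto
  also have "(kv * (kf^2 * norm \<zeta>)^2 + 0^2 / q) * (t - 0) \<le> kv * (kf^2 * norm \<zeta>)^2 * h"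
    using h kv t by (simp add: mult_left_mono)
  finally show ?thesis
    by (simp add: zt power2_eq_square power4_eq_xxxx algebra_simps)
qed

lemma P_upper_window:
  fixes \<Phi> \<Psi> :: "real \<Rightarrow> real^'n^'n"
  assumes t01: "0 \<le> t0" "t0 \<le> t1" "t1 \<le> T"
    and \<Psi>: "\<And>s. s \<in> {t0..t1} \<Longrightarrow> (\<Psi> has_vector_derivative - (\<Psi> s ** A s)) (at s within {t0..t1})"
    and inv: "\<And>s. s \<in> {t0..t1} \<Longrightarrow> \<Phi> s ** \<Psi> s = mat 1"
    and b: "\<And>s. s \<in> {t0..t1} \<Longrightarrow> norm (\<Psi> s) \<le> kf" "\<And>s. s \<in> {t0..t1} \<Longrightarrow> norm (\<Phi> s) \<le> kf"
    and cont: "continuous_on {t0..t1} \<Phi>" "continuous_on {t0..t1} C"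
    and "0 < \<gamma>"
    and gram: "\<And>x. \<gamma> * norm x^2 \<le> integral {t0..t1} (\<lambda>s. norm (C s *v (\<Phi> s *v x))^2)"
  shows "\<zeta> \<bullet> (P t1 *v \<zeta>) \<le>
    (kv * (kf * (kf^2 * kc^2 * (t1 - t0) * kf / \<gamma>))^2 + (kc * kf * kf / \<gamma>)^2 / q) * (t1 - t0) * norm \<zeta>^2"
proof -
  define F where "F = (\<lambda>s. transpose (C s ** \<Phi> s) ** (C s ** \<Phi> s))"
  define G where "G = (\<lambda>s. integral {t0..s} F)"
  have cF: "continuous_on {t0..t1} F"
    unfolding F_def using cont by (intro continuous_on_matrix_mult continuous_on_transpose)
  have G': "(G has_vector_derivative F s) (at s within {t0..t1})" if "s \<in> {t0..t1}" for s
    unfolding G_def using integral_has_vector_derivative[OF cF that] .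
  have Fx: "x \<bullet> (F s *v x) = norm (C s *v (\<Phi> s *v x))^2" for x s
    by (simp add: F_def power2_norm_eq_inner inner_mult_vec matrix_transpose_mul
        flip: matrix_vector_mul_assoc)
  have bl: "bounded_linear (\<lambda>M. x \<bullet> (M *v x))" for x :: "real^'n"
    by (rule bounded_linear_compose[OF bounded_linear_inner_right
          bounded_bilinear.bounded_linear_left[OF bounded_bilinear_mult_vec]])
  have "x \<bullet> (G t1 *v x) = integral {t0..t1} (\<lambda>s. norm (C s *v (\<Phi> s *v x))^2)" for x
    using integral_linear[OF integrable_continuous_real[OF cF] bl[of x]]
    by (simp add: G_def Fx o_def)
  then have coer: "\<gamma> * norm x^2 \<le> x \<bullet> (G t1 *v x)" for x
    using gram by simp
  \<comment> \<open>This equation makes \<open>z t1\<close> equal to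
    \<open>transpose (\<Psi> t1) *v (transpose (\<Phi> t1) *v \<zeta>)\<close>, that is
    \<open>\<zeta>\<close>.\<close>
  obtain \<eta> where \<eta>: "G t1 *v \<eta> = transpose (\<Phi> t1) *v \<zeta>" "\<gamma> * norm \<eta> \<le> norm (transpose (\<Phi> t1) *v \<zeta>)"
    using coercive_solve[OF \<open>0 < \<gamma>\<close> coer] .
  have t1: "t1 \<in> {t0..t1}" using t01 by simp
  have kf: "0 \<le> kf" using b(2)[OF t1] norm_ge_zero order_trans by blast
  have "t1 \<in> {0..T}" using t01 by auto
  then have kc: "0 \<le> kc" using bounds(2) norm_ge_zero order_trans by blast
  have "norm (transpose (\<Phi> t1) *v \<zeta>) \<le> kf * norm \<zeta>"
    using b(2)[OF t1] by (intro order_trans[OF norm_mult_vec_le] mult_right_mono) auto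
  then have n\<eta>: "norm \<eta> \<le> kf * norm \<zeta> / \<gamma>"
    using \<eta>(2) \<open>0 < \<gamma>\<close> by (simp add: field_simps)
  have nC\<Phi>: "norm (C s ** \<Phi> s) \<le> kc * kf" if "s \<in> {t0..t1}" for s
    using b(2)[OF that] bounds(2)[of s] that t01 kf kc
    by (intro order_trans[OF norm_matrix_mult_le] mult_mono) auto
  have nF: "norm (F s) \<le> kf^2 * kc^2" if "s \<in> {t0..t1}" for s
  proof -
    have "norm (F s) \<le> (kc * kf) * (kc * kf)"
      unfolding F_def using nC\<Phi>[OF that] kf kc
      by (intro order_trans[OF norm_matrix_mult_le[of "transpose (C s ** \<Phi> s)" "C s ** \<Phi> s"]]
          mult_mono) auto
    then show ?thesis by (simp add: power2_eq_square mult_ac)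
  qed
  have nG: "norm (G s) \<le> kf^2 * kc^2 * (t1 - t0)" if s: "s \<in> {t0..t1}" for s
  proof -
    have "norm (G s) \<le> kf^2 * kc^2 * (s - t0)"
      unfolding G_def using s by (intro integral_bound continuous_on_subset[OF cF] nF) auto
    also have "\<dots> \<le> kf^2 * kc^2 * (t1 - t0)"
      using s by (intro mult_left_mono) auto
    finally show ?thesis .
  qed
  define w where "w = (\<lambda>s. (C s ** \<Phi> s) *v \<eta>)"
  define z where "z = (\<lambda>s. transpose (\<Psi> s) *v (G s *v \<eta>))"
  define kz where "kz = kf * (kf^2 * kc^2 * (t1 - t0) * kf / \<gamma>) * norm \<zeta>"
  define kw where "kw = kc * kf * kf / \<gamma> * norm \<zeta>"
  have "z t1 \<bullet> (P t1 *v z t1) \<le> z t0 \<bullet> (P t0 *v z t0) + (kv * kz^2 + kw^2 / q) * (t1 - t0)"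
  proof (rule dual_cost[where w = w])
    fix s assume s: "s \<in> {t0..t1}"
    have "((\<lambda>s. transpose (\<Psi> s) *v (G s *v \<eta>)) has_vector_derivative
        transpose (\<Psi> s) *v (F s *v \<eta>) + transpose (- (\<Psi> s ** A s)) *v (G s *v \<eta>)) (at s within {t0..t1})"
      using has_vector_derivative_mult_vec[OF has_vector_derivative_transpose[OF \<Psi>[OF s]]
         has_vector_derivative_mult_vec[OF G'[OF s] has_vector_derivative_const[of \<eta>]]] by simp
    \<comment> \<open>\<open>\<Psi>\<close> undoes the outer factor \<open>\<Phi>\<close> of the
      Gramian density, so its contribution to \<open>z'\<close> is exactly the control term.\<close>
    moreover have "transpose (\<Psi> s) *v (F s *v \<eta>) = transpose (C s) *v w s"
    proof -
      have "transpose (\<Psi> s) ** F s = transpose (\<Phi> s ** \<Psi> s) ** (transpose (C s) ** (C s ** \<Phi> s))"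
        by (simp add: F_def matrix_transpose_mul matrix_mul_assoc)
      then show ?thesis
        by (simp add: inv[OF s] w_def matrix_vector_mul_assoc)
    qed
    moreover have "transpose (- (\<Psi> s ** A s)) *v (G s *v \<eta>) = - (transpose (A s) *v z s)"
      by (simp add: z_def transpose_minus matrix_transpose_mul mult_vec_minus_left flip: matrix_vector_mul_assoc)
    ultimately show "(z has_vector_derivative transpose (C s) *v w s - transpose (A s) *v z s)
        (at s within {t0..t1})"
      by (simp add: z_def)
    have "norm (w s) \<le> (kc * kf) * (kf * norm \<zeta> / \<gamma>)"
      unfolding w_def using nC\<Phi>[OF s] n\<eta> kf kc
      by (intro order_trans[OF norm_mult_vec_le] mult_mono) auto
    then show "norm (w s) \<le> kw" by (simp add: kw_def)
    have "norm (z s) \<le> kf * ((kf^2 * kc^2 * (t1 - t0)) * (kf * norm \<zeta> / \<gamma>))"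
      unfolding z_def using b(1)[OF s] nG[OF s] n\<eta> kf kc t01
      by (intro order_trans[OF norm_mult_vec_le] mult_mono order_trans[OF norm_mult_vec_le]) auto
    then show "norm (z s) \<le> kz" by (simp add: kz_def)
  qed (use t01 in auto)
  \<comment> \<open>Starting from 0 removes \<open>P t0\<close> from the cost, so the bound does not
    depend on the history of \<open>P\<close> and is the same for every window.\<close>
  moreover have "z t0 = 0" by (simp add: z_def G_def)
  moreover have "z t1 = \<zeta>"
    unfolding z_def \<eta>(1) by (simp add: matrix_vector_mul_assoc inv[OF t1] flip: matrix_transpose_mul)
  moreover have "(kv * (c1 * N)^2 + (c2 * N)^2 / q) * h = (kv * c1^2 + c2^2 / q) * h * N^2"
    for c1 c2 N h :: real
    by (simp add: power_mult_distrib algebra_simps)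
  ultimately show ?thesis
    by (simp only: kz_def kw_def inner_zero_left add_0_left)
qed

text \<open>The derivative of the inverse is minus the Riccati right-hand side conjugated by the
  inverse. Written in \<eta>, the terms with \<open>A\<close> cancel, one of the two output terms of
  the innovation survives, and \<open>V\<close> yields dissipation in \<eta>; \<open>e\<close> is an
  arbitrary perturbation.\<close>

lemma lyapunov_deriv:
  assumes t: "t \<in> {0..T}" and "0 < p"
    and P: "\<And>s x. s \<in> {0..T} \<Longrightarrow> p * norm x^2 \<le> x \<bullet> (P s *v x)"
    and x: "(x has_vector_derivative A t *v x t -
      P t *v (transpose (C t) *v (Q t *v (C t *v x t))) + e) (at t within {0..T})"
    and \<eta>: "\<eta> = matrix_inv (P t) *v x t"
  shows "((\<lambda>s. x s \<bullet> (matrix_inv (P s) *v x s)) has_real_derivative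
     - ((C t *v x t) \<bullet> (Q t *v (C t *v x t))) - \<eta> \<bullet> (V t *v \<eta>) + 2 * (\<eta> \<bullet> e)) (at t within {0..T})"
proof -
  let ?r = "riccati_rhs (A t) (C t) (Q t) (V t) (P t)" and ?J = "matrix_inv (P t)"
  let ?y = "C t *v x t"
  define x' where "x' = A t *v x t - P t *v (transpose (C t) *v (Q t *v ?y)) + e"
  note inv = coercive_inv[OF \<open>0 < p\<close> P[OF t]] and sP = P_symmetric[OF t]
  have "transpose ?J ** P t = transpose (P t ** ?J)"
    using sP by (simp add: matrix_transpose_mul sym_mat_def)
  then have "transpose ?J ** P t = mat 1" using inv(1) by simp
  then have "transpose ?J = ?J"
    by (metis inv(1) matrix_mul_assoc matrix_mul_lid matrix_mul_rid)
  then have sJ: "sym_mat ?J" by (simp add: sym_mat_def)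
  have P\<eta>: "P t *v \<eta> = x t"
    using inv(1) by (simp add: \<eta> matrix_vector_mul_assoc)
  have "((\<lambda>s. x s \<bullet> (matrix_inv (P s) *v x s)) has_real_derivative
     x t \<bullet> (?J *v x' + - (?J ** ?r ** ?J) *v x t) + x' \<bullet> (?J *v x t)) (at t within {0..T})"
    using x unfolding x'_def
    by (intro has_vector_derivative_inner has_vector_derivative_mult_vec
        has_vector_derivative_matrix_inv[OF P_deriv[OF t] t \<open>0 < p\<close> P])
  moreover have "x t \<bullet> (?J *v x') = \<eta> \<bullet> x'"
    using sym_mat_inner[OF sJ] by (simp add: \<eta>)
  moreover have "x t \<bullet> (- (?J ** ?r ** ?J) *v x t) = - (\<eta> \<bullet> (?r *v \<eta>))"
    using sym_mat_inner[OF sJ, of "x t"]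
    by (simp add: \<eta> mult_vec_minus_left flip: matrix_vector_mul_assoc)
  moreover have "\<eta> \<bullet> (?r *v \<eta>) = 2 * (\<eta> \<bullet> (A t *v x t)) - ?y \<bullet> (Q t *v ?y) + \<eta> \<bullet> (V t *v \<eta>)"
    using riccati_rhs_quadratic[OF sP, of \<eta>] by (simp add: P\<eta>)
  moreover have "\<eta> \<bullet> x' = \<eta> \<bullet> (A t *v x t) - ?y \<bullet> (Q t *v ?y) + \<eta> \<bullet> e"
  proof -
    have "\<eta> \<bullet> (P t *v (transpose (C t) *v (Q t *v ?y))) = ?y \<bullet> (Q t *v ?y)"
      using sym_mat_inner[OF sP] by (simp add: P\<eta> inner_mult_vec[of _ "transpose (C t)"])
    then show ?thesis by (simp add: x'_def inner_add_right inner_diff_right)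
  qed
  moreover have "x' \<bullet> (?J *v x t) = \<eta> \<bullet> x'"
    by (simp add: \<eta> inner_commute)
  ultimately show ?thesis
    by (elim DERIV_cong) (simp add: inner_add_right)
qed

end

section \<open>Ordinary differential equations on the half-line\<close>

lemma integral_has_vector_derivative_halfline:
  fixes f :: "real \<Rightarrow> 'a::banach"
  assumes f: "continuous_on {a..} f" and t: "a \<le> t"
  shows "((\<lambda>t. integral {a..t} f) has_vector_derivative f t) (at t within {a..})"
proof -
  have "((\<lambda>t. integral {a..t} f) has_vector_derivative f t) (at t within {a..t+1})"
    using t by (intro integral_has_vector_derivative continuous_on_subset[OF f]) auto
  moreover have "at t within {a..t+1} = at t within {a..}"
    using t by (intro at_within_nhd[of t "{..<t+1}"]) auto
  ultimately show ?thesis by simp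
qed

lemma norm_integral_exp_le:
  fixes f :: "real \<Rightarrow> 'a::euclidean_space"
  assumes "0 < \<kappa>" "0 \<le> t" "0 \<le> c" and int: "f integrable_on {0..t}"
    and le: "\<And>s. s \<in> {0..t} \<Longrightarrow> norm (f s) \<le> c * exp (\<kappa> * s)"
  shows "norm (integral {0..t} f) \<le> c / \<kappa> * exp (\<kappa> * t)"
proof -
  have "((\<lambda>s. c * exp (\<kappa> * s)) has_integral c / \<kappa> * exp (\<kappa> * t) - c / \<kappa> * exp (\<kappa> * 0)) {0..t}"
    using assms(1,2)
    by (intro fundamental_theorem_of_calculus)
      (auto intro!: derivative_eq_intros simp flip: has_real_derivative_iff_has_vector_derivative)
  then have i: "(\<lambda>s. c * exp (\<kappa> * s)) integrable_on {0..t}"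
    and e: "integral {0..t} (\<lambda>s. c * exp (\<kappa> * s)) = c / \<kappa> * exp (\<kappa> * t) - c / \<kappa>"
    by (auto simp: has_integral_iff)
  have "norm (integral {0..t} f) \<le> integral {0..t} (\<lambda>s. c * exp (\<kappa> * s))"
    by (rule integral_norm_bound_integral[OF int i le])
  also have "\<dots> \<le> c / \<kappa> * exp (\<kappa> * t)"
    unfolding e using assms(1,3) by simp
  finally show ?thesis .
qed

text \<open>The weight \<open>exp (- \<kappa> * t)\<close> makes the Picard operator a contraction on the whole half-line.\<close>

theorem global_solution:
  fixes F :: "real \<Rightarrow> 'a::euclidean_space \<Rightarrow> 'a"
  assumes cont: "\<And>u. continuous_on {0..} u \<Longrightarrow> continuous_on {0..} (\<lambda>t. F t (u t))"
    and bnd: "\<And>t x. 0 \<le> t \<Longrightarrow> norm (F t x) \<le> B"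
    and lip: "\<And>t x y. 0 \<le> t \<Longrightarrow> norm (F t x - F t y) \<le> L * norm (x - y)"
  obtains X where "X 0 = x0"
    "\<And>t. 0 \<le> t \<Longrightarrow> (X has_vector_derivative F t (X t)) (at t within {0..})"
proof -
  \<comment> \<open>A strictly positive Lipschitz constant; the weight rate \<open>2 * M\<close>
    turns it into the contraction factor 1/2.\<close>
  define M where "M = max L 1"
  define \<kappa> where "\<kappa> = 2 * M"
  have "1 \<le> M" by (simp add: M_def)
  then have "0 < \<kappa>" by (simp add: \<kappa>_def)
  have lipM: "norm (F t x - F t y) \<le> M * norm (x - y)" if "0 \<le> t" for t x y
    by (rule order_trans[OF lip[OF that] mult_right_mono]) (auto simp: M_def)
  have B: "0 \<le> B" using bnd[of 0 x0] norm_ge_zero order_trans by blast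
  \<comment> \<open>The fixed point is sought among bounded continuous functions \<open>u\<close>;
    \<open>E u\<close> removes the weight and is the actual candidate solution.\<close>
  define E where "E = (\<lambda>(u :: real \<Rightarrow>\<^sub>C 'a) s. exp (\<kappa> * s) *\<^sub>R apply_bcontfun u s)"
  define I where "I = (\<lambda>u t. integral {0..t} (\<lambda>s. F s (E u s)))"
  \<comment> \<open>Functions of the type of \<open>u\<close> live on the whole line, so the
    operator is extended to negative times as a constant through \<open>max 0 t\<close>.\<close>
  define G where "G = (\<lambda>u t. exp (- \<kappa> * max 0 t) *\<^sub>R (x0 + I u (max 0 t)))"
  have cF: "continuous_on {0..} (\<lambda>s. F s (E u s))" for u
    unfolding E_def by (intro cont continuous_intros) auto
  have I': "(I u has_vector_derivative F t (E u t)) (at t within {0..})" if "0 \<le> t" for u t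
    unfolding I_def by (rule integral_has_vector_derivative_halfline[OF cF that])
  have cI: "continuous_on {0..} (I u)" for u
    by (rule has_vector_derivative_continuous_on[OF I']) simp
  have int: "(\<lambda>s. F s (E u s)) integrable_on {0..t}" for u t
    by (intro integrable_continuous_real continuous_on_subset[OF cF]) auto
  have G: "G u \<in> bcontfun" for u
  proof -
    have "continuous_on UNIV (G u)"
      unfolding G_def by (intro continuous_intros continuous_on_compose2[OF cI]) auto
    moreover have "norm (G u t) \<le> norm x0 + B / \<kappa>" for t
    proof -
      define \<tau> where "\<tau> = max 0 t"
      have "0 \<le> \<tau>" unfolding \<tau>_def by (rule max.cobounded1)
      have "norm (I u \<tau>) \<le> B / \<kappa> * exp (\<kappa> * \<tau>)"
        unfolding I_def
      proof (rule norm_integral_exp_le[OF \<open>0 < \<kappa>\<close> \<open>0 \<le> \<tau>\<close> B int])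
        fix s assume "s \<in> {0..\<tau>}"
        then have "norm (F s (E u s)) \<le> B" "1 \<le> exp (\<kappa> * s)"
          using bnd \<open>0 < \<kappa>\<close> by auto
        then show "norm (F s (E u s)) \<le> B * exp (\<kappa> * s)"
          using B mult_left_mono[of 1 "exp (\<kappa> * s)" B] by simp
      qed
      then have "exp (- \<kappa> * \<tau>) * norm (I u \<tau>) \<le> exp (- \<kappa> * \<tau>) * (B / \<kappa> * exp (\<kappa> * \<tau>))"
        by (rule mult_left_mono) simp
      also have "\<dots> = B / \<kappa>"
        by (simp flip: exp_add)
      finally have 1: "exp (- \<kappa> * \<tau>) * norm (I u \<tau>) \<le> B / \<kappa>" .
      have "exp (- \<kappa> * \<tau>) \<le> 1" using \<open>0 < \<kappa>\<close> \<open>0 \<le> \<tau>\<close> by simp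
      then have 2: "exp (- \<kappa> * \<tau>) * norm x0 \<le> norm x0"
        by (intro mult_left_le_one_le) auto
      have "norm (G u t) \<le> exp (- \<kappa> * \<tau>) * (norm x0 + norm (I u \<tau>))"
        unfolding G_def \<tau>_def[symmetric]
        by (simp add: norm_triangle_ineq)
      with 1 2 show ?thesis by (simp add: distrib_left)
    qed
    then have "bounded (range (G u))" by (auto simp: bounded_iff)
    ultimately show ?thesis by (simp add: bcontfun_def)
  qed
  define T where "T = (\<lambda>u. Bcontfun (G u))"
  have T: "apply_bcontfun (T u) = G u" for u
    by (simp add: T_def Bcontfun_inverse G)
  have contr: "dist (T u) (T v) \<le> 1/2 * dist u v" for u v
  proof (rule dist_bound)
    fix t :: real
    define \<tau> where "\<tau> = max 0 t"
    have "0 \<le> \<tau>" unfolding \<tau>_def by (rule max.cobounded1)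
    have "I u \<tau> - I v \<tau> = integral {0..\<tau>} (\<lambda>s. F s (E u s) - F s (E v s))"
      unfolding I_def by (simp add: Henstock_Kurzweil_Integration.integral_diff int)
    moreover have "norm (integral {0..\<tau>} (\<lambda>s. F s (E u s) - F s (E v s)))
        \<le> (M * dist u v) / \<kappa> * exp (\<kappa> * \<tau>)"
    proof (rule norm_integral_exp_le[OF \<open>0 < \<kappa>\<close> \<open>0 \<le> \<tau>\<close>])
      fix s assume "s \<in> {0..\<tau>}"
      then have "norm (F s (E u s) - F s (E v s)) \<le> M * norm (E u s - E v s)"
        by (intro lipM) auto
      also have "norm (E u s - E v s) = exp (\<kappa> * s) * dist (apply_bcontfun u s) (apply_bcontfun v s)"
        by (simp add: E_def dist_norm flip: scaleR_diff_right)
      also have "M * (exp (\<kappa> * s) * dist (apply_bcontfun u s) (apply_bcontfun v s))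
          \<le> M * (exp (\<kappa> * s) * dist u v)"
        using \<open>1 \<le> M\<close> by (intro mult_left_mono dist_bounded) auto
      finally show "norm (F s (E u s) - F s (E v s)) \<le> M * dist u v * exp (\<kappa> * s)"
        by (simp add: mult_ac)
    qed (use \<open>1 \<le> M\<close> int in \<open>auto intro: integrable_diff\<close>)
    moreover have "(M * dist u v) / \<kappa> = 1/2 * dist u v"
      using \<open>1 \<le> M\<close> by (simp add: \<kappa>_def)
    ultimately have "norm (I u \<tau> - I v \<tau>) \<le> 1/2 * dist u v * exp (\<kappa> * \<tau>)"
      by simp
    then have "exp (- \<kappa> * \<tau>) * norm (I u \<tau> - I v \<tau>)
        \<le> exp (- \<kappa> * \<tau>) * (1/2 * dist u v * exp (\<kappa> * \<tau>))"
      by (rule mult_left_mono) simp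
    also have "\<dots> = 1/2 * dist u v"
      by (simp flip: exp_add)
    finally have "exp (- \<kappa> * \<tau>) * norm (I u \<tau> - I v \<tau>) \<le> 1/2 * dist u v" .
    moreover have "dist (G u t) (G v t) = exp (- \<kappa> * \<tau>) * norm (I u \<tau> - I v \<tau>)"
      by (simp add: G_def dist_norm flip: \<tau>_def scaleR_diff_right)
    ultimately show "dist (apply_bcontfun (T u) t) (apply_bcontfun (T v) t) \<le> 1/2 * dist u v"
      by (simp add: T)
  qed
  obtain u where u: "T u = u"
    using banach_fix_type[of "1/2" T] contr by auto
  have X: "E u t = x0 + I u t" if "0 \<le> t" for t
  proof -
    have "apply_bcontfun u t = G u t" using T[of u] u by simp
    then show ?thesis
      using that by (simp add: E_def G_def max_def flip: exp_add)
  qed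
  show thesis
  proof
    show "x0 + I u 0 = x0" by (simp add: I_def)
    fix t :: real assume "0 \<le> t"
    show "((\<lambda>t. x0 + I u t) has_vector_derivative F t (x0 + I u t)) (at t within {0..})"
      using has_vector_derivative_add[OF has_vector_derivative_const[of x0] I'[OF \<open>0 \<le> t\<close>, of u]]
      unfolding X[OF \<open>0 \<le> t\<close>, symmetric] by simp
  qed
qed

text \<open>Time-varying maps on \<open>K\<close> for which \<open>global_solution\<close> applies after composition with the
  projection onto \<open>K\<close>.\<close>

definition tame :: "'s::real_normed_vector set \<Rightarrow> (real \<Rightarrow> 's \<Rightarrow> 'b::real_normed_vector) \<Rightarrow> bool" where
  "tame K f \<longleftrightarrow>
    (\<exists>B\<ge>0. \<forall>t\<ge>0. \<forall>x\<in>K. norm (f t x) \<le> B) \<and>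
    (\<exists>L\<ge>0. \<forall>t\<ge>0. \<forall>x\<in>K. \<forall>y\<in>K. norm (f t x - f t y) \<le> L * norm (x - y)) \<and>
    (\<forall>u. continuous_on {0..} u \<longrightarrow> u ` {0..} \<subseteq> K \<longrightarrow> continuous_on {0..} (\<lambda>t. f t (u t)))"

lemma tameI:
  assumes "0 \<le> B" "0 \<le> L" "\<And>t x. 0 \<le> t \<Longrightarrow> x \<in> K \<Longrightarrow> norm (f t x) \<le> B"
    "\<And>t x y. 0 \<le> t \<Longrightarrow> x \<in> K \<Longrightarrow> y \<in> K \<Longrightarrow> norm (f t x - f t y) \<le> L * norm (x - y)"
    "\<And>u. continuous_on {0..} u \<Longrightarrow> u ` {0..} \<subseteq> K \<Longrightarrow> continuous_on {0..} (\<lambda>t. f t (u t))"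
  shows "tame K f"
  using assms unfolding tame_def by metis

lemma tameE:
  assumes "tame K f"
  obtains B L where "0 \<le> B" "0 \<le> L" "\<And>t x. 0 \<le> t \<Longrightarrow> x \<in> K \<Longrightarrow> norm (f t x) \<le> B"
    "\<And>t x y. 0 \<le> t \<Longrightarrow> x \<in> K \<Longrightarrow> y \<in> K \<Longrightarrow> norm (f t x - f t y) \<le> L * norm (x - y)"
proof -
  from assms obtain B where B: "0 \<le> B" "\<forall>t\<ge>0. \<forall>x\<in>K. norm (f t x) \<le> B"
    unfolding tame_def by (elim conjE exE) (rule that)
  from assms obtain L where L: "0 \<le> L" "\<forall>t\<ge>0. \<forall>x\<in>K. \<forall>y\<in>K. norm (f t x - f t y) \<le> L * norm (x - y)"
    unfolding tame_def by (elim conjE exE) (rule that)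
  show thesis
    by (rule that[of B L]) (use B L in auto)
qed

lemma tame_time:
  assumes "continuous_on {0..} f" "bounded (f ` {0..})"
  shows "tame K (\<lambda>t x. f t)"
proof -
  obtain B where "\<And>t. 0 \<le> t \<Longrightarrow> norm (f t) \<le> B"
    using assms(2) by (auto simp: bounded_iff)
  moreover from this[of 0] have "0 \<le> B" using norm_ge_zero order_trans by blast
  ultimately show ?thesis
    using assms(1) by (intro tameI[of B 0]) auto
qed

lemma tame_const: "tame K (\<lambda>t x. c)"
  by (rule tame_time) (auto simp: bounded_iff)

lemma tame_state:
  assumes "bounded K" "bounded_linear h"
  shows "tame K (\<lambda>t x. h x)"
proof -
  obtain L where L: "0 \<le> L" "\<And>x. norm (h x) \<le> norm x * L"
    using bounded_linear.nonneg_bounded[OF assms(2)] by blast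
  obtain B where B: "0 < B" "\<And>x. x \<in> K \<Longrightarrow> norm x \<le> B"
    using assms(1) by (auto simp: bounded_pos)
  show ?thesis
  proof (rule tameI[of "B * L" L])
    fix x assume "x \<in> K"
    then show "norm (h x) \<le> B * L"
      using L B by (meson mult_right_mono order_trans)
  next
    fix x y show "norm (h x - h y) \<le> L * norm (x - y)"
      using L(2)[of "x - y"] by (simp add: linear_diff[OF bounded_linear.linear[OF assms(2)]] mult.commute)
  next
    fix u :: "real \<Rightarrow> 'a" assume "continuous_on {0..} u"
    then show "continuous_on {0..} (\<lambda>t. h (u t))"
      by (rule bounded_linear.continuous_on[OF assms(2)])
  qed (use L B in auto)
qed

lemma tame_bilinear:
  assumes "bounded_bilinear h" "tame K f" "tame K g"
  shows "tame K (\<lambda>t x. h (f t x) (g t x))"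
proof -
  interpret bounded_bilinear h by fact
  obtain c where c: "0 \<le> c" "\<And>a b. norm (h a b) \<le> norm a * norm b * c"
    using nonneg_bounded by blast
  obtain B L where f: "0 \<le> B" "0 \<le> L" "\<And>t x. 0 \<le> t \<Longrightarrow> x \<in> K \<Longrightarrow> norm (f t x) \<le> B"
      "\<And>t x y. 0 \<le> t \<Longrightarrow> x \<in> K \<Longrightarrow> y \<in> K \<Longrightarrow> norm (f t x - f t y) \<le> L * norm (x - y)"
    using tameE[OF assms(2)] by blast
  obtain B' L' where g: "0 \<le> B'" "0 \<le> L'" "\<And>t x. 0 \<le> t \<Longrightarrow> x \<in> K \<Longrightarrow> norm (g t x) \<le> B'"
      "\<And>t x y. 0 \<le> t \<Longrightarrow> x \<in> K \<Longrightarrow> y \<in> K \<Longrightarrow> norm (g t x - g t y) \<le> L' * norm (x - y)"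
    using tameE[OF assms(3)] by blast
  show ?thesis
  proof (rule tameI[of "B * B' * c" "L * B' * c + B * L' * c"])
    fix t x assume "0 \<le> (t::real)" "x \<in> K"
    then show "norm (h (f t x) (g t x)) \<le> B * B' * c"
      using c(1) f g by (intro order_trans[OF c(2)] mult_mono mult_nonneg_nonneg) auto
  next
    fix t x y assume t: "0 \<le> (t::real)" "x \<in> K" "y \<in> K"
    have "h (f t x) (g t x) - h (f t y) (g t y) = h (f t x - f t y) (g t x) + h (f t y) (g t x - g t y)"
      by (simp add: diff_left diff_right)
    also have "norm \<dots> \<le> L * norm (x - y) * B' * c + B * (L' * norm (x - y)) * c"
      using c(1) f g t
      by (intro order_trans[OF norm_triangle_ineq] add_mono order_trans[OF c(2)] mult_mono
          mult_nonneg_nonneg) auto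
    finally show "norm (h (f t x) (g t x) - h (f t y) (g t y)) \<le> (L * B' * c + B * L' * c) * norm (x - y)"
      by (simp add: algebra_simps)
  next
    fix u :: "real \<Rightarrow> _" assume "continuous_on {0..} u" "u ` {0..} \<subseteq> K"
    then show "continuous_on {0..} (\<lambda>t. h (f t (u t)) (g t (u t)))"
      using assms(2,3) unfolding tame_def by (intro continuous_on) blast+
  qed (use c f g in auto)
qed

lemma tame_linear:
  assumes "bounded_linear h" "tame K f"
  shows "tame K (\<lambda>t x. h (f t x))"
proof -
  \<comment> \<open>A linear map is treated as a bilinear one whose first argument is the constant
    1.\<close>
  have "bounded_bilinear (\<lambda>(a::real) b. a *\<^sub>R h b)"
    by (rule bounded_bilinear.comp[OF bounded_bilinear_scaleR bounded_linear_ident assms(1)])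
  from tame_bilinear[OF this tame_const[of K 1] assms(2)] show ?thesis by simp
qed

lemma tame_add:
  assumes "tame K f" "tame K g"
  shows "tame K (\<lambda>t x. f t x + g t x)"
proof -
  obtain B L where f: "0 \<le> B" "0 \<le> L" "\<And>t x. 0 \<le> t \<Longrightarrow> x \<in> K \<Longrightarrow> norm (f t x) \<le> B"
      "\<And>t x y. 0 \<le> t \<Longrightarrow> x \<in> K \<Longrightarrow> y \<in> K \<Longrightarrow> norm (f t x - f t y) \<le> L * norm (x - y)"
    using tameE[OF assms(1)] by blast
  obtain B' L' where g: "0 \<le> B'" "0 \<le> L'" "\<And>t x. 0 \<le> t \<Longrightarrow> x \<in> K \<Longrightarrow> norm (g t x) \<le> B'"
      "\<And>t x y. 0 \<le> t \<Longrightarrow> x \<in> K \<Longrightarrow> y \<in> K \<Longrightarrow> norm (g t x - g t y) \<le> L' * norm (x - y)"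
    using tameE[OF assms(2)] by blast
  show ?thesis
  proof (rule tameI[of "B + B'" "L + L'"])
    fix t x assume "0 \<le> (t::real)" "x \<in> K"
    then show "norm (f t x + g t x) \<le> B + B'"
      using f g by (intro order_trans[OF norm_triangle_ineq] add_mono) auto
  next
    fix t x y assume t: "0 \<le> (t::real)" "x \<in> K" "y \<in> K"
    have "f t x + g t x - (f t y + g t y) = (f t x - f t y) + (g t x - g t y)" by simp
    also have "norm \<dots> \<le> L * norm (x - y) + L' * norm (x - y)"
      using f g t by (intro order_trans[OF norm_triangle_ineq] add_mono) auto
    finally show "norm (f t x + g t x - (f t y + g t y)) \<le> (L + L') * norm (x - y)"
      by (simp add: algebra_simps)
  next
    fix u :: "real \<Rightarrow> _" assume "continuous_on {0..} u" "u ` {0..} \<subseteq> K"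
    then show "continuous_on {0..} (\<lambda>t. f t (u t) + g t (u t))"
      using assms unfolding tame_def by (intro continuous_on_add) blast+
  qed (use f g in auto)
qed

lemma tame_minus: "tame K f \<Longrightarrow> tame K (\<lambda>t x. - f t x)"
  by (rule tame_linear) (rule bounded_linear_minus[OF bounded_linear_ident])

lemma tame_diff: "tame K f \<Longrightarrow> tame K g \<Longrightarrow> tame K (\<lambda>t x. f t x - g t x)"
  using tame_add[OF _ tame_minus] by fastforce

lemma tame_Pair: "tame K f \<Longrightarrow> tame K g \<Longrightarrow> tame K (\<lambda>t x. (f t x, g t x))"
proof -
  assume "tame K f" "tame K g"
  then have "tame K (\<lambda>t x. (f t x, 0) + (0, g t x))"
    by (intro tame_add tame_linear[where h = "\<lambda>y. (y, 0)"] tame_linear[where h = "\<lambda>y. (0, y)"]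
        bounded_linear_Pair bounded_linear_ident bounded_linear_zero)
  then show ?thesis by simp
qed

text \<open>The projection onto a closed convex set is 1-Lipschitz with values in \<open>K\<close>,
  so bounds valid on \<open>K\<close> become global. The result solves the original equation only at
  times when \<open>X t\<close> lies in \<open>K\<close>.\<close>

lemma tame_solution:
  fixes f :: "real \<Rightarrow> 'a::euclidean_space \<Rightarrow> 'a"
  assumes K: "convex K" "closed K" "K \<noteq> {}" and f: "tame K f"
  obtains X where "X 0 = x0"
    "\<And>t. 0 \<le> t \<Longrightarrow> (X has_vector_derivative f t (closest_point K (X t))) (at t within {0..})"
proof -
  obtain B L where b: "\<And>t x. 0 \<le> t \<Longrightarrow> x \<in> K \<Longrightarrow> norm (f t x) \<le> B" "0 \<le> L"
      "\<And>t x y. 0 \<le> t \<Longrightarrow> x \<in> K \<Longrightarrow> y \<in> K \<Longrightarrow> norm (f t x - f t y) \<le> L * norm (x - y)"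
    by (rule tameE[OF f]) (rule that; blast)
  note cK = closest_point_in_set[OF K(2,3)]
  show thesis
  proof (rule global_solution[of "\<lambda>t x. f t (closest_point K x)" B L x0])
    fix u :: "real \<Rightarrow> 'a" assume u: "continuous_on {0..} u"
    have "continuous_on {0..} (\<lambda>t. closest_point K (u t))"
      by (rule continuous_on_compose2[OF continuous_on_closest_point[OF K, of UNIV] u]) auto
    then show "continuous_on {0..} (\<lambda>t. f t (closest_point K (u t)))"
      using f cK unfolding tame_def by blast
  next
    fix t x y assume "0 \<le> (t::real)"
    then have "norm (f t (closest_point K x) - f t (closest_point K y))
        \<le> L * norm (closest_point K x - closest_point K y)"
      using b(3) cK by blast
    also have "\<dots> \<le> L * norm (x - y)"
      using closest_point_lipschitz[OF K, of x y] b(2) by (intro mult_left_mono) (auto simp: dist_norm)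
    finally show "norm (f t (closest_point K x) - f t (closest_point K y)) \<le> L * norm (x - y)" .
  qed (use b cK that in blast)+
qed

section \<open>Block structure of the observer\<close>

definition join :: "real^3 \<Rightarrow> real^3 \<Rightarrow> real^(3+3)" where
  "join u w = (\<chi> i. case i of Inl k \<Rightarrow> u $ k | Inr k \<Rightarrow> w $ k)"

lemma sum_UNIV_Plus: "(\<Sum>i\<in>(UNIV::('a::finite + 'b::finite) set). f i) = (\<Sum>k\<in>UNIV. f (Inl k)) + (\<Sum>k\<in>UNIV. f (Inr k))"
  by (simp add: UNIV_Plus_UNIV[symmetric] sum.Plus del: UNIV_Plus_UNIV)

lemma join_nth [simp]: "join u w $ Inl k = u $ k" "join u w $ Inr k = w $ k"
  by (simp_all add: join_def)

lemma vec_Plus_eq_iff: "(x :: 'a^('b::finite + 'c::finite)) = y \<longleftrightarrow> (\<forall>k. x $ Inl k = y $ Inl k) \<and> (\<forall>k. x $ Inr k = y $ Inr k)"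
  by (metis vec_eq_iff sum.exhaust)

lemma parts_join [simp]: "upper_part (join u w) = u" "lower_part (join u w) = w"
  by (simp_all add: upper_part_def lower_part_def vec_eq_iff)

lemma join_parts: "join (upper_part x) (lower_part x) = x"
  by (simp add: vec_Plus_eq_iff upper_part_def lower_part_def)

lemma norm_join: "norm (join u w)^2 = norm u^2 + norm w^2"
  by (simp add: norm_vec_sq sum_UNIV_Plus)

lemma norm_join_le: "norm (join u w) \<le> norm u + norm w"
  by (rule power2_le_imp_le) (simp_all add: norm_join power2_sum)

lemma norm_parts_le: "norm (upper_part x) \<le> norm x" "norm (lower_part x) \<le> norm x"
proof -
  have "norm x^2 = norm (upper_part x)^2 + norm (lower_part x)^2"
    using norm_join[of "upper_part x" "lower_part x"] by (simp add: join_parts)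
  then show "norm (upper_part x) \<le> norm x" "norm (lower_part x) \<le> norm x"
    by (auto intro: power2_le_imp_le)
qed

lemma join_add: "join u w + join u' w' = join (u + u') (w + w')"
  and join_scaleR: "c *\<^sub>R join u w = join (c *\<^sub>R u) (c *\<^sub>R w)"
  by (simp_all add: vec_Plus_eq_iff)

lemma bounded_linear_upper_part: "bounded_linear upper_part"
  unfolding linear_conv_bounded_linear[symmetric]
  by (rule linearI) (simp_all add: upper_part_def vec_eq_iff)

lemma bounded_linear_lower_part: "bounded_linear lower_part"
  unfolding linear_conv_bounded_linear[symmetric]
  by (rule linearI) (simp_all add: lower_part_def vec_eq_iff)

lemma has_vector_derivative_join:
  assumes "(f has_vector_derivative f') F" "(g has_vector_derivative g') F"
  shows "((\<lambda>t. join (f t) (g t)) has_vector_derivative join f' g') F"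
proof -
  have "bounded_linear (\<lambda>u. join u 0)" "bounded_linear (\<lambda>w. join 0 w)"
    using norm_join_le[of _ 0] norm_join_le[of 0]
    by (auto intro!: bounded_linear_intro[of _ 1] simp: join_add join_scaleR)
  from has_vector_derivative_add[OF bounded_linear.has_vector_derivative[OF this(1) assms(1)]
      bounded_linear.has_vector_derivative[OF this(2) assms(2)]]
  show ?thesis by (simp add: join_add)
qed

lemma norm_skew_le: "norm (skew w) \<le> 3 * norm w"
proof -
  have "norm (skew w *v x) \<le> norm w * norm x" for x
  proof -
    have "norm (w \<times> x)^2 \<le> (norm w * norm x)^2"
      using norm_cross_dot[of w x] zero_le_power2[of "w \<bullet> x"] by linarith
    then show ?thesis
      unfolding skew_mult_vec by (rule power2_le_imp_le) simp
  qed
  from norm_le_of_columns[OF this] show ?thesis by simp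
qed

lemma bounded_linear_skew: "bounded_linear skew"
  unfolding linear_conv_bounded_linear[symmetric]
  by (rule linearI)
    (simp_all add: matrix_eq skew_mult_vec matrix_vector_mult_add_rdistrib cross_add_left cross_mult_left
      flip: scaleR_matrix_vector_assoc)

lemma transpose_skew: "transpose (skew w) = - skew w"
proof -
  have "x \<bullet> (w \<times> y) = - ((w \<times> x) \<bullet> y)" for x y
    by (simp add: cross3_simps)
  then have "(transpose (skew w) *v x) \<bullet> y = (- skew w *v x) \<bullet> y" for x y
    by (simp add: inner_mult_vec[symmetric] mult_vec_minus_left skew_mult_vec)
  then show ?thesis
    by (metis matrix_eq vector_eq_rdot)
qed

text \<open>An isometry has operator norm 1, and three columns give 3. This bounds both attitudes
  without any smallness assumption.\<close>

lemma norm_orthogonal_le: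
  fixes U :: "real^3^3"
  assumes "transpose U ** U = mat 1"
  shows "norm U \<le> 3"
proof -
  have "norm (U *v x) = norm x" for x
  proof -
    have "norm (U *v x)^2 = x \<bullet> ((transpose U ** U) *v x)"
      by (simp only: power2_norm_eq_inner inner_mult_vec[of x] matrix_transpose_mul transpose_transpose
          inner_mult_vec[of "U *v x"] flip: matrix_vector_mul_assoc)
    then show ?thesis using assms by (simp add: dot_square_norm)
  qed
  then show ?thesis using norm_le_of_columns[of U 1] by simp
qed

lemma SO3_orthogonal:
  assumes "U \<in> SO3"
  shows "transpose U ** U = mat 1" "U ** transpose U = mat 1"
  using assms by (simp_all add: SO3_def rotation_matrix_def orthogonal_matrix_def)

lemma A_mat_mult_join: "A_mat S *v join u w = join (S *v w) 0"
  by (simp add: vec_Plus_eq_iff A_mat_def matrix_vector_mult_def sum_UNIV_Plus)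

lemma bounded_linear_A_mat: "bounded_linear A_mat"
  unfolding linear_conv_bounded_linear[symmetric]
  by (rule linearI) (simp_all add: vec_Plus_eq_iff A_mat_def)

lemma norm_A_mat: "norm (A_mat S) = norm S"
proof -
  have "norm (A_mat S)^2 = norm S^2"
    by (simp add: norm_vec_sq sum_UNIV_Plus A_mat_def)
  then show ?thesis by (metis norm_ge_zero power2_eq_imp_eq)
qed

text \<open>\<open>A_mat\<close> takes nilpotent values, so the transition matrices of \<open>A_mat\<close> are \<open>shear N\<close> with \<open>N\<close>
  the integral of the attitude.\<close>

definition shear :: "real^3^3 \<Rightarrow> real^(3+3)^(3+3)" where
  "shear N = mat 1 + A_mat N"

lemma shear_mult_join: "shear N *v join u w = join (u + N *v w) w"
  by (simp add: shear_def matrix_vector_mult_add_rdistrib A_mat_mult_join join_add)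

text \<open>Block identities are checked by their action on \<open>join u w\<close>, which avoids
  entrywise products over the sum type.\<close>

lemma mult_join_eqI:
  fixes X Y :: "real^(3+3)^'k"
  assumes "\<And>u w. X *v join u w = Y *v join u w"
  shows "X = Y"
  by (metis assms join_parts matrix_eq)

lemma shear_mult: "shear N ** shear N' = shear (N + N')"
  by (rule mult_join_eqI)
    (simp add: shear_mult_join matrix_vector_mult_add_rdistrib add_ac flip: matrix_vector_mul_assoc)

lemma shear_0: "shear 0 = mat 1"
  by (rule mult_join_eqI) (simp add: shear_mult_join)

lemma A_mat_shear: "A_mat S ** shear N = A_mat S" "shear N ** A_mat S = A_mat S"
  by (rule mult_join_eqI; simp add: shear_mult_join A_mat_mult_join flip: matrix_vector_mul_assoc)+

lemma has_vector_derivative_shear: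
  assumes "(N has_vector_derivative N') F"
  shows "((\<lambda>t. shear (N t)) has_vector_derivative A_mat N') F"
  using has_vector_derivative_add[OF has_vector_derivative_const[of "mat 1"]
      bounded_linear.has_vector_derivative[OF bounded_linear_A_mat assms]]
  by (simp add: shear_def)

lemma norm_shear_le: "norm (shear N) \<le> 6 + norm N"
proof -
  have "norm (mat 1 :: real^(3+3)^(3+3)) \<le> 6"
    using norm_le_of_columns[of "mat 1 :: real^(3+3)^(3+3)" 1] by simp
  then show ?thesis
    unfolding shear_def using norm_triangle_ineq[of "mat 1" "A_mat N"] by (simp add: norm_A_mat)
qed

section \<open>The output map and its linear structure\<close>

definition C_att :: "('m::finite \<Rightarrow> nat \<times> nat) \<Rightarrow> (nat \<Rightarrow> nat \<Rightarrow> real \<Rightarrow> real^3) \<Rightarrow>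
    (nat \<Rightarrow> real \<Rightarrow> real^3) \<Rightarrow> real^3^3 \<Rightarrow> real \<Rightarrow> real^3^'m" where
  "C_att idx a b S t = (\<chi> k. C_row a b S t (fst (idx k)) (snd (idx k)))"

text \<open>\<open>S\<close> is not restricted to attitudes: the output is linear in
  \<open>S\<close>, so it can be evaluated at differences such as \<open>Rh - R\<close> and at
  quadratic remainders.\<close>

definition y_stack :: "('m::finite \<Rightarrow> nat \<times> nat) \<Rightarrow> (nat \<Rightarrow> nat \<Rightarrow> real \<Rightarrow> real^3) \<Rightarrow>
    (nat \<Rightarrow> real \<Rightarrow> real^3) \<Rightarrow> real^3^3 \<Rightarrow> real \<Rightarrow> real^'m" where
  "y_stack idx a b S t = (\<chi> k. y_out a b S t (fst (idx k)) (snd (idx k)))"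

lemma y_stack_linear: "linear (\<lambda>S. y_stack idx a b S t)"
  by (rule linearI)
    (simp_all add: y_stack_def y_out_def vec_eq_iff transpose_add transpose_scalar
      matrix_vector_mult_add_rdistrib inner_add_right flip: scaleR_matrix_vector_assoc)

lemma y_err_eq: "y_err idx a b Rh R t = y_stack idx a b (Rh - R) t"
  using linear_diff[OF y_stack_linear[of idx a b t], of Rh R]
  by (simp add: y_err_def y_stack_def vec_eq_iff)

text \<open>The output matrix is the derivative of the output along the infinitesimal left rotation
  \<open>skew w ** S\<close>. This ties the innovation to the attitude error and shows that
  \<open>C_att\<close> is linear in \<open>S\<close>.\<close>

lemma C_att_mult: "C_att idx a b S t *v w = y_stack idx a b (skew w ** S) t"
proof -
  have "(C_att idx a b S t *v w) $ k = y_stack idx a b (skew w ** S) t $ k" for k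
  proof -
    let ?a = "a (fst (idx k)) (snd (idx k)) t" and ?b = "b (fst (idx k)) t"
    have "(C_att idx a b S t *v w) $ k = C_row a b S t (fst (idx k)) (snd (idx k)) \<bullet> w"
      by (simp add: C_att_def matrix_vector_mult_def inner_vec_def)
    also have "\<dots> = ?a \<bullet> (transpose S *v (?b \<times> w))"
      by (simp add: C_row_def dot_lmul_matrix skew_mult_vec flip: matrix_vector_mul_assoc)
    also have "?b \<times> w = transpose (skew w) *v ?b"
      using cross_skew[of ?b w] by (simp add: transpose_skew mult_vec_minus_left skew_mult_vec)
    finally show ?thesis
      by (simp add: y_stack_def y_out_def matrix_transpose_mul matrix_vector_mul_assoc)
  qed
  then show ?thesis by (simp add: vec_eq_iff)
qed

lemma C_att_diff: "C_att idx a b (S - S') t = C_att idx a b S t - C_att idx a b S' t"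
  by (simp add: matrix_eq matrix_vector_mult_diff_rdistrib C_att_mult matrix_mult_diff_right
      linear_diff[OF y_stack_linear])

lemma C_mat_mult_join: "C_mat idx a b S t *v join u w = C_att idx a b S t *v u"
  by (simp add: vec_eq_iff C_mat_def C_att_def matrix_vector_mult_def sum_UNIV_Plus)

lemma norm_C_mat: "norm (C_mat idx a b S t) = norm (C_att idx a b S t)"
proof -
  have "norm (C_mat idx a b S t)^2 = norm (C_att idx a b S t)^2"
    by (simp add: norm_vec_sq sum_UNIV_Plus C_mat_def C_att_def)
  then show ?thesis by (metis norm_ge_zero power2_eq_imp_eq)
qed

text \<open>Translates the double sum over channels in the hypotheses into one Gram product of the
  stacked matrix, by reindexing along the bijection \<open>idx\<close>.\<close>

lemma sum_gram:
  fixes idx :: "'m::finite \<Rightarrow> nat \<times> nat"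
  assumes "stacking p n idx"
  shows "(\<Sum>i=1..p. gram (n i) (f i)) =
    transpose (\<chi> k. f (fst (idx k)) (snd (idx k))) ** ((\<chi> k. f (fst (idx k)) (snd (idx k))) :: real^3^'m)"
proof -
  have "(\<Sum>i=1..p. \<Sum>j=1..n i. f i j $ k * f i j $ l) =
      (\<Sum>q\<in>UNIV. f (fst (idx q)) (snd (idx q)) $ k * f (fst (idx q)) (snd (idx q)) $ l)" for k l
  proof -
    have "(\<Sum>i=1..p. \<Sum>j=1..n i. f i j $ k * f i j $ l) =
        (\<Sum>z\<in>(SIGMA i:{1..p}. {1..n i}). f (fst z) (snd z) $ k * f (fst z) (snd z) $ l)"
      by (simp add: sum.Sigma case_prod_unfold)
    also have "\<dots> = (\<Sum>q\<in>UNIV. f (fst (idx q)) (snd (idx q)) $ k * f (fst (idx q)) (snd (idx q)) $ l)"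
      using assms unfolding stacking_def by (rule sum.reindex_bij_betw[symmetric])
    finally show ?thesis .
  qed
  then show ?thesis
    by (simp add: vec_eq_iff gram_def matrix_matrix_mult_def transpose_def)
qed

section \<open>Observability\<close>

lemma bounded_linear_quadratic: "bounded_linear (\<lambda>M. x \<bullet> ((M::real^'n^'n) *v y))"
  by (rule bounded_linear_compose[OF bounded_linear_inner_right
        bounded_bilinear.bounded_linear_left[OF bounded_bilinear_mult_vec]])

lemma inner_integral_mult_vec:
  fixes F :: "real \<Rightarrow> real^'n^'n"
  assumes "continuous_on {t..s} F"
  shows "x \<bullet> (integral {t..s} F *v y) = integral {t..s} (\<lambda>r. x \<bullet> (F r *v y))"
  using integral_linear[OF integrable_continuous_real[OF assms] bounded_linear_quadratic[of x y]]
  by (simp add: o_def)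

lemma sym_mat_integral:
  fixes F :: "real \<Rightarrow> real^'n^'n"
  assumes "continuous_on {t..s} F" "\<And>r. r \<in> {t..s} \<Longrightarrow> sym_mat (F r)"
  shows "sym_mat (integral {t..s} F)"
proof -
  have "transpose (integral {t..s} F) = integral {t..s} (transpose \<circ> F)"
    using integral_linear[OF integrable_continuous_real[OF assms(1)] bounded_linear_transpose] by simp
  also have "\<dots> = integral {t..s} F"
    using assms(2) by (intro integral_cong) (simp add: sym_mat_def)
  finally show ?thesis by (simp add: sym_mat_def)
qed

lemma inner_transpose_mult_vec: "x \<bullet> ((transpose M ** N) *v y) = (M *v x) \<bullet> ((N::real^'n^'m) *v y)"
  by (simp add: inner_mult_vec[of x "transpose M"] flip: matrix_vector_mul_assoc)

locale observer_data =
  fixes p :: nat and n :: "nat \<Rightarrow> nat"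
    and idx :: "'m::finite \<Rightarrow> nat \<times> nat"
    and a :: "nat \<Rightarrow> nat \<Rightarrow> real \<Rightarrow> real^3" and b :: "nat \<Rightarrow> real \<Rightarrow> real^3"
    and R :: "real \<Rightarrow> real^3^3" and \<Omega> :: "real \<Rightarrow> real^3" and d :: "real^3"
    and Q :: "real \<Rightarrow> real^'m^'m" and V :: "real \<Rightarrow> real^(3+3)^(3+3)"
    and P0 :: "real^(3+3)^(3+3)"
    and \<delta> \<mu> :: real
  assumes stack: "stacking p n idx"
    and R_SO3: "\<And>t. 0 \<le> t \<Longrightarrow> R t \<in> SO3"
    and R_deriv: "\<And>t. 0 \<le> t \<Longrightarrow> (R has_vector_derivative (R t ** skew (\<Omega> t))) (at t within {0..})"
    and \<Omega>: "continuous_on {0..} \<Omega>" "bounded (\<Omega> ` {0..})"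
    and a: "\<And>i j. i \<in> {1..p} \<Longrightarrow> j \<in> {1..n i} \<Longrightarrow>
           continuous_on {0..} (a i j) \<and> bounded (a i j ` {0..})"
    and b: "\<And>i. i \<in> {1..p} \<Longrightarrow> continuous_on {0..} (b i) \<and> bounded (b i ` {0..})"
    and Q: "admissible_weight Q" and V: "admissible_weight V"
    and P0: "pos_def P0"
    and \<delta>: "0 < \<delta>" and \<mu>: "0 < \<mu>"
    and W_lam_ge: "\<And>t. 0 \<le> t \<Longrightarrow> W_lam p n a b R t \<delta> \<succeq> \<mu> *\<^sub>R mat 1"
    and W_bar_ge: "\<And>t. 0 \<le> t \<Longrightarrow> W_bar p n a b R t \<delta> \<succeq> \<mu> *\<^sub>R mat 1"
begin

abbreviation "C1 \<equiv> C_att idx a b"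

lemma channel_in: "fst (idx k) \<in> {1..p}" "snd (idx k) \<in> {1..n (fst (idx k))}"
proof -
  have "idx k \<in> (SIGMA i:{1..p}. {1..n i})"
    using stack by (auto simp: stacking_def bij_betw_def)
  then show "fst (idx k) \<in> {1..p}" "snd (idx k) \<in> {1..n (fst (idx k))}"
    by (auto simp: mem_Sigma_iff split: prod.splits)
qed

lemma y_stack_bound: obtains ky where "0 \<le> ky"
  "\<And>S t. 0 \<le> t \<Longrightarrow> norm (y_stack idx a b S t) \<le> ky * norm S"
proof -
  have "\<exists>c\<ge>0. \<forall>t\<ge>0. \<forall>S. \<bar>y_stack idx a b S t $ k\<bar> \<le> c * norm S" for k
  proof -
    obtain ka where ka: "\<And>t. 0 \<le> t \<Longrightarrow> norm (a (fst (idx k)) (snd (idx k)) t) \<le> ka"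
      using a[OF channel_in(1)[of k] channel_in(2)[of k]] by (auto simp: bounded_iff)
    obtain kb where kb: "\<And>t. 0 \<le> t \<Longrightarrow> norm (b (fst (idx k)) t) \<le> kb"
      using b[OF channel_in(1)[of k]] by (auto simp: bounded_iff)
    have nn: "0 \<le> ka" "0 \<le> kb"
      using order_trans[OF norm_ge_zero ka[of 0]] order_trans[OF norm_ge_zero kb[of 0]] by auto
    have "\<bar>y_stack idx a b S t $ k\<bar> \<le> (ka * kb) * norm S" if "0 \<le> t" for S t
    proof -
      have "\<bar>y_stack idx a b S t $ k\<bar> \<le> norm (a (fst (idx k)) (snd (idx k)) t) * norm (transpose S)
          * norm (b (fst (idx k)) t)"
        unfolding y_stack_def y_out_def by (simp add: abs_inner_mult_vec_le del: norm_transpose)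
      also have "\<dots> \<le> ka * norm S * kb"
        using ka[OF that] kb[OF that] nn by (intro mult_mono) auto
      finally show ?thesis by (simp add: mult_ac)
    qed
    then show ?thesis using nn by (intro exI[of _ "ka * kb"]) auto
  qed
  then obtain c where c: "\<And>k. 0 \<le> c k" "\<And>k t S. 0 \<le> t \<Longrightarrow> \<bar>y_stack idx a b S t $ k\<bar> \<le> c k * norm S"
    by metis
  show thesis
  proof
    show "0 \<le> (\<Sum>k\<in>UNIV. c k)" by (intro sum_nonneg c)
    fix S and t :: real assume "0 \<le> t"
    have "norm (y_stack idx a b S t) \<le> (\<Sum>k\<in>UNIV. \<bar>y_stack idx a b S t $ k\<bar>)"
      by (rule norm_le_l1_cart)
    also have "\<dots> \<le> (\<Sum>k\<in>UNIV. c k * norm S)"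
      by (intro sum_mono c \<open>0 \<le> t\<close>)
    finally show "norm (y_stack idx a b S t) \<le> (\<Sum>k\<in>UNIV. c k) * norm S"
      by (simp add: sum_distrib_right)
  qed
qed

lemma C1_bound: obtains kc where "0 \<le> kc" "\<And>S t. 0 \<le> t \<Longrightarrow> norm (C1 S t) \<le> kc * norm S"
proof -
  obtain ky where ky: "0 \<le> ky" "\<And>S t. 0 \<le> t \<Longrightarrow> norm (y_stack idx a b S t) \<le> ky * norm S"
    using y_stack_bound by blast
  show thesis
  \<comment> \<open>One factor 3 comes from \<open>norm_skew_le\<close>, the other from passing to
    columns.\<close>
  proof (rule that[of "9 * ky"])
    fix S and t :: real assume t: "0 \<le> t"
    have "norm (C1 S t *v w) \<le> (3 * ky * norm S) * norm w" for w
    proof -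
      have "norm (C1 S t *v w) \<le> ky * norm (skew w ** S)"
        unfolding C_att_mult by (rule ky(2)[OF t])
      also have "\<dots> \<le> ky * (3 * norm w * norm S)"
        using ky(1) norm_skew_le[of w]
        by (intro mult_left_mono order_trans[OF norm_matrix_mult_le] mult_right_mono) auto
      finally show ?thesis by (simp add: mult_ac)
    qed
    from norm_le_of_columns[OF this] show "norm (C1 S t) \<le> 9 * ky * norm S" by simp
  qed (use ky in simp)
qed

lemma y_stack_continuous:
  assumes "continuous_on X S" "X \<subseteq> {0..}"
  shows "continuous_on X (\<lambda>t. y_stack idx a b (S t) t)"
  unfolding y_stack_def y_out_def
  using assms a[OF channel_in] b[OF channel_in(1)]
  by (intro continuous_on_vec_lambda continuous_on_inner continuous_on_mult_vec continuous_on_transpose)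
    (blast intro: continuous_on_subset)+

lemma C1_continuous:
  assumes "continuous_on X S" "X \<subseteq> {0..}"
  shows "continuous_on X (\<lambda>t. C1 (S t) t)"
proof -
  \<comment> \<open>Each column is an output evaluated at a matrix depending continuously on time,
    which reduces the claim to \<open>y_stack_continuous\<close>.\<close>
  have "C1 (S t) t = (\<chi> i j. y_stack idx a b (skew (axis j 1) ** S t) t $ i)" for t
    by (simp add: vec_eq_iff matrix_vector_mult_basis column_def flip: C_att_mult)
  then show ?thesis
    using assms
    by (simp only:) (intro continuous_on_vec_lambda continuous_on_component y_stack_continuous
        continuous_on_matrix_mult continuous_on_const; simp)
qed

lemma C_mat_continuous:
  assumes "continuous_on X S" "X \<subseteq> {0..}"
  shows "continuous_on X (\<lambda>t. C_mat idx a b (S t) t)"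
proof -
  have "C_mat idx a b (S t) t = (\<chi> k c. case c of Inl l \<Rightarrow> C1 (S t) t $ k $ l | Inr l \<Rightarrow> 0)" for t
    by (simp add: vec_eq_iff C_mat_def C_att_def split: sum.split)
  moreover have "continuous_on X (\<lambda>t. case c of Inl l \<Rightarrow> C1 (S t) t $ k $ l | Inr l \<Rightarrow> 0)"
    for c :: "3+3" and k
    by (cases c) (auto intro!: continuous_on_component C1_continuous assms)
  ultimately show ?thesis
    by (simp only:) (intro continuous_on_vec_lambda; simp)
qed

lemma R_continuous: "continuous_on {0..} R"
  by (rule has_vector_derivative_continuous_on[OF R_deriv]) simp

lemma R_norm: "0 \<le> t \<Longrightarrow> norm (R t) \<le> 3"
  by (intro norm_orthogonal_le SO3_orthogonal R_SO3)

lemma integral_attitude: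
  assumes "\<And>s. s \<in> {t..t'} \<Longrightarrow> norm (S s) \<le> k" "continuous_on {t..t'} S" "s \<in> {t..t'}"
  shows "norm (integral {t..s} (S :: real \<Rightarrow> real^3^3)) \<le> k * (t' - t)"
proof -
  have "norm (integral {t..s} S) \<le> k * (s - t)"
    using assms by (intro integral_bound continuous_on_subset[OF assms(2)]) auto
  also have "\<dots> \<le> k * (t' - t)"
    using assms(3) order_trans[OF norm_ge_zero assms(1)[OF assms(3)]] by (intro mult_left_mono) auto
  finally show ?thesis .
qed

text \<open>The matrix \<open>rho\<close> is chosen so that the cross term between the constant vector \<open>u + rho w\<close> and
  the remainder vanishes; hence the Gramian of the pair splits into \<open>W_lam\<close> and \<open>W_bar\<close>.\<close>

lemma gram_lower:
  obtains \<mu>' where "0 < \<mu>'" "\<And>t u w. 0 \<le> t \<Longrightarrow> \<mu>' * (norm u^2 + norm w^2) \<le>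
    (1 / \<delta>) * integral {t..t+\<delta>} (\<lambda>s. norm (C1 (R s) s *v (u + integral {t..s} R *v w))^2)"
proof -
  obtain kc where kc: "0 \<le> kc" "\<And>S t. 0 \<le> t \<Longrightarrow> norm (C1 S t) \<le> kc * norm S"
    using C1_bound by blast
  \<comment> \<open>Bounds \<open>rho\<close> uniformly in \<open>t\<close>:
    \<open>3 / \<mu>\<close> bounds the inverse of \<open>W_lam\<close>, and the second factor
    bounds the average of \<open>M s ** N s\<close>.\<close>
  define k\<rho> where "k\<rho> = (3 / \<mu>) * ((kc * 3)^2 * (3 * \<delta>))"
  have "0 \<le> k\<rho>" using kc \<mu> \<delta> by (simp add: k\<rho>_def)
  show thesis
  proof (rule that[of "\<mu> / (2 * k\<rho>^2 + 2)"])
    show "0 < \<mu> / (2 * k\<rho>^2 + 2)" using \<mu> by (simp add: add_nonneg_pos)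
    fix t :: real and u w :: "real^3"
    assume t: "0 \<le> t"
    define I where "I = {t..t+\<delta>}"
    have sub: "I \<subseteq> {0..}" using t by (auto simp: I_def)
    define C where "C = (\<lambda>s. C1 (R s) s)"
    define N where "N = (\<lambda>s. integral {t..s} R)"
    define M where "M = (\<lambda>s. transpose (C s) ** C s)"
    define W where "W = W_lam p n a b R t \<delta>"
    define \<rho> where "\<rho> = rho p n a b R t \<delta>"
    have cR: "continuous_on I R" by (rule continuous_on_subset[OF R_continuous sub])
    have cC: "continuous_on I C"
      unfolding C_def by (rule C1_continuous[OF cR sub])
    have cN: "continuous_on I N"
      unfolding N_def I_def
      by (intro indefinite_integral_continuous_1 integrable_continuous_real) (use cR in \<open>simp add: I_def\<close>)
    have cM: "continuous_on I M"
      unfolding M_def by (intro continuous_on_matrix_mult continuous_on_transpose cC)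
    have cMN: "continuous_on I (\<lambda>s. M s ** N s)"
      by (intro continuous_on_matrix_mult cM cN)
    have gram_C: "(\<Sum>i=1..p. gram (n i) (C_row a b (R s) s i)) = M s" for s
      by (simp only: sum_gram[OF stack] M_def C_def C_att_def)
    have W: "W = (1 / \<delta>) *\<^sub>R integral I M"
      by (simp only: W_def W_lam_def gram_C I_def)
    have Wge: "\<mu> * norm x^2 \<le> x \<bullet> (W *v x)" for x
      unfolding W_def by (rule loewner_ge_scaled_mat(2)[OF W_lam_ge[OF t]])
    have \<rho>: "\<rho> = matrix_inv W ** ((1 / \<delta>) *\<^sub>R integral I (\<lambda>s. M s ** N s))"
      unfolding \<rho>_def rho_def W_def gram_C I_def N_def by (simp only: scalar_matrix_assoc matrix_scalar_ac)
    \<comment> \<open>The defining equation of \<open>rho\<close> in the form that is used: it says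
      that the integral of \<open>M s ** (N s - \<rho>)\<close> is 0.\<close>
    have W\<rho>: "W ** \<rho> = (1 / \<delta>) *\<^sub>R integral I (\<lambda>s. M s ** N s)"
      unfolding \<rho> using coercive_inv(1)[OF \<mu> Wge] by (simp add: matrix_mul_assoc)
    have bC: "norm (C s) \<le> kc * 3" if "s \<in> I" for s
    proof -
      have "norm (C s) \<le> kc * norm (R s)" unfolding C_def using that sub by (intro kc) auto
      also have "\<dots> \<le> kc * 3" using that sub kc by (intro mult_left_mono R_norm) auto
      finally show ?thesis .
    qed
    have bN: "norm (N s) \<le> 3 * \<delta>" if "s \<in> I" for s
      unfolding N_def using integral_attitude[of t "t+\<delta>" R 3 s] cR that sub R_norm
      by (auto simp: I_def)
    have bMN: "norm (M s ** N s) \<le> (kc * 3)^2 * (3 * \<delta>)" if "s \<in> I" for s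
      unfolding M_def power2_eq_square using bC[OF that] bN[OF that] kc \<delta>
      by (intro order_trans[OF norm_matrix_mult_le] mult_mono
          order_trans[OF norm_matrix_mult_le[of "transpose (C s)" "C s"]]) auto
    have "norm (integral I (\<lambda>s. M s ** N s)) \<le> (kc * 3)^2 * (3 * \<delta>) * (t + \<delta> - t)"
      unfolding I_def
      by (rule integral_bound) (use bMN cMN \<delta> in \<open>auto simp: I_def\<close>)
    then have "norm ((1 / \<delta>) *\<^sub>R integral I (\<lambda>s. M s ** N s)) \<le> (kc * 3)^2 * (3 * \<delta>)"
      using \<delta> by (simp add: field_simps)
    moreover have "norm (matrix_inv W) \<le> 3 / \<mu>"
      using coercive_inv_norm[OF \<mu> Wge] by simp
    ultimately have n\<rho>: "norm \<rho> \<le> k\<rho>"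
      unfolding \<rho> k\<rho>_def using \<mu>
      by (intro order_trans[OF norm_matrix_mult_le] mult_mono) auto
    define v where "v = u + \<rho> *v w"
    define D where "D = (\<lambda>s. N s - \<rho>)"
    have cD: "continuous_on I D"
      unfolding D_def by (intro continuous_intros cN)
    have "(\<Sum>i=1..p. gram (n i) (Cbar_row p n a b R s t \<delta> i)) = transpose (C s ** D s) ** (C s ** D s)" for s
    proof -
      have "(\<chi> k. Cbar_row p n a b R s t \<delta> (fst (idx k)) (snd (idx k))) = C s ** D s"
        by (simp add: vec_eq_iff Cbar_row_def C_def C_att_def D_def N_def \<rho>_def matrix_matrix_mult_def
            vector_matrix_mult_def mult.commute)
      then show ?thesis by (simp only: sum_gram[OF stack])
    qed
    then have Wbar: "W_bar p n a b R t \<delta> = (1 / \<delta>) *\<^sub>R integral I (\<lambda>s. transpose (C s ** D s) ** (C s ** D s))"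
      by (simp only: W_bar_def I_def)
    have cI: "continuous_on {t..t+\<delta>} f = continuous_on I f" for f :: "real \<Rightarrow> 'z::topological_space"
      by (simp add: I_def)
    have int: "continuous_on I f \<Longrightarrow> f integrable_on I" for f :: "real \<Rightarrow> real"
      unfolding I_def by (rule integrable_continuous_real)
    define f1 where "f1 = (\<lambda>s. norm (C s *v v)^2)"
    define f2 where "f2 = (\<lambda>s. v \<bullet> ((M s ** D s) *v w))"
    define f3 where "f3 = (\<lambda>s. norm (C s *v (D s *v w))^2)"
    have i1: "f1 integrable_on I" and i2: "f2 integrable_on I" and i3: "f3 integrable_on I"
      unfolding f1_def f2_def f3_def
      by (intro int continuous_intros continuous_on_mult_vec continuous_on_matrix_mult cC cD cM)+
    have "norm (C s *v (u + N s *v w))^2 = f1 s + 2 * f2 s + f3 s" for s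
    proof -
      have "u + N s *v w = v + D s *v w"
        by (simp add: v_def D_def matrix_vector_mult_diff_rdistrib)
      moreover have "(C s *v v) \<bullet> (C s *v (D s *v w)) = f2 s"
        by (simp add: f2_def M_def inner_transpose_mult_vec flip: matrix_vector_mul_assoc)
           (simp add: inner_transpose_mult_vec matrix_vector_mul_assoc)
      ultimately show ?thesis
        by (simp add: f1_def f3_def matrix_vector_right_distrib power2_norm_eq_inner
            inner_add_left inner_add_right inner_commute)
    qed
    then have split: "integral I (\<lambda>s. norm (C s *v (u + N s *v w))^2) = integral I f1 + 2 * integral I f2 + integral I f3"
      using i1 i2 i3 by (simp add: integral_add integrable_add integral_mult_right)
    have e1: "(1 / \<delta>) * integral I f1 = v \<bullet> (W *v v)"
    proof -
      have "v \<bullet> (integral I M *v v) = integral I f1"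
        unfolding I_def
        by (subst inner_integral_mult_vec)
          (use cM in \<open>simp_all add: cI f1_def M_def inner_transpose_mult_vec power2_norm_eq_inner\<close>)
      then show ?thesis by (simp add: W flip: scaleR_matrix_vector_assoc)
    qed
    have "v \<bullet> (integral I (\<lambda>s. M s ** D s) *v w) = integral I f2"
      unfolding I_def
      by (subst inner_integral_mult_vec)
        (use cM cD in \<open>simp_all add: cI f2_def continuous_on_matrix_mult\<close>)
    moreover have "integral I (\<lambda>s. M s ** D s) = 0"
    proof -
      have im: "M integrable_on I" "(\<lambda>s. M s ** N s) integrable_on I"
        using cM cMN by (auto simp: I_def intro: integrable_continuous_real)
      have bl: "bounded_linear (\<lambda>X::real^3^3. X ** \<rho>)"
        by (rule bounded_bilinear.bounded_linear_left[OF bounded_bilinear_matrix_mult])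
      have "integral I (\<lambda>s. M s ** D s) = integral I (\<lambda>s. M s ** N s) - integral I (\<lambda>s. M s ** \<rho>)"
        unfolding D_def matrix_mult_diff_right
        using integrable_linear[OF im(1) bl] im(2) by (intro integral_diff) (auto simp: o_def)
      also have "integral I (\<lambda>s. M s ** \<rho>) = integral I M ** \<rho>"
        using integral_linear[OF im(1) bl] by (simp add: o_def)
      also have "integral I (\<lambda>s. M s ** N s) = \<delta> *\<^sub>R (W ** \<rho>)"
        using \<delta> by (simp add: W\<rho>)
      also have "\<dots> = integral I M ** \<rho>"
        using \<delta> by (simp add: W flip: scalar_matrix_assoc)
      finally show ?thesis by simp
    qed
    ultimately have e2: "integral I f2 = 0" by simp
    have e3: "(1 / \<delta>) * integral I f3 = w \<bullet> (W_bar p n a b R t \<delta> *v w)"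
    proof -
      have "w \<bullet> (integral I (\<lambda>s. transpose (C s ** D s) ** (C s ** D s)) *v w) = integral I f3"
        unfolding I_def
        by (subst inner_integral_mult_vec)
          (use cC cD in \<open>simp_all add: cI f3_def inner_transpose_mult_vec power2_norm_eq_inner
              continuous_on_matrix_mult continuous_on_transpose matrix_vector_mul_assoc\<close>)
      then show ?thesis by (simp add: Wbar flip: scaleR_matrix_vector_assoc)
    qed
    have "\<mu> * norm v^2 \<le> (1 / \<delta>) * integral I f1"
      unfolding e1 by (rule Wge)
    moreover have "\<mu> * norm w^2 \<le> (1 / \<delta>) * integral I f3"
      unfolding e3 by (rule loewner_ge_scaled_mat(2)[OF W_bar_ge[OF t]])
    ultimately have main: "\<mu> * (norm v^2 + norm w^2) \<le> (1 / \<delta>) * integral I (\<lambda>s. norm (C s *v (u + N s *v w))^2)"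
      by (simp add: split e2 distrib_left)
    \<comment> \<open>The two hypotheses control \<open>v = u + \<rho> *v w\<close> and
      \<open>w\<close>; returning to \<open>u\<close> costs the factor
      \<open>2 * k\<rho>^2 + 2\<close>.\<close>
    have "norm u^2 \<le> 2 * norm v^2 + 2 * k\<rho>^2 * norm w^2"
    proof -
      have "norm (\<rho> *v w) \<le> k\<rho> * norm w"
        using n\<rho> by (intro order_trans[OF norm_mult_vec_le] mult_right_mono) auto
      moreover have "norm u \<le> norm v + norm (\<rho> *v w)"
        using norm_triangle_ineq4[of v "\<rho> *v w"] by (simp add: v_def)
      ultimately have "norm u^2 \<le> (norm v + k\<rho> * norm w)^2"
        by (intro power_mono) auto
      also have "\<dots> \<le> 2 * norm v^2 + 2 * (k\<rho> * norm w)^2"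
        using zero_le_power2[of "norm v - k\<rho> * norm w"] by (simp add: power2_sum power2_diff)
      finally show ?thesis by (simp add: power_mult_distrib)
    qed
    moreover have "(2 * k\<rho>^2 + 2) * (norm v^2 + norm w^2) =
        (2 * norm v^2 + 2 * k\<rho>^2 * norm w^2) + norm w^2 + (2 * k\<rho>^2 * norm v^2 + norm w^2)"
      by (simp add: algebra_simps)
    moreover have "0 \<le> 2 * k\<rho>^2 * norm v^2 + norm w^2" by simp
    ultimately have "norm u^2 + norm w^2 \<le> (2 * k\<rho>^2 + 2) * (norm v^2 + norm w^2)"
      by linarith
    then have "\<mu> / (2 * k\<rho>^2 + 2) * (norm u^2 + norm w^2) \<le> \<mu> / (2 * k\<rho>^2 + 2) * ((2 * k\<rho>^2 + 2) * (norm v^2 + norm w^2))"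
      using \<mu> by (intro mult_left_mono) auto
    also have "\<dots> = \<mu> * (norm v^2 + norm w^2)"
      using add_nonneg_pos[of "2 * k\<rho>^2" 2] by simp
    finally show "\<mu> / (2 * k\<rho>^2 + 2) * (norm u^2 + norm w^2) \<le>
      (1 / \<delta>) * integral {t..t+\<delta>} (\<lambda>s. norm (C1 (R s) s *v (u + integral {t..s} R *v w))^2)"
      using main by (simp add: I_def C_def N_def)
  qed
qed

lemma observable: "uniformly_observable (\<lambda>t. A_mat (R t)) (\<lambda>t. C_mat idx a b (R t) t)"
proof -
  obtain \<mu>' where \<mu>': "0 < \<mu>'" "\<And>t u w. 0 \<le> t \<Longrightarrow> \<mu>' * (norm u^2 + norm w^2) \<le>
    (1 / \<delta>) * integral {t..t+\<delta>} (\<lambda>s. norm (C1 (R s) s *v (u + integral {t..s} R *v w))^2)"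
    using gram_lower by blast
  \<comment> \<open>\<open>transition_matrix\<close> also asks for times \<open>s < t\<close>, where
    \<open>integral {t..s} R\<close> would be 0 by convention; a difference of integrals from 0 is
    correct on both sides of \<open>t\<close>.\<close>
  define J where "J = (\<lambda>s. integral {0..s} R)"
  define \<Phi> where "\<Phi> = (\<lambda>s t. shear (J s - J t))"
  have J': "(J has_vector_derivative R s) (at s within {0..})" if "0 \<le> s" for s
    unfolding J_def using integral_has_vector_derivative_halfline[OF R_continuous that] .
  have J_diff: "J s - J t = integral {t..s} R" if "0 \<le> t" "t \<le> s" for s t
  proof -
    have "integral {0..t} R + integral {t..s} R = integral {0..s} R"
      using that by (intro Henstock_Kurzweil_Integration.integral_combine integrable_continuous_real
          continuous_on_subset[OF R_continuous]) auto
    then show ?thesis by (simp add: J_def algebra_simps)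
  qed
  have cJ: "continuous_on {0..} J"
    by (rule has_vector_derivative_continuous_on[OF J']) simp
  have "transition_matrix (\<lambda>t. A_mat (R t)) \<Phi>"
    unfolding transition_matrix_def
  proof (intro allI impI conjI)
    fix t s :: real assume "0 \<le> t"
    show "\<Phi> t t = mat 1" by (simp add: \<Phi>_def shear_0)
    assume "0 \<le> s"
    show "((\<lambda>s. \<Phi> s t) has_vector_derivative A_mat (R s) ** \<Phi> s t) (at s within {0..})"
      unfolding \<Phi>_def A_mat_shear
      by (rule has_vector_derivative_shear)
        (use has_vector_derivative_diff[OF J'[OF \<open>0 \<le> s\<close>] has_vector_derivative_const[of "J t"]] in simp)
  qed
  moreover have "(1 / \<delta>) *\<^sub>R integral {t..t+\<delta>} (\<lambda>s. transpose (\<Phi> s t) **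
      transpose (C_mat idx a b (R s) s) ** C_mat idx a b (R s) s ** \<Phi> s t) \<succeq> \<mu>' *\<^sub>R mat 1"
    if t: "0 \<le> t" for t
  proof -
    define F where "F = (\<lambda>s. transpose (\<Phi> s t) **
      transpose (C_mat idx a b (R s) s) ** C_mat idx a b (R s) s ** \<Phi> s t)"
    have F: "F s = transpose (C_mat idx a b (R s) s ** \<Phi> s t) ** (C_mat idx a b (R s) s ** \<Phi> s t)" for s
      by (simp add: F_def matrix_transpose_mul matrix_mul_assoc)
    have CP: "(C_mat idx a b (R s) s ** \<Phi> s t) *v join u w = C1 (R s) s *v (u + (J s - J t) *v w)" for s u w
      by (simp add: \<Phi>_def shear_mult_join C_mat_mult_join flip: matrix_vector_mul_assoc)
    have sub: "{t..t+\<delta>} \<subseteq> {0..}" using t by auto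
    have "continuous_on {t..t+\<delta>} (\<lambda>s. C_mat idx a b (R s) s)"
      by (rule C_mat_continuous[OF continuous_on_subset[OF R_continuous sub] sub])
    moreover have "continuous_on {t..t+\<delta>} (\<lambda>s. \<Phi> s t)"
      unfolding \<Phi>_def shear_def
      by (intro continuous_intros bounded_linear.continuous_on[OF bounded_linear_A_mat]
          continuous_on_subset[OF cJ sub])
    ultimately have cF: "continuous_on {t..t+\<delta>} F"
      unfolding F by (intro continuous_on_matrix_mult continuous_on_transpose)
    have "sym_mat (integral {t..t+\<delta>} F)"
      by (rule sym_mat_integral[OF cF]) (simp add: F sym_mat_def matrix_transpose_mul)
    then have 1: "sym_mat ((1 / \<delta>) *\<^sub>R integral {t..t+\<delta>} F)"
      by (simp add: sym_mat_def transpose_scalar)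
    have 2: "\<mu>' * norm x^2 \<le> x \<bullet> (((1 / \<delta>) *\<^sub>R integral {t..t+\<delta>} F) *v x)" for x
    proof -
      define u w where "u = upper_part x" and "w = lower_part x"
      have x: "x = join u w" by (simp add: u_def w_def join_parts)
      have "x \<bullet> (integral {t..t+\<delta>} F *v x) = integral {t..t+\<delta>} (\<lambda>s. norm (C1 (R s) s *v (u + (J s - J t) *v w))^2)"
        unfolding inner_integral_mult_vec[OF cF]
        by (simp add: F inner_transpose_mult_vec x CP dot_square_norm)
      also have "\<dots> = integral {t..t+\<delta>} (\<lambda>s. norm (C1 (R s) s *v (u + integral {t..s} R *v w))^2)"
        using t by (intro integral_cong) (simp add: J_diff)
      finally show ?thesis
        using \<mu>'(2)[OF t, of u w] by (simp add: norm_join x flip: scaleR_matrix_vector_assoc)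
    qed
    show ?thesis
      unfolding F_def[symmetric] by (rule loewner_geI[OF 1 2])
  qed
  ultimately show ?thesis
    unfolding uniformly_observable_def using \<delta> \<mu>'(1) by blast
qed

end

section \<open>The attitude error\<close>

text \<open>The axial vector of the skew part of \<open>M\<close>: linear on all matrices and a left
  inverse of \<open>skew\<close>.\<close>

definition vex :: "real^3^3 \<Rightarrow> real^3" where
  "vex M = (1/2) *\<^sub>R vector [M$3$2 - M$2$3, M$1$3 - M$3$1, M$2$1 - M$1$2]"

lemma skew_nth: "skew w $ i $ j = (w \<times> axis j 1) $ i"
  by (simp add: skew_def matrix_def)

lemma skew_vex: "skew (vex M) = (1/2) *\<^sub>R (M - transpose M)"
  by (simp add: vec_eq_iff forall_3 skew_nth vex_def cross3_def vector_3 axis_def transpose_def field_simps)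

lemma vex_skew: "vex (skew w) = w"
  by (simp add: vec_eq_iff forall_3 skew_nth vex_def cross3_def vector_3 axis_def)

lemma bounded_linear_vex: "bounded_linear vex"
  unfolding linear_conv_bounded_linear[symmetric]
  by (rule linearI) (simp_all add: vec_eq_iff forall_3 vex_def vector_3 algebra_simps)

lemma norm_vex_le: "norm (vex M) \<le> 3 * norm M"
proof -
  have e: "\<bar>M$i$j\<bar> \<le> norm M" for i j
    using component_le_norm_cart[of "M$i" j] Finite_Cartesian_Product.norm_nth_le[of M i] by linarith
  have "norm (vex M) \<le> (\<Sum>i\<in>UNIV. \<bar>vex M $ i\<bar>)" by (rule norm_le_l1_cart)
  also have "\<dots> \<le> 3 * norm M"
    using norm_ge_zero[of M] e[of 3 2] e[of 2 3] e[of 1 3] e[of 3 1] e[of 2 1] e[of 1 2]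
      abs_triangle_ineq4[of "M$3$2" "M$2$3"] abs_triangle_ineq4[of "M$1$3" "M$3$1"]
      abs_triangle_ineq4[of "M$2$1" "M$1$2"]
    unfolding sum_3 vex_def by (simp add: vector_3 del: abs_triangle_ineq4)
  finally show ?thesis .
qed

text \<open>Needs determinant 1, since a reflection reverses cross products. It is applied to the
  true attitude \<open>R\<close> only; along the estimate, orthogonality alone has to be
  propagated.\<close>

lemma rotation_skew:
  assumes "U \<in> SO3"
  shows "U ** skew w ** transpose U = skew (U *v w)"
proof -
  have rot: "rotation_matrix U" using assms by (simp add: SO3_def)
  have "U *v (w \<times> (transpose U *v y)) = (U *v w) \<times> y" for y
  proof -
    have "U *v (w \<times> (transpose U *v y)) = (U *v w) \<times> (U *v (transpose U *v y))"
      using cross_rotation_matrix[OF rot] by simp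
    also have "U *v (transpose U *v y) = y"
      using SO3_orthogonal(2)[OF assms] by (simp add: matrix_vector_mul_assoc)
    finally show ?thesis .
  qed
  then show ?thesis
    by (simp add: matrix_eq skew_mult_vec flip: matrix_vector_mul_assoc)
qed

text \<open>For the Frobenius inner product, multiplication by a skew matrix from either side is
  antisymmetric, hence neutral for the norm.\<close>

lemma inner_skew_mult: "D \<bullet> (skew w ** D) = 0" "D \<bullet> (D ** skew w) = 0"
proof -
  have "(skew w ** D) \<bullet> D = D \<bullet> (- skew w ** D)"
    by (simp add: inner_matrix_mult_left transpose_skew)
  moreover have "- skew w ** D = - (skew w ** D)"
    using matrix_mult_diff_left[of 0 "skew w" D] by simp
  ultimately show "D \<bullet> (skew w ** D) = 0" by (simp add: inner_commute)
  have "(D ** skew w) \<bullet> D = D \<bullet> (D ** - skew w)"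
    by (simp add: inner_matrix_mult_right transpose_skew)
  moreover have "D ** - skew w = - (D ** skew w)"
    using matrix_mult_diff_right[of D 0 "skew w"] by simp
  ultimately show "D \<bullet> (D ** skew w) = 0" by (simp add: inner_commute)
qed

lemma matrix_mult_minus: "(- A) ** B = - (A ** B)" "A ** (- B) = - (A ** (B::real^'k^'n))"
  using matrix_mult_diff_left[of 0 A B] matrix_mult_diff_right[of A 0 B] by simp_all

text \<open>The defect \<open>D\<close> evolves by its commutator with \<open>skew (w2 s)\<close>,
  the terms with \<open>w1\<close> cancelling. A commutator with a skew matrix preserves the norm,
  so \<open>gronwall_zero\<close> applies with \<open>K = 0\<close>.\<close>

lemma orthogonal_flow:
  fixes U :: "real \<Rightarrow> real^3^3"
  assumes U': "\<And>t. t \<in> {0..T} \<Longrightarrow>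
      (U has_vector_derivative (U t ** skew (w1 t) + skew (w2 t) ** U t)) (at t within {0..T})"
    and U0: "U 0 ** transpose (U 0) = mat 1" and t: "t \<in> {0..T}"
  shows "U t ** transpose (U t) = mat 1"
proof -
  define D where "D = (\<lambda>s. U s ** transpose (U s) - mat 1)"
  define D' where "D' = (\<lambda>s. skew (w2 s) ** D s - D s ** skew (w2 s))"
  have "D t = 0"
  proof (rule gronwall_zero)
    fix s assume s: "s \<in> {0..T}"
    let ?U' = "U s ** skew (w1 s) + skew (w2 s) ** U s"
    have "(D has_vector_derivative (U s ** transpose ?U' + ?U' ** transpose (U s))) (at s within {0..T})"
      unfolding D_def
      using has_vector_derivative_diff[OF has_vector_derivative_matrix_mult[OF U'[OF s]
          has_vector_derivative_transpose[OF U'[OF s]]] has_vector_derivative_const[of "mat 1"]] by simp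
    moreover have "U s ** transpose ?U' + ?U' ** transpose (U s) = D' s"
      by (simp add: D'_def D_def transpose_add matrix_transpose_mul transpose_skew matrix_mult_minus
          matrix_add_ldistrib matrix_mult_add_left matrix_mult_diff_right matrix_mult_diff_left matrix_mul_assoc)
    ultimately show "(D has_vector_derivative D' s) (at s within {0..T})" by simp
    show "D s \<bullet> D' s \<le> 0 * norm (D s)^2"
      by (simp add: D'_def inner_diff_right inner_skew_mult)
  qed (use t U0 in \<open>auto simp: D_def\<close>)
  then show ?thesis by (simp add: D_def)
qed

text \<open>None of these constants refers to a trajectory. The condition on \<open>pm\<close> is
  the smallness condition of the Riccati lower bound for |A| \<le> 3 and |C| \<le> 3 kc;
  \<open>eps\<close> is the distance between estimate and attitude up to which the Gramian
  survives.\<close>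

locale observer_consts = observer_data +
  fixes kc ky kq kv q v \<mu>' p0 pm eps :: real
  assumes kc: "0 \<le> kc" "\<And>S t. 0 \<le> t \<Longrightarrow> norm (C1 S t) \<le> kc * norm S"
    and ky: "0 \<le> ky" "\<And>S t. 0 \<le> t \<Longrightarrow> norm (y_stack idx a b S t) \<le> ky * norm S"
    and Qb: "0 < q" "\<And>t. 0 \<le> t \<Longrightarrow> sym_mat (Q t)" "\<And>t. 0 \<le> t \<Longrightarrow> norm (Q t) \<le> kq"
      "\<And>t y. 0 \<le> t \<Longrightarrow> q * norm y^2 \<le> y \<bullet> (Q t *v y)"
    and Vb: "0 < v" "\<And>t. 0 \<le> t \<Longrightarrow> sym_mat (V t)" "\<And>t. 0 \<le> t \<Longrightarrow> norm (V t) \<le> kv"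
      "\<And>t y. 0 \<le> t \<Longrightarrow> v * norm y^2 \<le> y \<bullet> (V t *v y)"
    and \<mu>': "0 < \<mu>'" "\<And>t u w. 0 \<le> t \<Longrightarrow> \<mu>' * (norm u^2 + norm w^2) \<le>
      (1 / \<delta>) * integral {t..t+\<delta>} (\<lambda>s. norm (C1 (R s) s *v (u + integral {t..s} R *v w))^2)"
    and p0: "\<And>x. p0 * norm x^2 \<le> x \<bullet> (P0 *v x)"
    and pm: "0 < pm" "pm < p0" "2 * pm * 3 + pm^2 * (kc * 3 * kq * (kc * 3)) < v"
    and eps: "0 < eps" "(eps * (kc * (1 + 3 * \<delta>) + kc * 3 * \<delta>))^2 * 4 \<le> \<mu>'"
begin

text \<open>The constants \<open>kU1\<close> and \<open>kU2\<close> are the bounds of \<open>P_upper_initial\<close> and \<open>P_upper_window\<close> for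
  windows of length \<open>\<delta>\<close>; the factor \<open>6\<close> in \<open>pM\<close> is the dimension in \<open>psd_norm_le\<close>.\<close>

definition "\<gamma> = \<delta> * \<mu>' / 4"
definition "kf = 6 + 3 * \<delta>"
definition "kU1 = kf^4 * norm P0 + kv * kf^4 * \<delta>"
definition "kU2 = (kv * (kf * (kf^2 * (kc*3)^2 * \<delta> * kf / \<gamma>))^2 + (kc * 3 * kf * kf / \<gamma>)^2 / q) * \<delta>"
definition "pM = 6 * max kU1 kU2 + 1"

lemma nonneg: "0 \<le> kq" "0 \<le> kv" "0 < \<gamma>" "0 \<le> kU1" "0 \<le> kU2" "1 \<le> pM"
proof -
  show "0 \<le> kq" "0 \<le> kv"
    using order_trans[OF norm_ge_zero Qb(3)[of 0]] order_trans[OF norm_ge_zero Vb(3)[of 0]] by auto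
  note k = this
  have kf: "0 \<le> kf" using \<delta> by (simp add: kf_def)
  show "0 \<le> kU1"
    using k kf \<delta> unfolding kU1_def
    by (intro add_nonneg_nonneg mult_nonneg_nonneg zero_le_power norm_ge_zero) auto
  have "0 \<le> kv * X^2 + Y^2 / q" for X Y
    using k Qb(1) by simp
  then show kU2: "0 \<le> kU2"
    using \<delta> unfolding kU2_def by (intro mult_nonneg_nonneg) auto
  show "0 < \<gamma>" using \<delta> \<mu>'(1) by (simp add: \<gamma>_def)
  show "1 \<le> pM" using kU2 by (simp add: pM_def max_def)
qed

text \<open>With integrands \<open>f\<close> along \<open>R\<close>, \<open>g\<close> along
  \<open>S\<close> and \<open>h = f - g\<close>, one has |g|^2 \<ge> |f|^2 / 2 - |h|^2. The choice
  of \<open>eps\<close> bounds the last term by a quarter of \<mu>', so a quarter of the original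
  Gramian bound remains.\<close>

lemma perturbed_gram:
  assumes t: "0 \<le> t" and S: "continuous_on {t..t+\<delta>} S" "\<And>s. s \<in> {t..t+\<delta>} \<Longrightarrow> norm (S s) \<le> 3"
    and close: "\<And>s. s \<in> {t..t+\<delta>} \<Longrightarrow> norm (S s - R s) \<le> eps"
  shows "\<gamma> * (norm u^2 + norm w^2) \<le> integral {t..t+\<delta>} (\<lambda>s. norm (C1 (S s) s *v (u + integral {t..s} S *v w))^2)"
proof -
  define I where "I = {t..t+\<delta>}"
  have sub: "I \<subseteq> {0..}" using t by (auto simp: I_def)
  define f where "f = (\<lambda>s. C1 (R s) s *v (u + integral {t..s} R *v w))"
  define g where "g = (\<lambda>s. C1 (S s) s *v (u + integral {t..s} S *v w))"
  define h where "h = (\<lambda>s. f s - g s)"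
  define N where "N = sqrt (norm u^2 + norm w^2)"
  have N: "norm u \<le> N" "norm w \<le> N" "N^2 = norm u^2 + norm w^2"
    by (auto simp: N_def real_le_rsqrt)
  define k1 where "k1 = kc * (1 + 3 * \<delta>) + kc * 3 * \<delta>"
  have cR: "continuous_on I R" by (rule continuous_on_subset[OF R_continuous sub])
  have cS: "continuous_on I S" using S(1) by (simp add: I_def)
  have cN: "continuous_on I (\<lambda>s. integral {t..s} X)" if "continuous_on I X" for X :: "real \<Rightarrow> real^3^3"
    unfolding I_def
    by (intro indefinite_integral_continuous_1 integrable_continuous_real) (use that in \<open>simp add: I_def\<close>)
  have cf: "continuous_on I f" and cg: "continuous_on I g"
    unfolding f_def g_def
    by (intro continuous_intros continuous_on_mult_vec C1_continuous cR cS cN sub)+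
  have int: "(\<lambda>s. norm (X s)^2) integrable_on I" if "continuous_on I X" for X :: "real \<Rightarrow> real^'m"
    using that unfolding I_def by (intro integrable_continuous_real continuous_intros) auto
  have hb: "norm (h s)^2 \<le> \<mu>' / 4 * N^2" if s: "s \<in> I" for s
  proof -
    have s0: "0 \<le> s" "s \<in> {t..t+\<delta>}" using s sub by (auto simp: I_def)
    have RS: "norm (R s - S s) \<le> eps" using close[OF s0(2)] by (simp add: norm_minus_commute)
    have NR: "norm (integral {t..s} R) \<le> 3 * \<delta>"
      using integral_attitude[of t "t+\<delta>" R 3 s] s cR R_norm t by (auto simp: I_def)
    have iR: "R integrable_on {t..s}" "S integrable_on {t..s}"
      using s0 continuous_on_subset[OF cR, of "{t..s}"] continuous_on_subset[OF cS, of "{t..s}"]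
      by (auto intro: integrable_continuous_real simp: I_def)
    have "integral {t..s} R - integral {t..s} S = integral {t..s} (\<lambda>r. R r - S r)"
      using iR by (simp add: Henstock_Kurzweil_Integration.integral_diff)
    also have "norm \<dots> \<le> eps * (t + \<delta> - t)"
      using close s0 cR cS
      by (intro integral_attitude continuous_intros) (auto simp: I_def norm_minus_commute)
    finally have ND: "norm (integral {t..s} R - integral {t..s} S) \<le> eps * \<delta>" by simp
    \<comment> \<open>Separates the change of the output matrix from the change of the transition
      matrix; each is of order \<open>eps\<close>, and together they give the factor
      \<open>k1\<close>.\<close>
    have "h s = C1 (R s - S s) s *v (u + integral {t..s} R *v w)
        + C1 (S s) s *v ((integral {t..s} R - integral {t..s} S) *v w)"
      by (simp add: h_def f_def g_def C_att_diff matrix_vector_mult_diff_rdistrib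
          matrix_vector_right_distrib matrix_vector_mult_diff_distrib algebra_simps)
    moreover have "norm (u + integral {t..s} R *v w) \<le> (1 + 3 * \<delta>) * N"
    proof -
      have "norm (integral {t..s} R *v w) \<le> 3 * \<delta> * N"
        using NR N(2) \<delta> by (intro order_trans[OF norm_mult_vec_le] mult_mono) auto
      with norm_triangle_ineq[of u "integral {t..s} R *v w"] N(1) show ?thesis
        by (simp add: algebra_simps)
    qed
    then have "norm (C1 (R s - S s) s *v (u + integral {t..s} R *v w)) \<le> (kc * eps) * ((1 + 3 * \<delta>) * N)"
      using order_trans[OF kc(2)[OF s0(1)] mult_left_mono[OF RS kc(1)]] kc(1) eps(1)
      by (intro order_trans[OF norm_mult_vec_le] mult_mono) auto
    moreover have "norm (C1 (S s) s *v ((integral {t..s} R - integral {t..s} S) *v w)) \<le> (kc * 3) * (eps * \<delta> * N)"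
      using order_trans[OF kc(2)[OF s0(1)] mult_left_mono[OF S(2)[OF s0(2)] kc(1)]] kc(1) ND N(2) \<delta> eps(1)
      by (intro order_trans[OF norm_mult_vec_le] mult_mono
          order_trans[OF norm_mult_vec_le[of "integral {t..s} R - integral {t..s} S" w]]) auto
    ultimately have "norm (h s) \<le> (kc * eps) * ((1 + 3 * \<delta>) * N) + (kc * 3) * (eps * \<delta> * N)"
      by (simp only:) (intro order_trans[OF norm_triangle_ineq] add_mono)
    also have "\<dots> = eps * k1 * N" by (simp add: k1_def algebra_simps)
    finally have "norm (h s)^2 \<le> (eps * k1 * N)^2" by (rule power_mono) simp
    also have "\<dots> = (eps * k1)^2 * N^2" by (simp add: power_mult_distrib)
    also have "\<dots> \<le> \<mu>' / 4 * N^2"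
      using eps(2) by (intro mult_right_mono) (auto simp: k1_def)
    finally show ?thesis .
  qed
  have le: "norm (f s)^2 / 2 - norm (h s)^2 \<le> norm (g s)^2" for s
  proof -
    have "f s = g s + h s" by (simp add: h_def)
    then have "norm (f s)^2 \<le> (norm (g s) + norm (h s))^2"
      by (intro power_mono) (auto intro: norm_triangle_ineq)
    also have "\<dots> \<le> 2 * norm (g s)^2 + 2 * norm (h s)^2"
      using zero_le_power2[of "norm (g s) - norm (h s)"] by (simp add: power2_sum power2_diff)
    finally show ?thesis by simp
  qed
  have ch: "continuous_on I h" unfolding h_def by (intro continuous_intros cf cg)
  have "\<mu>' * N^2 * \<delta> \<le> integral I (\<lambda>s. norm (f s)^2)"
    using \<mu>'(2)[OF t, of u w] \<delta> by (simp add: N(3) f_def I_def field_simps)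
  moreover have "integral I (\<lambda>s. norm (h s)^2) \<le> \<mu>' / 4 * N^2 * \<delta>"
  proof -
    have "integral I (\<lambda>s. norm (h s)^2) \<le> integral I (\<lambda>s. \<mu>' / 4 * N^2)"
      using hb by (intro integral_le int ch) (auto simp: I_def)
    then show ?thesis using \<delta> by (simp add: I_def mult_ac)
  qed
  moreover have "integral I (\<lambda>s. norm (f s)^2) / 2 - integral I (\<lambda>s. norm (h s)^2) \<le> integral I (\<lambda>s. norm (g s)^2)"
  proof -
    have "integral I (\<lambda>s. norm (f s)^2) / 2 - integral I (\<lambda>s. norm (h s)^2)
        = integral I (\<lambda>s. norm (f s)^2 / 2 - norm (h s)^2)"
      using int[OF cf] int[OF ch]
      by (subst Henstock_Kurzweil_Integration.integral_diff) (auto intro: integrable_on_divide)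
    also have "\<dots> \<le> integral I (\<lambda>s. norm (g s)^2)"
      using int[OF cf] int[OF ch] int[OF cg] le
      by (intro integral_le) (auto intro!: integrable_diff integrable_on_divide)
    finally show ?thesis .
  qed
  ultimately have "\<gamma> * N^2 \<le> integral I (\<lambda>s. norm (g s)^2)"
    by (simp add: \<gamma>_def algebra_simps)
  then show ?thesis by (simp add: N(3) g_def I_def)
qed

end

text \<open>The finite horizon serves twice: the locale can be reinterpreted at an earlier time
  inside a continuation argument, and it applies to solutions of the truncated system as long as
  they satisfy the observer equations.\<close>

locale observer_traj = observer_consts +
  fixes Rh :: "real \<Rightarrow> real^3^3" and dh :: "real \<Rightarrow> real^3"
    and P :: "real \<Rightarrow> real^(3+3)^(3+3)" and T :: real
  assumes T: "0 \<le> T"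
    and Rh_deriv: "\<And>t. t \<in> {0..T} \<Longrightarrow> (Rh has_vector_derivative
           (Rh t ** skew ((\<Omega> t + d) - dh t) +
            skew (upper_part (innovation idx a b Q (R t) (Rh t) (P t) t)) ** Rh t))
          (at t within {0..})"
    and dh_deriv: "\<And>t. t \<in> {0..T} \<Longrightarrow> (dh has_vector_derivative
           - lower_part (innovation idx a b Q (R t) (Rh t) (P t) t)) (at t within {0..})"
    and P_deriv: "\<And>t. t \<in> {0..T} \<Longrightarrow> (P has_vector_derivative
           riccati_rhs (A_mat (Rh t)) (C_mat idx a b (Rh t) t) (Q t) (V t) (P t))
          (at t within {0..})"
    and Rh0: "Rh 0 \<in> SO3" and P0_eq: "P 0 = P0"
begin

abbreviation "Ch t \<equiv> C_mat idx a b (Rh t) t"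

lemma within_T: "(f has_vector_derivative f') (at t within {0..}) \<Longrightarrow>
    (f has_vector_derivative f') (at t within {0..T})"
  by (rule has_vector_derivative_within_subset) auto

lemma Rh_orthogonal:
  assumes "t \<in> {0..T}"
  shows "Rh t ** transpose (Rh t) = mat 1" "transpose (Rh t) ** Rh t = mat 1"
proof -
  show "Rh t ** transpose (Rh t) = mat 1"
    by (rule orthogonal_flow[OF within_T[OF Rh_deriv] _ assms]) (use SO3_orthogonal(2)[OF Rh0] in auto)
  then show "transpose (Rh t) ** Rh t = mat 1" by (simp add: matrix_left_right_inverse)
qed

lemma Rh_norm: "t \<in> {0..T} \<Longrightarrow> norm (Rh t) \<le> 3"
  by (intro norm_orthogonal_le Rh_orthogonal)

lemma Rh_continuous: "continuous_on {0..T} Rh"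
  by (rule has_vector_derivative_continuous_on[OF within_T[OF Rh_deriv]])

lemma dh_continuous: "continuous_on {0..T} dh"
  by (rule has_vector_derivative_continuous_on[OF within_T[OF dh_deriv]])

lemma Ch_norm: "t \<in> {0..T} \<Longrightarrow> norm (Ch t) \<le> kc * 3"
  unfolding norm_C_mat using kc(1) Rh_norm[of t] kc(2)[of t "Rh t"]
  by (meson atLeastAtMost_iff mult_left_mono order_trans)

text \<open>Along a given trajectory \<open>Rh\<close> is a known function of time, and
  orthogonality bounds the coefficients a priori; the Riccati estimates thus apply despite the
  coupling.\<close>

sublocale ric: riccati_flow "\<lambda>t. A_mat (Rh t)" Ch Q V P T 3 "kc * 3" kq kv q v
proof
  show "sym_mat (P 0)" using P0 by (simp add: P0_eq pos_def_def)
  show "\<And>t. t \<in> {0..T} \<Longrightarrow> norm (A_mat (Rh t)) \<le> 3"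
    by (simp add: norm_A_mat Rh_norm del: atLeastAtMost_iff)
qed (use Qb Vb Ch_norm within_T[OF P_deriv] in auto)

lemma P_lower: "t \<in> {0..T} \<Longrightarrow> pm * norm x^2 \<le> x \<bullet> (P t *v x)"
proof (rule ric.P_lower)
  fix x :: "real^(3+3)" assume "x \<noteq> 0"
  then have "pm * norm x^2 < p0 * norm x^2" using pm by simp
  with p0[of x] show "pm * norm x^2 < x \<bullet> (P 0 *v x)" by (simp add: P0_eq)
qed (use pm in auto)

text \<open>Observability enters the stability argument through this bound. For \<open>t\<close> at
  least \<delta> the window ending at \<open>t\<close> is used; for smaller \<open>t\<close> the
  free adjoint solution from time 0.\<close>

lemma P_upper:
  assumes close: "\<And>s. s \<in> {0..T} \<Longrightarrow> norm (Rh s - R s) \<le> eps" and t: "t \<in> {0..T}"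
  shows "norm (P t) \<le> pM"
proof -
  define t0 where "t0 = max 0 (t - \<delta>)"
  have t0: "0 \<le> t0" "t0 \<le> t" "t \<le> T" "t - t0 \<le> \<delta>" using t \<delta> by (auto simp: t0_def)
  \<comment> \<open>The transition matrices of the coefficients along \<open>Rh\<close> are explicit
    shears, so both they and their inverses are bounded by \<open>kf\<close> on a window.\<close>
  define N where "N = (\<lambda>s. integral {t0..s} Rh)"
  have cRh: "continuous_on {t0..t} Rh"
    using t0 by (intro continuous_on_subset[OF Rh_continuous]) auto
  have N': "(N has_vector_derivative Rh s) (at s within {t0..t})" if "s \<in> {t0..t}" for s
    unfolding N_def by (rule integral_has_vector_derivative[OF cRh that])
  have nN: "norm (N s) \<le> 3 * \<delta>" if s: "s \<in> {t0..t}" for s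
  proof -
    have "norm (N s) \<le> 3 * (t - t0)"
      unfolding N_def using t0 by (intro integral_attitude[OF _ cRh s] Rh_norm) auto
    with t0 show ?thesis by simp
  qed
  define \<Phi> where "\<Phi> = (\<lambda>s. shear (N s))"
  define \<Psi> where "\<Psi> = (\<lambda>s. shear (- N s))"
  have inv: "\<Phi> s ** \<Psi> s = mat 1" for s
    by (simp add: \<Phi>_def \<Psi>_def shear_mult shear_0)
  have b: "norm (\<Psi> s) \<le> kf" "norm (\<Phi> s) \<le> kf" if "s \<in> {t0..t}" for s
    using norm_shear_le[of "- N s"] norm_shear_le[of "N s"] nN[OF that]
    by (auto simp: \<Phi>_def \<Psi>_def kf_def)
  have \<Psi>': "(\<Psi> has_vector_derivative - (\<Psi> s ** A_mat (Rh s))) (at s within {t0..t})"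
    if "s \<in> {t0..t}" for s
    using has_vector_derivative_shear[OF has_vector_derivative_minus[OF N'[OF that]]]
    by (simp add: \<Psi>_def A_mat_shear linear_neg[OF bounded_linear.linear[OF bounded_linear_A_mat]])
  have quad: "\<zeta> \<bullet> (P t *v \<zeta>) \<le> max kU1 kU2 * norm \<zeta>^2" for \<zeta>
  proof (cases "\<delta> \<le> t")
    case True
    then have t0_eq: "t0 = t - \<delta>" by (simp add: t0_def)
    have "\<zeta> \<bullet> (P t *v \<zeta>) \<le> (kv * (kf * (kf^2 * (kc * 3)^2 * (t - t0) * kf / \<gamma>))^2 +
        (kc * 3 * kf * kf / \<gamma>)^2 / q) * (t - t0) * norm \<zeta>^2"
    proof (rule ric.P_upper_window[OF t0(1-3) \<Psi>' inv b])
      show "continuous_on {t0..t} \<Phi>"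
        by (rule has_vector_derivative_continuous_on) (unfold \<Phi>_def, rule has_vector_derivative_shear[OF N'])
      show "continuous_on {t0..t} Ch"
        using t0 by (intro C_mat_continuous cRh) auto
      show "\<gamma> * norm x^2 \<le> integral {t0..t} (\<lambda>s. norm (Ch s *v (\<Phi> s *v x))^2)" for x
      proof -
        define u w where "u = upper_part x" and "w = lower_part x"
        have x: "x = join u w" by (simp add: u_def w_def join_parts)
        have t0d: "{t0..t0+\<delta>} = {t0..t}" by (simp add: t0_eq)
        show ?thesis
          using perturbed_gram[of t0 Rh u w, unfolded t0d] t0 cRh Rh_norm close
          by (simp add: x norm_join \<Phi>_def shear_mult_join C_mat_mult_join N_def)
      qed
    qed (use nonneg in auto)
    also have "\<dots> = kU2 * norm \<zeta>^2" by (simp add: t0_eq kU2_def)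
    also have "\<dots> \<le> max kU1 kU2 * norm \<zeta>^2" by (intro mult_right_mono) auto
    finally show ?thesis .
  next
    case False
    then have t0_eq: "t0 = 0" by (simp add: t0_def)
    have "\<zeta> \<bullet> (P t *v \<zeta>) \<le> (kf^4 * norm (P 0) + kv * kf^4 * \<delta>) * norm \<zeta>^2"
    proof (rule ric.P_upper_initial[where \<Phi> = \<Phi> and \<Psi> = \<Psi>, OF t])
      show "(\<Psi> has_vector_derivative - (\<Psi> s ** A_mat (Rh s))) (at s within {0..t})"
        if "s \<in> {0..t}" for s
        using \<Psi>'[of s] that by (simp add: t0_eq)
    qed (use b t0 t0_eq nonneg inv False in auto)
    also have "\<dots> = kU1 * norm \<zeta>^2" by (simp add: P0_eq kU1_def)
    also have "\<dots> \<le> max kU1 kU2 * norm \<zeta>^2" by (intro mult_right_mono) auto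
    finally show ?thesis .
  qed
  have "0 \<le> x \<bullet> (P t *v x)" for x
    using P_lower[OF t, of x] pm(1) by (meson less_imp_le mult_nonneg_nonneg order_trans zero_le_power2)
  then have "norm (P t) \<le> real CARD(3+3) * max kU1 kU2"
    using nonneg by (intro psd_norm_le[OF ric.P_symmetric[OF t]] quad) auto
  then show ?thesis by (simp add: pM_def)
qed

section \<open>Error coordinates and their dynamics\<close>

definition "E t = Rh t ** transpose (R t) - mat 1"
definition "err t = est_error (R t) d (Rh t) (dh t)"
definition "x t = join (vex (E t)) (d - dh t)"
definition "Inn t = innovation idx a b Q (R t) (Rh t) (P t) t"

lemma err_eq: "err t = norm (E t) + norm (d - dh t)"
  by (simp add: err_def est_error_def E_def)

lemma Rh_eq: "t \<in> {0..T} \<Longrightarrow> Rh t = R t + E t ** R t"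
  using SO3_orthogonal(1)[OF R_SO3, of t]
  by (simp add: E_def matrix_mult_diff_left flip: matrix_mul_assoc)

lemma Rh_close: "t \<in> {0..T} \<Longrightarrow> norm (Rh t - R t) \<le> norm (E t) * 3"
  using Rh_eq[of t] R_norm[of t] norm_matrix_mult_le[of "E t" "R t"]
  by (simp add: mult_left_mono order_trans[of _ "norm (E t) * norm (R t)"])

lemma E_orthogonal:
  assumes t: "t \<in> {0..T}"
  shows "E t + transpose (E t) = - (E t ** transpose (E t))"
proof -
  let ?U = "Rh t ** transpose (R t)"
  have "?U ** transpose ?U = Rh t ** (transpose (R t) ** R t) ** transpose (Rh t)"
    by (simp add: matrix_transpose_mul matrix_mul_assoc)
  also have "\<dots> = mat 1"
    using SO3_orthogonal(1)[OF R_SO3, of t] Rh_orthogonal[OF t] t by simp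
  finally have "(mat 1 + E t) ** transpose (mat 1 + E t) = mat 1" by (simp add: E_def)
  then have "mat 1 + (E t + transpose (E t) + E t ** transpose (E t)) = mat 1"
    by (simp add: transpose_add matrix_add_ldistrib matrix_mult_add_left add_ac)
  then have "E t + transpose (E t) + E t ** transpose (E t) = 0" by (simp only: add_cancel_left_right)
  then show ?thesis by (simp only: eq_neg_iff_add_eq_0)
qed

lemma transpose_E:
  assumes t: "t \<in> {0..T}"
  shows "transpose (E t) = - (E t ** transpose (E t)) - E t"
  using E_orthogonal[OF t] by (metis add_diff_cancel_left')

lemma skew_vex_E:
  assumes t: "t \<in> {0..T}"
  shows "skew (vex (E t)) = E t + (1/2) *\<^sub>R (E t ** transpose (E t))"
proof -
  have "F - A = 2 *\<^sub>R F + X" if "A = - X - F" for A F X :: "real^3^3"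
    using that by (simp add: scaleR_2)
  from this[OF transpose_E[OF t]]
  have "E t - transpose (E t) = 2 *\<^sub>R E t + E t ** transpose (E t)" .
  then show ?thesis
    unfolding skew_vex by (simp add: scaleR_add_right)
qed

text \<open>For \<open>norm (E t) \<le> 1\<close> half of the left side absorbs the quadratic
  symmetric part. Some smallness is necessary: \<open>vex\<close> vanishes at rotations by a half
  turn.\<close>

lemma norm_E_le:
  assumes t: "t \<in> {0..T}" and "norm (E t) \<le> 1"
  shows "norm (E t) \<le> 6 * norm (vex (E t))"
proof -
  have "norm (E t) = norm (skew (vex (E t)) - (1/2) *\<^sub>R (E t ** transpose (E t)))"
    by (simp add: skew_vex_E[OF t])
  also have "\<dots> \<le> 3 * norm (vex (E t)) + 1/2 * (norm (E t) * norm (E t))"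
    using norm_matrix_mult_le[of "E t" "transpose (E t)"]
    by (intro order_trans[OF norm_triangle_ineq4] add_mono norm_skew_le) auto
  also have "norm (E t) * norm (E t) \<le> norm (E t) * 1"
    using assms(2) by (intro mult_left_mono) auto
  finally show ?thesis by simp
qed

lemma err_le_x: "t \<in> {0..T} \<Longrightarrow> norm (E t) \<le> 1 \<Longrightarrow> err t \<le> 7 * norm (x t)"
  using norm_E_le[of t] norm_parts_le[of "x t"] by (simp add: err_eq x_def)

lemma x_le_err: "norm (x t) \<le> 3 * err t"
proof -
  have "j \<le> 3 * (e + w)" if "j \<le> f + w" "f \<le> 3 * e" "0 \<le> w" for j f e w :: real
    using that by simp
  from this[OF norm_join_le norm_vex_le norm_ge_zero] show ?thesis
    unfolding err_eq x_def .
qed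

text \<open>Both attitudes are driven by \<Omega>, whose contributions cancel; only the bias error
  remains, carried to the other frame by \<open>rotation_skew\<close>.\<close>

lemma E_deriv:
  assumes t: "t \<in> {0..T}"
  shows "(E has_vector_derivative skew (R t *v (d - dh t)) + E t ** skew (R t *v (d - dh t)) +
     (skew (upper_part (Inn t)) + skew (upper_part (Inn t)) ** E t)) (at t within {0..T})"
proof -
  let ?u = "upper_part (Inn t)" and ?w = "d - dh t"
  have t0: "0 \<le> t" using t by simp
  have sk: "skew ((\<Omega> t + d) - dh t) = skew (\<Omega> t) + skew ?w"
    using linear_add[OF bounded_linear.linear[OF bounded_linear_skew], of "\<Omega> t" ?w] by (simp add: algebra_simps)
  have "(E has_vector_derivative
     Rh t ** transpose (R t ** skew (\<Omega> t)) +
     (Rh t ** skew ((\<Omega> t + d) - dh t) + skew ?u ** Rh t) ** transpose (R t)) (at t within {0..T})"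
    unfolding E_def Inn_def
    using has_vector_derivative_diff[OF has_vector_derivative_matrix_mult[OF within_T[OF Rh_deriv[OF t]]
       has_vector_derivative_transpose[OF within_T[OF R_deriv[OF t0]]]] has_vector_derivative_const[of "mat 1"]]
    by simp
  moreover have "Rh t ** transpose (R t ** skew (\<Omega> t)) +
     (Rh t ** skew ((\<Omega> t + d) - dh t) + skew ?u ** Rh t) ** transpose (R t) =
     Rh t ** skew ?w ** transpose (R t) + skew ?u ** (Rh t ** transpose (R t))"
    by (simp add: sk matrix_transpose_mul transpose_skew matrix_mult_minus matrix_add_ldistrib
        matrix_mult_add_left matrix_mul_assoc)
  moreover have "Rh t ** skew ?w ** transpose (R t) = skew (R t *v ?w) + E t ** skew (R t *v ?w)"
    using rotation_skew[OF R_SO3[OF t0], of ?w]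
    by (subst Rh_eq[OF t]) (simp add: matrix_mult_add_left flip: matrix_mul_assoc)
  moreover have "skew ?u ** (Rh t ** transpose (R t)) = skew ?u + skew ?u ** E t"
    by (simp add: E_def matrix_mult_diff_right)
  ultimately show ?thesis by simp
qed

text \<open>The part of \<open>x'\<close> that is of second order in \<open>err\<close>.\<close>

definition "rest t = - ((P t ** transpose (Ch t) ** Q t) *v
     y_stack idx a b ((1/2) *\<^sub>R (E t ** transpose (E t) ** Rh t)) t) +
   join ((R t - Rh t) *v (d - dh t) +
     vex (E t ** skew (R t *v (d - dh t)) + skew (upper_part (Inn t)) ** E t)) 0"

text \<open>The bias error enters through \<open>R t\<close>; replacing it by \<open>Rh t\<close>
  gives the Riccati coefficient, and the difference is quadratic. The innovation is linear in the
  output error, whose linear part is \<open>Ch t *v x t\<close>.\<close>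

lemma x_deriv:
  assumes t: "t \<in> {0..T}"
  shows "(x has_vector_derivative A_mat (Rh t) *v x t -
      P t *v (transpose (Ch t) *v (Q t *v (Ch t *v x t))) + rest t) (at t within {0..T})"
proof -
  let ?w = "d - dh t" and ?G = "P t ** transpose (Ch t) ** Q t"
  let ?n = "vex (E t ** skew (R t *v ?w) + skew (upper_part (Inn t)) ** E t)"
  let ?q = "(1/2) *\<^sub>R (E t ** transpose (E t) ** Rh t)"
  note lin_vex = bounded_linear.linear[OF bounded_linear_vex]
  have "((\<lambda>t. d - dh t) has_vector_derivative lower_part (Inn t)) (at t within {0..T})"
    using has_vector_derivative_diff[OF has_vector_derivative_const[of d] within_T[OF dh_deriv[OF t]]]
    by (simp add: Inn_def)
  from has_vector_derivative_join[OF bounded_linear.has_vector_derivative[OF bounded_linear_vex E_deriv[OF t]] this]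
  have "(x has_vector_derivative join (R t *v ?w + upper_part (Inn t) + ?n) (lower_part (Inn t)))
      (at t within {0..T})"
    unfolding x_def by (simp add: linear_add[OF lin_vex] vex_skew add_ac)
  then have D: "(x has_vector_derivative J) (at t within {0..T})"
    if "J = join (R t *v ?w + upper_part (Inn t) + ?n) (lower_part (Inn t))" for J
    using that by simp
  have J: "join (R t *v ?w + upper_part (Inn t) + ?n) (lower_part (Inn t)) =
      A_mat (Rh t) *v x t + Inn t + join ((R t - Rh t) *v ?w + ?n) 0"
  proof -
    have "A_mat (Rh t) *v x t + Inn t = join (Rh t *v ?w) 0 + join (upper_part (Inn t)) (lower_part (Inn t))"
      by (simp only: x_def A_mat_mult_join join_parts)
    then show ?thesis
      by (simp add: join_add matrix_vector_mult_diff_rdistrib add_ac)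
  qed
  have I: "Inn t = - (P t *v (transpose (Ch t) *v (Q t *v (Ch t *v x t)))) - ?G *v y_stack idx a b ?q t"
  proof -
    have "y_err idx a b (Rh t) (R t) t = Ch t *v x t + y_stack idx a b ?q t"
    proof -
      \<comment> \<open>Factoring out \<open>Rh\<close> on the right writes
        \<open>Rh t - R t\<close> as \<open>- (transpose (E t) ** Rh t)\<close>; its first-order
        part \<open>skew (vex (E t)) ** Rh t\<close> is what \<open>C_att_mult\<close>
        recognises.\<close>
      have "R t = R t ** (transpose (Rh t) ** Rh t)"
        using Rh_orthogonal[OF t] by simp
      also have "\<dots> = transpose (mat 1 + E t) ** Rh t"
        by (simp add: E_def matrix_transpose_mul matrix_mul_assoc)
      finally have m1: "Rh t - R t = - (transpose (E t) ** Rh t)"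
        by (simp add: transpose_add matrix_mult_add_left)
      have m2: "- transpose (E t) = skew (vex (E t)) + (1/2) *\<^sub>R (E t ** transpose (E t))"
      proof -
        have "- A = (F + (1/2) *\<^sub>R X) + (1/2) *\<^sub>R X" if "A = - X - F" for A F X :: "real^3^3"
          unfolding that by (simp add: add.assoc flip: scaleR_add_left)
        from this[OF transpose_E[OF t]] show ?thesis
          unfolding skew_vex_E[OF t] .
      qed
      have "Rh t - R t = (skew (vex (E t)) + (1/2) *\<^sub>R (E t ** transpose (E t))) ** Rh t"
        unfolding m2[symmetric] matrix_mult_minus(1) by (rule m1)
      then have "Rh t - R t = skew (vex (E t)) ** Rh t + ?q"
        by (simp only: matrix_mult_add_left scalar_matrix_assoc)
      then show ?thesis
        unfolding y_err_eq x_def C_mat_mult_join C_att_mult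
        by (simp add: linear_add[OF y_stack_linear])
    qed
    then show ?thesis
      by (simp add: Inn_def innovation_def matrix_vector_right_distrib flip: matrix_vector_mul_assoc)
  qed
  show ?thesis
  proof (rule D)
    have "X - Y + (- Z + j) = X + i + j" if "i = - Y - Z" for X Y Z i j :: "real^(3+3)"
      unfolding that by simp
    from this[OF I] show "A_mat (Rh t) *v x t - P t *v (transpose (Ch t) *v (Q t *v (Ch t *v x t))) + rest t
        = join (R t *v ?w + upper_part (Inn t) + ?n) (lower_part (Inn t))"
      unfolding J rest_def .
  qed
qed

lemma rest_bound:
  assumes t: "t \<in> {0..T}" and P: "norm (P t) \<le> pM" and e1: "norm (E t) \<le> 1"
  shows "norm (rest t) \<le> (30 + 29 * (pM * (kc * 3) * kq * ky)) * err t^2"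
proof -
  let ?w = "d - dh t" and ?G = "P t ** transpose (Ch t) ** Q t" and ?e = "norm (E t)"
  define kP where "kP = pM * (kc * 3) * kq"
  have t0: "0 \<le> t" using t by simp
  have kP: "0 \<le> kP" unfolding kP_def using nonneg kc(1) by simp
  have G: "norm ?G \<le> kP"
    unfolding kP_def using P Ch_norm[OF t] Qb(3)[OF t0] nonneg kc(1)
    by (intro order_trans[OF norm_matrix_mult_le] mult_mono mult_nonneg_nonneg) auto
  have EE: "norm (E t ** transpose (E t) ** Rh t) \<le> ?e * ?e * 3"
    using Rh_norm[OF t] norm_matrix_mult_le[of "E t" "transpose (E t)"]
    by (intro order_trans[OF norm_matrix_mult_le] mult_mono) auto
  have "norm (y_stack idx a b ((1/2) *\<^sub>R (E t ** transpose (E t) ** Rh t)) t) \<le> ky * (3/2 * (?e * ?e))"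
    using EE ky(1) by (intro order_trans[OF ky(2)[OF t0]] mult_left_mono) auto
  then have 1: "norm (?G *v y_stack idx a b ((1/2) *\<^sub>R (E t ** transpose (E t) ** Rh t)) t)
      \<le> kP * (ky * (3/2 * (?e * ?e)))"
    using G kP by (intro order_trans[OF norm_mult_vec_le] mult_mono) auto
  have "norm (y_err idx a b (Rh t) (R t) t) \<le> ky * (?e * 3)"
    unfolding y_err_eq using Rh_close[OF t] ky(1)
    by (intro order_trans[OF ky(2)[OF t0]] mult_left_mono) auto
  then have "norm (Inn t) \<le> kP * (ky * (?e * 3))"
    unfolding Inn_def innovation_def using G kP
    by (simp only: norm_minus_cancel) (intro order_trans[OF norm_mult_vec_le] mult_mono; simp)
  then have U: "norm (upper_part (Inn t)) \<le> kP * (ky * (?e * 3))"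
    using norm_parts_le(1)[of "Inn t"] by linarith
  have 2: "norm ((R t - Rh t) *v ?w) \<le> ?e * 3 * norm ?w"
    using Rh_close[OF t] by (intro order_trans[OF norm_mult_vec_le] mult_right_mono) (auto simp: norm_minus_commute)
  have "norm (R t *v ?w) \<le> 3 * norm ?w"
    using R_norm[OF t0] by (intro order_trans[OF norm_mult_vec_le] mult_right_mono) auto
  then have "norm (skew (R t *v ?w)) \<le> 9 * norm ?w"
    using norm_skew_le[of "R t *v ?w"] by linarith
  then have 3: "norm (E t ** skew (R t *v ?w)) \<le> ?e * (9 * norm ?w)"
    by (intro order_trans[OF norm_matrix_mult_le] mult_left_mono) auto
  have "norm (skew (upper_part (Inn t))) \<le> 9 * (kP * (ky * ?e))"
    using norm_skew_le[of "upper_part (Inn t)"] U by simp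
  then have 4: "norm (skew (upper_part (Inn t)) ** E t) \<le> 9 * (kP * (ky * ?e)) * ?e"
    by (intro order_trans[OF norm_matrix_mult_le] mult_right_mono) auto
  have "norm (E t ** skew (R t *v ?w) + skew (upper_part (Inn t)) ** E t) \<le>
      ?e * (9 * norm ?w) + 9 * (kP * (ky * ?e)) * ?e"
    using 3 4 by (intro order_trans[OF norm_triangle_ineq] add_mono)
  then have "norm (vex (E t ** skew (R t *v ?w) + skew (upper_part (Inn t)) ** E t)) \<le>
      3 * (?e * (9 * norm ?w) + 9 * (kP * (ky * ?e)) * ?e)"
    by (intro order_trans[OF norm_vex_le] mult_left_mono) auto
  note n5 = this
  have j: "norm (join (y + z) 0) \<le> A + B" if "norm y \<le> A" "norm z \<le> B" for y z :: "real^3" and A B :: real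
    using norm_join_le[of "y + z" 0] norm_triangle_ineq[of y z] that by simp
  have 5: "norm (join ((R t - Rh t) *v ?w +
     vex (E t ** skew (R t *v ?w) + skew (upper_part (Inn t)) ** E t)) 0) \<le>
     ?e * 3 * norm ?w + 3 * (?e * (9 * norm ?w) + 9 * (kP * (ky * ?e)) * ?e)"
    by (rule j[OF 2 n5])
  have "norm (rest t) \<le> kP * (ky * (3/2 * (?e * ?e))) +
     (?e * 3 * norm ?w + 3 * (?e * (9 * norm ?w) + 9 * (kP * (ky * ?e)) * ?e))"
    unfolding rest_def using 1 5 by (intro order_trans[OF norm_triangle_ineq] add_mono) auto
  \<comment> \<open>Here 57/2 = 3/2 + 27 and 30 = 3 + 27; the former is rounded up to 29 in the next
    step.\<close>
  also have "\<dots> = 57/2 * (kP * ky) * (?e * ?e) + 30 * (?e * norm ?w)"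
    by (simp add: algebra_simps)
  also have "\<dots> \<le> 29 * (kP * ky) * err t^2 + 30 * err t^2"
  proof (intro add_mono mult_mono)
    show "?e * ?e \<le> err t^2" "?e * norm ?w \<le> err t^2"
      unfolding power2_eq_square by (intro mult_mono; simp add: err_eq)+
  qed (use kP ky(1) in auto)
  finally show ?thesis by (simp add: kP_def algebra_simps)
qed

end

section \<open>Exponential stability\<close>

context observer_consts
begin

text \<open>The factor \<open>21\<close> in \<open>c0\<close> is the product of the factors in \<open>err_le_x\<close> and \<open>x_le_err\<close>.\<close>

definition "ke = 30 + 29 * (pM * (kc * 3) * kq * ky)"
text \<open>The three entries serve, in turn, \<open>norm_E_le\<close>, the closeness
  \<open>eps\<close> required by the Gramian (the factor 3 is that of \<open>Rh_close\<close>), and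
  the absorption of \<open>rest\<close> into half of the dissipation.\<close>

definition "\<epsilon>1 = min 1 (min (eps / 3) (v / (28 * ke * pM)))"
text \<open>The Lyapunov function decays at rate \<open>v / (2 * pM)\<close>; being quadratic in the
  error, it gives the error half that rate.\<close>

definition "\<kappa> = v / (4 * pM)"
definition "c0 = 21 * pM / pm"
definition "r0 = \<epsilon>1 / (2 * (c0 + 1))"

lemma consts_pos: "0 < ke" "0 < pM" "0 < \<epsilon>1" "0 < \<kappa>" "0 < c0" "0 < r0" "r0 < \<epsilon>1" "c0 * r0 < \<epsilon>1"
proof -
  have "0 \<le> pM * (kc * 3) * kq * ky" using nonneg kc(1) ky(1) by simp
  then show 1: "0 < ke" unfolding ke_def by linarith
  show 2: "0 < pM" using nonneg by simp
  show 3: "0 < \<epsilon>1" using 1 2 eps Vb(1) by (simp add: \<epsilon>1_def)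
  show "0 < \<kappa>" using 2 Vb(1) by (simp add: \<kappa>_def)
  show 5: "0 < c0" using 2 pm by (simp add: c0_def)
  show "0 < r0" using 3 5 by (simp add: r0_def)
  show "r0 < \<epsilon>1" "c0 * r0 < \<epsilon>1" using 3 5 by (simp_all add: r0_def field_simps add_pos_pos)
qed

end

context observer_traj
begin

lemma err_smallD:
  assumes "err t \<le> \<epsilon>1"
  shows "norm (E t) \<le> 1" "norm (d - dh t) \<le> 1" "norm (E t) * 3 \<le> eps" "err t \<le> v / (28 * ke * pM)"
proof -
  have "err t \<le> 1" "err t \<le> eps / 3" and 1: "err t \<le> v / (28 * ke * pM)"
    using assms by (simp_all add: \<epsilon>1_def)
  moreover have "norm (E t) \<le> err t" "norm (d - dh t) \<le> err t" by (simp_all add: err_eq)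
  ultimately show "norm (E t) \<le> 1" "norm (d - dh t) \<le> 1" "norm (E t) * 3 \<le> eps"
    by linarith+
  show "err t \<le> v / (28 * ke * pM)" by (rule 1)
qed

lemma close_eps: "t \<in> {0..T} \<Longrightarrow> err t \<le> \<epsilon>1 \<Longrightarrow> norm (Rh t - R t) \<le> eps"
  using Rh_close err_smallD(3) by (rule order_trans)

text \<open>All comparisons go through \<eta>, the inverse of \<open>P\<close> applied to
  \<open>x\<close>: \<open>V\<close> dissipates in \<eta>, and the bounds on \<open>P\<close> give
  |x| \<le> pM |\<eta>| and pm |\<eta>| \<le> |x|.\<close>

lemma decay:
  assumes small: "\<And>s. s \<in> {0..T} \<Longrightarrow> err s \<le> \<epsilon>1" and t: "t \<in> {0..T}"
  shows "err t \<le> c0 * exp (- \<kappa> * t) * err 0"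
proof -
  define \<eta> where "\<eta> = (\<lambda>s. matrix_inv (P s) *v x s)"
  define L where "L = (\<lambda>s. x s \<bullet> \<eta> s)"
  define L' where "L' = (\<lambda>s. - ((Ch s *v x s) \<bullet> (Q s *v (Ch s *v x s))) - \<eta> s \<bullet> (V s *v \<eta> s)
    + 2 * (\<eta> s \<bullet> rest s))"
  have L': "(L has_real_derivative L' s) (at s within {0..T})" if s: "s \<in> {0..T}" for s
    unfolding L_def L'_def \<eta>_def
    by (rule ric.lyapunov_deriv[OF s pm(1) P_lower x_deriv[OF s] refl])
  have PM: "norm (P s) \<le> pM" if "s \<in> {0..T}" for s
    by (rule P_upper[OF close_eps[OF _ small] that])
  have P\<eta>: "P s *v \<eta> s = x s" if "s \<in> {0..T}" for s
    using coercive_inv(1)[OF pm(1) P_lower[OF that]] by (simp add: \<eta>_def matrix_vector_mul_assoc)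
  have x\<eta>: "norm (x s) \<le> pM * norm (\<eta> s)" if "s \<in> {0..T}" for s
    using norm_mult_vec_le[of "P s" "\<eta> s"] PM[OF that]
    by (simp add: P\<eta>[OF that] order_trans mult_right_mono)
  have diss: "L' s \<le> - 2 * \<kappa> * L s" if s: "s \<in> {0..T}" for s
  proof -
    have s0: "0 \<le> s" using s by simp
    have e1: "norm (E s) \<le> 1" and e2: "err s \<le> v / (28 * ke * pM)" and e0: "0 \<le> err s"
      using err_smallD[OF small[OF s]] by (simp_all add: err_eq)
    let ?n = "norm (\<eta> s)"
    \<comment> \<open>One factor \<open>err s\<close> is replaced by its smallness bound, the other
      by \<open>7 * pM\<close> times |\<eta>|. So twice the inner product of \<eta> and
      \<open>rest\<close> costs at most half of \<open>v\<close> |\<eta>|^2.\<close>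
    have "norm (rest s) \<le> ke * (err s * err s)"
      using rest_bound[OF s PM[OF s] e1] by (simp add: ke_def power2_eq_square)
    also have "\<dots> \<le> ke * (v / (28 * ke * pM) * (7 * (pM * ?n)))"
    proof (intro mult_left_mono mult_mono e2)
      show "err s \<le> 7 * (pM * ?n)" using err_le_x[OF s e1] x\<eta>[OF s] by simp
    qed (use e0 consts_pos Vb(1) in auto)
    also have "\<dots> = v / 4 * ?n" using consts_pos by (simp add: field_simps)
    finally have "?n * norm (rest s) \<le> ?n * (v / 4 * ?n)" by (rule mult_left_mono) simp
    then have "\<eta> s \<bullet> rest s \<le> v / 4 * ?n^2"
      using norm_cauchy_schwarz[of "\<eta> s" "rest s"] by (simp add: power2_eq_square mult_ac)
    moreover have "v * ?n^2 \<le> \<eta> s \<bullet> (V s *v \<eta> s)" by (rule Vb(4)[OF s0])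
    moreover have "0 \<le> (Ch s *v x s) \<bullet> (Q s *v (Ch s *v x s))"
      by (rule order_trans[OF _ Qb(4)[OF s0]]) (use Qb(1) in simp)
    ultimately have "L' s \<le> - (v / 2 * ?n^2)" unfolding L'_def by linarith
    moreover have "2 * \<kappa> * L s \<le> v / 2 * ?n^2"
    proof -
      have "L s \<le> norm (x s) * ?n" unfolding L_def by (rule norm_cauchy_schwarz)
      also have "\<dots> \<le> pM * ?n * ?n" by (intro mult_right_mono x\<eta>[OF s]) simp
      finally have "2 * \<kappa> * L s \<le> 2 * \<kappa> * (pM * ?n * ?n)"
        using consts_pos by (intro mult_left_mono) auto
      also have "\<dots> = v / 2 * ?n^2"
        using consts_pos by (simp add: \<kappa>_def power2_eq_square field_simps)
      finally show ?thesis .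
    qed
    ultimately show ?thesis by simp
  qed
  have sub: "{0..t} \<subseteq> {0..T}" using t by auto
  have "L t * exp (2 * \<kappa> * t) \<le> L 0 * exp (2 * \<kappa> * 0)"
  proof (rule nonincreasing_within[where f = "\<lambda>s. L s * exp (2 * \<kappa> * s)" and
      f' = "\<lambda>s. (L' s + 2 * \<kappa> * L s) * exp (2 * \<kappa> * s)"])
    fix s assume "s \<in> {0..t}"
    then have s: "s \<in> {0..T}" using sub by blast
    have A: "(L has_real_derivative L' s) (at s within {0..t})"
      by (rule has_field_derivative_subset[OF L'[OF s] sub])
    have B: "((\<lambda>s. exp (2 * \<kappa> * s)) has_real_derivative 2 * \<kappa> * exp (2 * \<kappa> * s)) (at s within {0..t})"
      by (auto intro!: derivative_eq_intros)
    have "(l + 2 * \<kappa> * m) * e = l * e + 2 * \<kappa> * e * m" for l m e :: real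
      by (simp add: algebra_simps)
    with DERIV_mult[OF A B]
    show "((\<lambda>s. L s * exp (2 * \<kappa> * s)) has_real_derivative (L' s + 2 * \<kappa> * L s) * exp (2 * \<kappa> * s))
        (at s within {0..t})"
      by simp
    show "(L' s + 2 * \<kappa> * L s) * exp (2 * \<kappa> * s) \<le> 0"
      using diss[OF s] by (intro mult_nonpos_nonneg) auto
  qed (use t in auto)
  then have "L t * exp (2 * \<kappa> * t) * exp (- 2 * \<kappa> * t) \<le> L 0 * exp (- 2 * \<kappa> * t)"
    by (intro mult_right_mono) auto
  then have Lt: "L t \<le> L 0 * exp (- 2 * \<kappa> * t)"
    by (simp add: mult.assoc flip: exp_add)
  have T0: "0 \<in> {0..T}" using T by simp
  have "pm * norm (\<eta> 0) \<le> norm (x 0)"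
    unfolding \<eta>_def by (rule coercive_inv(3)[OF pm(1) P_lower[OF T0]])
  then have "norm (x 0) * (pm * norm (\<eta> 0)) \<le> norm (x 0) * norm (x 0)"
    by (rule mult_left_mono) simp
  moreover have "pm * L 0 \<le> pm * (norm (x 0) * norm (\<eta> 0))"
    unfolding L_def using pm(1) by (intro mult_left_mono norm_cauchy_schwarz) auto
  ultimately have L0: "pm * L 0 \<le> norm (x 0)^2"
    by (simp add: power2_eq_square mult.left_commute)
  have "pm * norm (\<eta> t)^2 \<le> L t"
    using P_lower[OF t, of "\<eta> t"] by (simp add: P\<eta>[OF t] L_def inner_commute)
  then have "pm * (pm * norm (\<eta> t)^2) \<le> pm * (L 0 * exp (- 2 * \<kappa> * t))"
    using Lt pm(1) by (intro mult_left_mono) auto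
  also have "\<dots> \<le> norm (x 0)^2 * exp (- 2 * \<kappa> * t)"
    using L0 mult_right_mono[of "pm * L 0" "norm (x 0)^2" "exp (- 2 * \<kappa> * t)"] by (simp add: mult_ac)
  also have "exp (- 2 * \<kappa> * t) = exp (- \<kappa> * t)^2"
    by (simp add: power2_eq_square flip: exp_add)
  finally have "(pm * norm (\<eta> t))^2 \<le> (norm (x 0) * exp (- \<kappa> * t))^2"
    by (simp add: power_mult_distrib power2_eq_square mult_ac)
  then have n\<eta>: "pm * norm (\<eta> t) \<le> norm (x 0) * exp (- \<kappa> * t)"
    by (rule power2_le_imp_le) simp
  have "norm (E t) \<le> 1" by (rule err_smallD[OF small[OF t]])
  then have "err t \<le> 7 * (pM * norm (\<eta> t))"
    using err_le_x[OF t] x\<eta>[OF t] by linarith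
  also have "\<dots> = 7 * pM / pm * (pm * norm (\<eta> t))" using pm(1) by simp
  also have "\<dots> \<le> 7 * pM / pm * ((3 * err 0) * exp (- \<kappa> * t))"
    using n\<eta> x_le_err[of 0] pm(1) consts_pos
    by (intro mult_left_mono order_trans[OF n\<eta>] mult_right_mono) auto
  also have "\<dots> = c0 * exp (- \<kappa> * t) * err 0" by (simp add: c0_def)
  finally show ?thesis .
qed

lemma err_continuous: "continuous_on {0..T} err"
  unfolding err_eq[abs_def] E_def
  by (intro continuous_intros continuous_on_matrix_mult continuous_on_transpose Rh_continuous dh_continuous
      continuous_on_subset[OF R_continuous]) auto

lemma err_small:
  assumes init: "err 0 \<le> r0" and t: "t \<in> {0..T}"
  shows "err t < \<epsilon>1"
proof (rule bootstrap[OF err_continuous _ _ t])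
  show "err 0 < \<epsilon>1" using init consts_pos by simp
  fix \<tau> assume \<tau>: "\<tau> \<in> {0..T}" and le: "\<And>t. t \<in> {0..\<tau>} \<Longrightarrow> err t \<le> \<epsilon>1"
  \<comment> \<open>The decay estimate needs smallness up to its own horizon, so it is used with
    horizon \<tau>; all constants stay the same, and \<open>c0 * r0 < \<epsilon>1\<close> gives the
    strict inequality.\<close>
  interpret sub: observer_traj p n idx a b R \<Omega> d Q V P0 \<delta> \<mu> kc ky kq kv q v \<mu>' p0 pm eps Rh dh P \<tau>
    using \<tau> Rh_deriv dh_deriv P_deriv Rh0 P0_eq by unfold_locales auto
  have e0: "0 \<le> err 0" by (simp add: err_eq)
  have "err \<tau> \<le> c0 * exp (- \<kappa> * \<tau>) * err 0"
    by (rule sub.decay[OF le]) (use \<tau> in auto)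
  also have "\<dots> \<le> c0 * 1 * err 0"
    using consts_pos \<tau> e0 by (intro mult_right_mono mult_left_mono) auto
  also have "\<dots> \<le> c0 * r0" using init consts_pos by simp
  finally show "err \<tau> < \<epsilon>1" using consts_pos by simp
qed

lemma a_priori:
  assumes init: "err 0 \<le> r0" and t: "t \<in> {0..T}"
  shows "err t \<le> c0 * exp (- \<kappa> * t) * err 0" "norm (P t) \<le> pM"
    "norm (Rh t) \<le> 3" "norm (dh t) \<le> norm d + 1"
proof -
  have small: "err s \<le> \<epsilon>1" if "s \<in> {0..T}" for s
    using err_small[OF init that] by simp
  show "err t \<le> c0 * exp (- \<kappa> * t) * err 0" by (rule decay[OF small t])
  show "norm (P t) \<le> pM" by (rule P_upper[OF close_eps[OF _ small] t])
  show "norm (Rh t) \<le> 3" by (rule Rh_norm[OF t])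
  have "norm (d - dh t) \<le> 1"
    by (rule err_smallD[OF small[OF t]])
  then show "norm (dh t) \<le> norm d + 1"
    using norm_triangle_ineq2[of "dh t" d] by (simp add: norm_minus_commute)
qed

end

section \<open>Existence of observer trajectories by truncation\<close>

lemma tame_linear_time:
  assumes h: "tame K h"
    and k: "0 \<le> k" "\<And>t S S'. 0 \<le> t \<Longrightarrow> norm (G t S - G t S') \<le> k * norm (S - S')"
      "\<And>t S. 0 \<le> t \<Longrightarrow> norm (G t S) \<le> k * norm S"
    and c: "\<And>S. continuous_on {0..} S \<Longrightarrow> continuous_on {0..} (\<lambda>t. G t (S t))"
  shows "tame K (\<lambda>t x. G t (h t x))"
proof -
  obtain B L where b: "0 \<le> B" "0 \<le> L" "\<And>t x. 0 \<le> t \<Longrightarrow> x \<in> K \<Longrightarrow> norm (h t x) \<le> B"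
      "\<And>t x y. 0 \<le> t \<Longrightarrow> x \<in> K \<Longrightarrow> y \<in> K \<Longrightarrow> norm (h t x - h t y) \<le> L * norm (x - y)"
    using tameE[OF h] by blast
  show ?thesis
  proof (rule tameI[of "k * B" "k * L"])
    fix t x assume "0 \<le> (t::real)" "x \<in> K"
    then show "norm (G t (h t x)) \<le> k * B"
      using k b by (intro order_trans[OF k(3)] mult_left_mono) auto
  next
    fix t x y assume t: "0 \<le> (t::real)" "x \<in> K" "y \<in> K"
    then have "k * norm (h t x - h t y) \<le> k * (L * norm (x - y))"
      using k b by (intro mult_left_mono) auto
    then show "norm (G t (h t x) - G t (h t y)) \<le> k * L * norm (x - y)"
      using k(2)[OF t(1), of "h t x" "h t y"] by (simp add: mult.assoc)
  next
    fix u :: "real \<Rightarrow> _" assume "continuous_on {0..} u" "u ` {0..} \<subseteq> K"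
    then show "continuous_on {0..} (\<lambda>t. G t (h t (u t)))"
      using h unfolding tame_def by (intro c) blast
  qed (use k b in auto)
qed

context observer_consts
begin

lemma tame_C_mat:
  assumes "tame K h"
  shows "tame K (\<lambda>t x. C_mat idx a b (h t x) t)"
proof (rule tame_linear_time[OF assms kc(1)])
  fix t :: real and S S' assume t: "0 \<le> t"
  show "norm (C_mat idx a b S t) \<le> kc * norm S"
    unfolding norm_C_mat by (rule kc(2)[OF t])
  have "C_mat idx a b S t - C_mat idx a b S' t = C_mat idx a b (S - S') t"
    by (rule mult_join_eqI)
      (simp add: matrix_vector_mult_diff_rdistrib C_mat_mult_join C_att_diff)
  then show "norm (C_mat idx a b S t - C_mat idx a b S' t) \<le> kc * norm (S - S')"
    by (simp add: norm_C_mat kc(2)[OF t])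
qed (rule C_mat_continuous; simp)

lemma tame_y_err:
  assumes "tame K h"
  shows "tame K (\<lambda>t x. y_err idx a b (h t x) (R t) t)"
proof -
  have "bounded (R ` {0..})" using R_norm by (auto simp: bounded_iff)
  then have "tame K (\<lambda>t x. h t x - R t)"
    by (intro tame_diff assms tame_time R_continuous)
  then show ?thesis
    unfolding y_err_eq
  proof (rule tame_linear_time[OF _ ky(1)])
    fix t :: real and S S' assume t: "0 \<le> t"
    show "norm (y_stack idx a b S t) \<le> ky * norm S" by (rule ky(2)[OF t])
    show "norm (y_stack idx a b S t - y_stack idx a b S' t) \<le> ky * norm (S - S')"
      using ky(2)[OF t, of "S - S'"] by (simp add: linear_diff[OF y_stack_linear])
  qed (rule y_stack_continuous; simp)
qed

lemma tame_Q: "tame K (\<lambda>t x. Q t)" and tame_V: "tame K (\<lambda>t x. V t)"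
  using Q V by (auto intro!: tame_time simp: admissible_weight_def)

definition obs_field :: "real \<Rightarrow> (real^3^3) \<times> (real^3) \<times> (real^(3+3)^(3+3)) \<Rightarrow> (real^3^3) \<times> (real^3) \<times> (real^(3+3)^(3+3))"
  where "obs_field t X =
    (let Rh = fst X; dh = fst (snd X); P = snd (snd X); i = innovation idx a b Q (R t) Rh P t in
     (Rh ** skew ((\<Omega> t + d) - dh) + skew (upper_part i) ** Rh, - lower_part i,
      riccati_rhs (A_mat Rh) (C_mat idx a b Rh t) (Q t) (V t) P))"

text \<open>The field is polynomial in the state with bounded continuous coefficients, hence bounded
  and Lipschitz on bounded sets, though not globally.\<close>

lemma tame_obs_field:
  assumes K: "bounded K"
  shows "tame K obs_field"
proof -
  note mm = tame_bilinear[OF bounded_bilinear_matrix_mult]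
    and mv = tame_bilinear[OF bounded_bilinear_mult_vec]
    and tr = tame_linear[OF bounded_linear_transpose] and sk = tame_linear[OF bounded_linear_skew]
  have Rh: "tame K (\<lambda>t x. fst x)" and dh: "tame K (\<lambda>t x. fst (snd x))" and P: "tame K (\<lambda>t x. snd (snd x))"
    by (intro tame_state[OF K] bounded_linear_fst bounded_linear_fst_comp bounded_linear_snd_comp
        bounded_linear_snd)+
  have \<Omega>d: "tame K (\<lambda>t x. \<Omega> t + d)"
    by (intro tame_add tame_const tame_time \<Omega>)
  note C = tame_C_mat[OF Rh]
  have i: "tame K (\<lambda>t x. innovation idx a b Q (R t) (fst x) (snd (snd x)) t)"
    unfolding innovation_def by (intro tame_minus mv mm tr P C tame_Q tame_y_err Rh)
  have A: "tame K (\<lambda>t x. A_mat (fst x))"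
    by (rule tame_linear[OF bounded_linear_A_mat Rh])
  show ?thesis
    unfolding obs_field_def[abs_def] Let_def riccati_rhs_def
    by (intro tame_Pair tame_add tame_diff tame_minus mm sk tr Rh dh P \<Omega>d C A tame_Q tame_V
        tame_linear[OF bounded_linear_upper_part i] tame_linear[OF bounded_linear_lower_part i])
qed

lemma stable_of_consts: "locally_exp_stable idx a b Q V P0 R \<Omega> d"
  unfolding locally_exp_stable_def
proof (rule exI[of _ r0], rule conjI[OF consts_pos(6)], rule exI[of _ c0], rule conjI[OF consts_pos(5)],
    rule exI[of _ \<kappa>], rule conjI[OF consts_pos(4)], intro ballI allI impI conjI)
  fix Rh0 :: "real^3^3" and dh0 :: "real^3"
  assume Rh0: "Rh0 \<in> SO3" and init: "est_error (R 0) d Rh0 dh0 \<le> r0"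
  \<comment> \<open>The radius adds the a priori bounds on the three components, the norm of
    \<open>P0\<close> for the initial state, and 1 for strictness.\<close>
  define \<rho> where "\<rho> = 3 + (norm d + 1) + pM + norm P0 + 1"
  define K where "K = cball (0 :: (real^3^3) \<times> (real^3) \<times> (real^(3+3)^(3+3))) \<rho>"
  have "0 \<le> \<rho>" using consts_pos by (simp add: \<rho>_def)
  then have K: "convex K" "closed K" "K \<noteq> {}" "bounded K" by (auto simp: K_def)
  obtain X where X0: "X 0 = (Rh0, dh0, P0)"
    and X': "\<And>t. 0 \<le> t \<Longrightarrow> (X has_vector_derivative obs_field t (closest_point K (X t))) (at t within {0..})"
    using tame_solution[OF K(1-3) tame_obs_field[OF K(4)]] by blast
  define Rh dh P where "Rh = (\<lambda>t. fst (X t))" and "dh = (\<lambda>t. fst (snd (X t)))" and "P = (\<lambda>t. snd (snd (X t)))"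
  have X_eq: "X t = (Rh t, dh t, P t)" for t by (simp add: Rh_def dh_def P_def)
  have eqs: "(Rh has_vector_derivative (Rh t ** skew ((\<Omega> t + d) - dh t) +
        skew (upper_part (innovation idx a b Q (R t) (Rh t) (P t) t)) ** Rh t)) (at t within {0..})"
    "(dh has_vector_derivative - lower_part (innovation idx a b Q (R t) (Rh t) (P t) t)) (at t within {0..})"
    "(P has_vector_derivative riccati_rhs (A_mat (Rh t)) (C_mat idx a b (Rh t) t) (Q t) (V t) (P t)) (at t within {0..})"
    if "0 \<le> t" "norm (X t) \<le> \<rho>" for t
  proof -
    have "closest_point K (X t) = X t"
      using that by (intro closest_point_self) (simp add: K_def)
    then have D: "(X has_vector_derivative obs_field t (X t)) (at t within {0..})"
      using X'[OF that(1)] by simp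
    note D2 = bounded_linear.has_vector_derivative[OF bounded_linear_snd D]
    from bounded_linear.has_vector_derivative[OF bounded_linear_fst D]
      bounded_linear.has_vector_derivative[OF bounded_linear_fst D2]
      bounded_linear.has_vector_derivative[OF bounded_linear_snd D2]
    show "(Rh has_vector_derivative (Rh t ** skew ((\<Omega> t + d) - dh t) +
        skew (upper_part (innovation idx a b Q (R t) (Rh t) (P t) t)) ** Rh t)) (at t within {0..})"
      "(dh has_vector_derivative - lower_part (innovation idx a b Q (R t) (Rh t) (P t) t)) (at t within {0..})"
      "(P has_vector_derivative riccati_rhs (A_mat (Rh t)) (C_mat idx a b (Rh t) t) (Q t) (V t) (P t)) (at t within {0..})"
      by (simp_all add: obs_field_def Let_def Rh_def dh_def P_def)
  qed
  have bound: "norm (X t) < \<rho>" if t: "0 \<le> t" for t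
  proof (rule bootstrap[where g = "\<lambda>s. norm (X s)" and T = t])
    show "continuous_on {0..t} (\<lambda>t. norm (X t))"
      by (intro continuous_intros continuous_on_subset[OF has_vector_derivative_continuous_on[OF X']]) auto
    have nX: "norm (X s) \<le> norm (Rh s) + (norm (dh s) + norm (P s))" for s
      unfolding X_eq by (intro order_trans[OF norm_Pair_le] add_left_mono norm_Pair_le)
    have "norm (d - dh0) \<le> 1"
    proof -
      have "norm (d - dh0) \<le> r0" using init norm_ge_zero[of "Rh0 ** transpose (R 0) - mat 1"]
        unfolding est_error_def by linarith
      also have "r0 \<le> 1" using consts_pos(7) by (simp add: \<epsilon>1_def)
      finally show ?thesis .
    qed
    then have "norm dh0 \<le> norm d + 1"
      using norm_triangle_ineq2[of dh0 d] by (simp add: norm_minus_commute)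
    moreover have "norm Rh0 \<le> 3" by (intro norm_orthogonal_le SO3_orthogonal Rh0)
    ultimately show "norm (X 0) < \<rho>"
      using nX[of 0] X0 X_eq[of 0] consts_pos(2) by (simp add: \<rho>_def)
    fix \<tau> assume \<tau>: "\<tau> \<in> {0..t}" and le: "\<And>s. s \<in> {0..\<tau>} \<Longrightarrow> norm (X s) \<le> \<rho>"
    \<comment> \<open>While the state stays in the ball, the projection is the identity and the
      truncated solution satisfies the observer equations; the a priori bounds then keep it strictly
      inside.\<close>
    interpret tr: observer_traj p n idx a b R \<Omega> d Q V P0 \<delta> \<mu> kc ky kq kv q v \<mu>' p0 pm eps Rh dh P \<tau>
      using \<tau> eqs le Rh0 X0 X_eq[of 0] by unfold_locales auto
    have "tr.err 0 \<le> r0" using init X0 X_eq[of 0] by (simp add: tr.err_def)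
    from tr.a_priori[OF this, of \<tau>] \<tau>
    have "norm (P \<tau>) \<le> pM" "norm (Rh \<tau>) \<le> 3" "norm (dh \<tau>) \<le> norm d + 1" by auto
    with nX[of \<tau>] show "norm (X \<tau>) < \<rho>"
      using norm_ge_zero[of P0] unfolding \<rho>_def by linarith
  qed (use t in simp)
  show "\<exists>Rh dh P. observer_solution idx a b Q V R \<Omega> d Rh dh P \<and> Rh 0 = Rh0 \<and> dh 0 = dh0 \<and> P 0 = P0"
  proof (intro exI conjI)
    show "observer_solution idx a b Q V R \<Omega> d Rh dh P"
      unfolding observer_solution_def using eqs bound by (meson less_imp_le)
  qed (use X0 in \<open>simp_all add: Rh_def dh_def P_def\<close>)
next
  fix Rh0 :: "real^3^3" and dh0 :: "real^3" and Rh dh P and t :: real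
  assume Rh0: "Rh0 \<in> SO3" and init: "est_error (R 0) d Rh0 dh0 \<le> r0" and t: "0 \<le> t"
    and sol: "observer_solution idx a b Q V R \<Omega> d Rh dh P \<and> Rh 0 = Rh0 \<and> dh 0 = dh0 \<and> P 0 = P0"
  interpret tr: observer_traj p n idx a b R \<Omega> d Q V P0 \<delta> \<mu> kc ky kq kv q v \<mu>' p0 pm eps Rh dh P t
    using sol Rh0 t by unfold_locales (auto simp: observer_solution_def)
  have "tr.err 0 \<le> r0" using init sol by (simp add: tr.err_def)
  from tr.a_priori(1)[OF this, of t] t sol
  show "est_error (R t) d (Rh t) (dh t) \<le> c0 * exp (- \<kappa> * t) * est_error (R 0) d Rh0 dh0"
    by (simp add: tr.err_def)
qed

end

context observer_data
begin

lemma weight_bounds: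
  assumes "admissible_weight M"
  obtains e k where "0 < e" "\<And>t. 0 \<le> t \<Longrightarrow> sym_mat (M t)" "\<And>t. 0 \<le> t \<Longrightarrow> norm (M t) \<le> k"
    "\<And>t y. 0 \<le> t \<Longrightarrow> e * norm y^2 \<le> y \<bullet> (M t *v y)"
proof -
  obtain e where e: "0 < e" "\<And>t. 0 \<le> t \<Longrightarrow> M t \<succeq> e *\<^sub>R mat 1"
    using assms by (auto simp: admissible_weight_def)
  obtain k where k: "\<And>t. 0 \<le> t \<Longrightarrow> norm (M t) \<le> k"
    using assms by (auto simp: admissible_weight_def bounded_iff)
  show thesis
    by (rule that[OF e(1) loewner_ge_scaled_mat(1)[OF e(2)] k loewner_ge_scaled_mat(2)[OF e(2)]])
qed

lemma stable: "locally_exp_stable idx a b Q V P0 R \<Omega> d"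
proof -
  obtain kc where kc: "0 \<le> kc" "\<And>S t. 0 \<le> t \<Longrightarrow> norm (C1 S t) \<le> kc * norm S"
    using C1_bound by blast
  obtain ky where ky: "0 \<le> ky" "\<And>S t. 0 \<le> t \<Longrightarrow> norm (y_stack idx a b S t) \<le> ky * norm S"
    using y_stack_bound by blast
  obtain q kq where q: "0 < q" "\<And>t. 0 \<le> t \<Longrightarrow> sym_mat (Q t)" "\<And>t. 0 \<le> t \<Longrightarrow> norm (Q t) \<le> kq"
      "\<And>t y. 0 \<le> t \<Longrightarrow> q * norm y^2 \<le> y \<bullet> (Q t *v y)"
    using weight_bounds[OF Q] by blast
  obtain v kv where v: "0 < v" "\<And>t. 0 \<le> t \<Longrightarrow> sym_mat (V t)" "\<And>t. 0 \<le> t \<Longrightarrow> norm (V t) \<le> kv"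
      "\<And>t y. 0 \<le> t \<Longrightarrow> v * norm y^2 \<le> y \<bullet> (V t *v y)"
    using weight_bounds[OF V] by blast
  obtain \<mu>' where \<mu>': "0 < \<mu>'" "\<And>t u w. 0 \<le> t \<Longrightarrow> \<mu>' * (norm u^2 + norm w^2) \<le>
      (1 / \<delta>) * integral {t..t+\<delta>} (\<lambda>s. norm (C1 (R s) s *v (u + integral {t..s} R *v w))^2)"
    using gram_lower by blast
  obtain p0 where p0: "0 < p0" "\<And>x. p0 * norm x^2 \<le> x \<bullet> (P0 *v x)"
    using pos_def_coercive[OF P0] by blast
  define k where "k = kc * 3 * kq * (kc * 3)"
  have "0 \<le> kq" using order_trans[OF norm_ge_zero q(3)[of 0]] by simp
  then have k: "0 \<le> k" using kc(1) by (simp add: k_def)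
  \<comment> \<open>\<open>p0 / 2\<close> gives \<open>pm < p0\<close>; for
    \<open>pm \<le> 1\<close> the smallness expression is at most \<open>pm * (6 + k)\<close>, which
    the last entry keeps below \<open>v\<close>.\<close>
  define pm where "pm = min (p0 / 2) (min 1 (v / (2 * (6 + k))))"
  have "0 < v / (2 * (6 + k))" using v(1) k by simp
  moreover have "pm \<le> p0 / 2" "pm \<le> 1" "pm \<le> v / (2 * (6 + k))"
    unfolding pm_def by linarith+
  ultimately have pm: "0 < pm" "pm < p0" "pm \<le> 1" "pm \<le> v / (2 * (6 + k))"
    using p0(1) by (auto simp: pm_def)
  have "pm^2 * k \<le> pm * k"
    using pm k by (intro mult_right_mono) (auto simp: power2_eq_square intro: mult_left_le)
  then have "2 * pm * 3 + pm^2 * k \<le> pm * (6 + k)" by (simp add: algebra_simps)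
  also have "\<dots> \<le> v / (2 * (6 + k)) * (6 + k)"
    using pm k by (intro mult_right_mono) auto
  also have "\<dots> = v / 2" using k by (simp add: field_simps)
  also have "\<dots> < v" using v(1) by simp
  finally have pm3: "2 * pm * 3 + pm^2 * k < v" .
  define j where "j = kc * (1 + 3 * \<delta>) + kc * 3 * \<delta>"
  have j: "0 \<le> j" using kc(1) \<delta> by (simp add: j_def)
  \<comment> \<open>Makes \<open>eps * j\<close> at most half the root of \<mu>'; the added 1 covers
    \<open>j = 0\<close>.\<close>
  define eps where "eps = sqrt \<mu>' / (2 * (j + 1))"
  have eps: "0 < eps" using \<mu>'(1) j by (simp add: eps_def)
  have "eps * j \<le> sqrt \<mu>' / 2"
    using j \<mu>'(1) by (simp add: eps_def field_simps)
  then have "(eps * j)^2 \<le> (sqrt \<mu>' / 2)^2"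
    using eps j by (intro power_mono) auto
  then have eps2: "(eps * j)^2 * 4 \<le> \<mu>'"
    using \<mu>'(1) by (simp add: power_divide)
  interpret observer_consts p n idx a b R \<Omega> d Q V P0 \<delta> \<mu> kc ky kq kv q v \<mu>' p0 pm eps
    by unfold_locales (fact kc ky q v \<mu>' p0(2) pm(1,2) pm3[unfolded k_def] eps eps2[unfolded j_def])+
  show ?thesis by (rule stable_of_consts)
qed

end

theorem lemma2:
  fixes p :: nat and n :: "nat \<Rightarrow> nat"
    and idx :: "'m::finite \<Rightarrow> nat \<times> nat"
    and a :: "nat \<Rightarrow> nat \<Rightarrow> real \<Rightarrow> real^3" and b :: "nat \<Rightarrow> real \<Rightarrow> real^3"
    and R :: "real \<Rightarrow> real^3^3" and \<Omega> :: "real \<Rightarrow> real^3" and d :: "real^3"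
    and Q :: "real \<Rightarrow> real^'m^'m" and V :: "real \<Rightarrow> real^(3+3)^(3+3)"
    and P0 :: "real^(3+3)^(3+3)"
    and \<delta> \<mu> :: real
  assumes "\<And>i. i \<in> {1..p} \<Longrightarrow> 1 \<le> n i"
    and "stacking p n idx"
    and "\<And>t. 0 \<le> t \<Longrightarrow> R t \<in> SO3"
    and "\<And>t. 0 \<le> t \<Longrightarrow> (R has_vector_derivative (R t ** skew (\<Omega> t))) (at t within {0..})"
    and "continuous_on {0..} \<Omega>" and "bounded (\<Omega> ` {0..})"
    and "\<And>i j. i \<in> {1..p} \<Longrightarrow> j \<in> {1..n i} \<Longrightarrow>
           uniformly_continuous_on {0..} (a i j) \<and> bounded (a i j ` {0..})"
    and "\<And>i. i \<in> {1..p} \<Longrightarrow>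
           uniformly_continuous_on {0..} (b i) \<and> bounded (b i ` {0..})"
    and "admissible_weight Q" and "admissible_weight V"
    and "pos_def P0"
    and "0 < \<delta>" and "0 < \<mu>"
    and "\<And>t. 0 \<le> t \<Longrightarrow> W_lam p n a b R t \<delta> \<succeq> \<mu> *\<^sub>R mat 1"
    and "\<And>t. 0 \<le> t \<Longrightarrow> W_bar p n a b R t \<delta> \<succeq> \<mu> *\<^sub>R mat 1"
  shows "uniformly_observable (\<lambda>t. A_mat (R t)) (\<lambda>t. C_mat idx a b (R t) t) \<and>
         locally_exp_stable idx a b Q V P0 R \<Omega> d"
proof -
  interpret observer_data p n idx a b R \<Omega> d Q V P0 \<delta> \<mu>
    by unfold_locales
      (use assms in \<open>auto intro: uniformly_continuous_imp_continuous simp del: One_nat_def\<close>)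
  show ?thesis using observable stable by blast
qed

end
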